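(* Let $U$ be a real analytic function, $\sigma$ a real analytic one-form and $g=(g_{ij})$ a real analytic Riemannian metric on a neighbourhood of the origin $p=0$ in $\mathbb{R}^n$, with $U(0)=0$, $d_0U=0$, $g_{ij}(0)=\delta_{ij}$, and $U$ not a homogeneous polynomial. Write the first and second non-zero homogeneous terms of the Maclaurin series $$U=U_{l_1}+U_{l_2}+\cdots,\qquad g_{ij}=\delta_{ij}+g^{(m)}_{ij}+\cdots,$$ let $\kappa=\min\{l_2-l_1,\,m\}$, and assume that the degree $d$ of the first non-zero jet of the magnetic potential $\sigma$ at $p$ verifies $d-l_1/2>\kappa$. Let $f=U_{l_1}|_{S^{n-1}}$ and $$\mathcal{C}(q)=-\delta_\kappa^{\,l_2-l_1}(l_2-l_1)\,U_{l_2}(q)+\delta_\kappa^{\,m}\,m\,U_{l_1}(q)\sum_{i,j=1}^n g^{(m)}_{ij}(q)\,q^iq^j,\qquad q\in S^{n-1}.$$ Suppose that $\mathcal{C}(q)>0$ at every critical point $q$ of $f$ such that $f(q)\le0$. Then there is a neighbourhood $B$ of $p$ in configuration space such that, for any positive orbit $\mathcal{O}^+(z)$ of the Lagrangian system $L(x,v)=\tfrac12g_x(v,v)+\sigma_x(v)-U(x)$ verifying $$\mathcal{O}^+(z)\subset TB,\qquad H(z)\le0,$$ its omega-limit set contains $\mathbf{0}=(p,0)$. In particular, $H(z)=0$.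
   Context: Here $l_1<l_2$ are the degrees of the first and second non-zero homogeneous terms of $U$ (so $l_1\ge2$), and $m\ge1$ is the smallest positive degree in which some $g_{ij}$ has a non-zero homogeneous term; $g^{(m)}_{ij}$ is the degree-$m$ homogeneous part of $g_{ij}$. If the metric is Euclidean, formally $m=\infty$ (so $\kappa=l_2-l_1$ and the second term of $\mathcal{C}$ is absent). $\delta_a^b$ is the Kronecker delta. $d$ is the smallest degree of a non-zero homogeneous Taylor term of the coefficients of $\sigma$; if the germ of $\sigma$ is zero, the condition on $d$ is considered satisfied. $S^{n-1}$ is the Euclidean unit sphere. The Euler–Lagrange flow is given by $\dot x=v$, $\nabla_{\dot x}v=-\mathrm{grad}_gU(x)-\mathcal{R}_x(\iota_vd\sigma(x))$, where $\nabla$ is the Levi-Civita connection and $\mathcal{R}_x$ is Riesz duality from covectors to vectors. The energy $H(x,v)=\tfrac12g_x(v,v)+U(x)$ is constant along orbits. $\mathcal{O}^+(z)$ is the positive orbit of $z$. *)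

theory Defs
  imports "HOL-Analysis.Analysis"
begin

subsection \<open>Real analytic functions and their homogeneous Maclaurin terms\<close>

definition monomial_fun :: "('n \<Rightarrow> nat) \<Rightarrow> real ^ 'n \<Rightarrow> real" where
  "monomial_fun \<alpha> x = (\<Prod>i\<in>UNIV. (x $ i) ^ \<alpha> i)"

definition has_power_series_at ::
    "(real ^ 'n \<Rightarrow> real) \<Rightarrow> real ^ 'n \<Rightarrow> (('n \<Rightarrow> nat) \<Rightarrow> real) \<Rightarrow> bool" where
  "has_power_series_at f a c \<longleftrightarrow>
     (\<exists>r>0. \<forall>x\<in>ball a r. ((\<lambda>\<alpha>. c \<alpha> * monomial_fun \<alpha> (x - a)) has_sum f x) UNIV)"

definition real_analytic_on :: "(real ^ 'n \<Rightarrow> real) \<Rightarrow> (real ^ 'n) set \<Rightarrow> bool"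
    (infixl "(real'_analytic'_on)" 50) where
  "f real_analytic_on W \<longleftrightarrow> (\<forall>a\<in>W. \<exists>c. has_power_series_at f a c)"

definition maclaurin_coeff :: "(real ^ 'n \<Rightarrow> real) \<Rightarrow> ('n \<Rightarrow> nat) \<Rightarrow> real" where
  "maclaurin_coeff f = (SOME c. has_power_series_at f 0 c)"
  \<comment> \<open>for \<open>f\<close> analytic at \<open>0\<close> such a \<open>c\<close> exists and is unique\<close>

definition hom_poly :: "(('n::finite \<Rightarrow> nat) \<Rightarrow> real) \<Rightarrow> nat \<Rightarrow> real ^ 'n \<Rightarrow> real" where
  "hom_poly c k x = (\<Sum>\<alpha> | (\<Sum>i\<in>UNIV. \<alpha> i) = k. c \<alpha> * monomial_fun \<alpha> x)"

definition hom_term :: "(real ^ 'n \<Rightarrow> real) \<Rightarrow> nat \<Rightarrow> real ^ 'n \<Rightarrow> real" where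
  "hom_term f k = hom_poly (maclaurin_coeff f) k"

definition nonzero_degrees :: "(real ^ 'n \<Rightarrow> real) \<Rightarrow> nat set" where
  "nonzero_degrees f = {k. hom_term f k \<noteq> (\<lambda>_. 0)}"

text \<open>Being a homogeneous polynomial is a property of the germ at the origin; the zero germ
  is included.\<close>

definition homogeneous_poly_germ :: "(real ^ 'n \<Rightarrow> real) \<Rightarrow> bool" where
  "homogeneous_poly_germ f \<longleftrightarrow> (\<exists>c k. \<forall>\<^sub>F x in nhds 0. f x = hom_poly c k x)"

definition first_degree :: "(real ^ 'n \<Rightarrow> real) \<Rightarrow> nat" where
  "first_degree f = (LEAST k. k \<in> nonzero_degrees f)"

definition second_degree :: "(real ^ 'n \<Rightarrow> real) \<Rightarrow> nat" where
  "second_degree f = (LEAST k. k \<in> nonzero_degrees f \<and> first_degree f < k)"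

text \<open>These two degrees are \<open>\<infinity>\<close> (the infimum of the empty set) if the metric is
  Euclidean near the origin, respectively if the germ of the one-form vanishes.\<close>

definition metric_degree :: "(real ^ 'n \<Rightarrow> real ^ 'n ^ 'n) \<Rightarrow> enat" where
  "metric_degree g = Inf (enat ` {k. 1 \<le> k \<and> (\<exists>i j. k \<in> nonzero_degrees (\<lambda>x. g x $ i $ j))})"

definition one_form_degree :: "(real ^ 'n \<Rightarrow> real ^ 'n) \<Rightarrow> enat" where
  "one_form_degree \<sigma> = Inf (enat ` {k. \<exists>i. k \<in> nonzero_degrees (\<lambda>x. \<sigma> x $ i)})"

text \<open>A critical point of the restriction of \<open>f\<close> to the Euclidean unit sphere: the differential
  of \<open>f\<close> vanishes on the tangent space, which is the orthogonal complement of the point.\<close>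

definition sphere_critical_point :: "(real ^ 'n \<Rightarrow> real) \<Rightarrow> real ^ 'n \<Rightarrow> bool" where
  "sphere_critical_point f q \<longleftrightarrow> q \<in> sphere 0 1 \<and> f differentiable at q \<and>
     (\<forall>w. q \<bullet> w = 0 \<longrightarrow> frechet_derivative f (at q) w = 0)"


subsection \<open>Riemannian metrics and one-forms in coordinates\<close>

definition riemannian_metric_on :: "(real ^ 'n \<Rightarrow> real ^ 'n ^ 'n) \<Rightarrow> (real ^ 'n) set \<Rightarrow> bool" where
  "riemannian_metric_on g W \<longleftrightarrow>
     (\<forall>x\<in>W. transpose (g x) = g x \<and> (\<forall>v. v \<noteq> 0 \<longrightarrow> 0 < v \<bullet> (g x *v v)))"

definition partial_deriv :: "'n \<Rightarrow> (real ^ 'n \<Rightarrow> real) \<Rightarrow> real ^ 'n \<Rightarrow> real" where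
  "partial_deriv i f x = frechet_derivative f (at x) (axis i 1)"

definition riesz :: "(real ^ 'n \<Rightarrow> real ^ 'n ^ 'n) \<Rightarrow> real ^ 'n \<Rightarrow> real ^ 'n \<Rightarrow> real ^ 'n" where
  "riesz g x \<beta> = matrix_inv (g x) *v \<beta>"

definition riem_grad :: "(real ^ 'n \<Rightarrow> real ^ 'n ^ 'n) \<Rightarrow> (real ^ 'n \<Rightarrow> real) \<Rightarrow> real ^ 'n \<Rightarrow> real ^ 'n" where
  "riem_grad g U x = riesz g x (\<chi> i. partial_deriv i U x)"

text \<open>\<open>\<iota>\<^sub>v d\<sigma>\<close>, with \<open>d\<sigma> = \<Sum>\<^sub>j\<^sub>i \<partial>\<^sub>j\<sigma>\<^sub>i dx\<^sup>j \<and> dx\<^sup>i\<close>.\<close>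

definition contract_d :: "(real ^ 'n \<Rightarrow> real ^ 'n) \<Rightarrow> real ^ 'n \<Rightarrow> real ^ 'n \<Rightarrow> real ^ 'n" where
  "contract_d \<sigma> x v =
     (\<chi> i. \<Sum>j\<in>UNIV. (partial_deriv j (\<lambda>y. \<sigma> y $ i) x - partial_deriv i (\<lambda>y. \<sigma> y $ j) x) * v $ j)"

text \<open>\<open>christoffel g x k i j\<close> is \<open>\<Gamma>\<^sup>k\<^sub>i\<^sub>j(x)\<close> for the Levi-Civita connection of \<open>g\<close>.\<close>

definition christoffel :: "(real ^ 'n \<Rightarrow> real ^ 'n ^ 'n) \<Rightarrow> real ^ 'n \<Rightarrow> 'n \<Rightarrow> 'n \<Rightarrow> 'n \<Rightarrow> real" where
  "christoffel g x k i j = (1/2) * (\<Sum>l\<in>UNIV. matrix_inv (g x) $ k $ l *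
     (partial_deriv i (\<lambda>y. g y $ j $ l) x + partial_deriv j (\<lambda>y. g y $ i $ l) x
      - partial_deriv l (\<lambda>y. g y $ i $ j) x))"

text \<open>The covariant derivative, in direction \<open>u\<close>, of a vector field along a curve that passes
  through \<open>x\<close> with velocity \<open>u\<close>; the field has value \<open>v\<close> and coordinate derivative \<open>a\<close> there.\<close>

definition cov_deriv ::
    "(real ^ 'n \<Rightarrow> real ^ 'n ^ 'n) \<Rightarrow> real ^ 'n \<Rightarrow> real ^ 'n \<Rightarrow> real ^ 'n \<Rightarrow> real ^ 'n \<Rightarrow> real ^ 'n" where
  "cov_deriv g x u v a = a + (\<chi> k. \<Sum>i\<in>UNIV. \<Sum>j\<in>UNIV. christoffel g x k i j * u $ i * v $ j)"


subsection \<open>The Euler--Lagrange flow\<close>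

definition lagrangian :: "(real ^ 'n \<Rightarrow> real ^ 'n ^ 'n) \<Rightarrow> (real ^ 'n \<Rightarrow> real ^ 'n) \<Rightarrow>
    (real ^ 'n \<Rightarrow> real) \<Rightarrow> real ^ 'n \<Rightarrow> real ^ 'n \<Rightarrow> real" where
  "lagrangian g \<sigma> U x v = (1/2) * (v \<bullet> (g x *v v)) + \<sigma> x \<bullet> v - U x"

definition energy :: "(real ^ 'n \<Rightarrow> real ^ 'n ^ 'n) \<Rightarrow> (real ^ 'n \<Rightarrow> real) \<Rightarrow>
    ((real ^ 'n) \<times> (real ^ 'n)) \<Rightarrow> real" where
  "energy g U z = (1/2) * (snd z \<bullet> (g (fst z) *v snd z)) + U (fst z)"

definition el_equation :: "(real ^ 'n \<Rightarrow> real ^ 'n ^ 'n) \<Rightarrow> (real ^ 'n \<Rightarrow> real ^ 'n) \<Rightarrow>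
    (real ^ 'n \<Rightarrow> real) \<Rightarrow> real ^ 'n \<Rightarrow> real ^ 'n \<Rightarrow> real ^ 'n \<Rightarrow> bool" where
  "el_equation g \<sigma> U x v a \<longleftrightarrow>
     cov_deriv g x v v a = - riem_grad g U x - riesz g x (contract_d \<sigma> x v)"

text \<open>\<open>el_flow W g \<sigma> U z t w\<close>: the flow on \<open>TW = W \<times> \<real>\<^sup>n\<close> carries \<open>z\<close> to \<open>w\<close> in time \<open>t \<ge> 0\<close>.
  As the data are not complete in general, it is a relation: for given \<open>z\<close> it holds for the
  times \<open>t\<close> of the maximal forward interval of existence only.\<close>

definition el_flow :: "(real ^ 'n) set \<Rightarrow> (real ^ 'n \<Rightarrow> real ^ 'n ^ 'n) \<Rightarrow> (real ^ 'n \<Rightarrow> real ^ 'n) \<Rightarrow>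
    (real ^ 'n \<Rightarrow> real) \<Rightarrow> ((real ^ 'n) \<times> (real ^ 'n)) \<Rightarrow> real \<Rightarrow> ((real ^ 'n) \<times> (real ^ 'n)) \<Rightarrow> bool" where
  "el_flow W g \<sigma> U z t w \<longleftrightarrow> 0 \<le> t \<and>
     (\<exists>x v. (x 0, v 0) = z \<and> (x t, v t) = w \<and>
        (\<forall>s\<in>{0..t}. x s \<in> W \<and> (x has_vector_derivative v s) (at s within {0..t}) \<and>
           (\<exists>a. (v has_vector_derivative a) (at s within {0..t}) \<and>
                el_equation g \<sigma> U (x s) (v s) a)))"

definition positive_orbit :: "(real ^ 'n) set \<Rightarrow> (real ^ 'n \<Rightarrow> real ^ 'n ^ 'n) \<Rightarrow> (real ^ 'n \<Rightarrow> real ^ 'n) \<Rightarrow>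
    (real ^ 'n \<Rightarrow> real) \<Rightarrow> ((real ^ 'n) \<times> (real ^ 'n)) \<Rightarrow> ((real ^ 'n) \<times> (real ^ 'n)) set" where
  "positive_orbit W g \<sigma> U z = {w. \<exists>t\<ge>0. el_flow W g \<sigma> U z t w}"

text \<open>The omega-limit set is empty if the orbit is not defined for all positive times.\<close>

definition omega_limit :: "(real ^ 'n) set \<Rightarrow> (real ^ 'n \<Rightarrow> real ^ 'n ^ 'n) \<Rightarrow> (real ^ 'n \<Rightarrow> real ^ 'n) \<Rightarrow>
    (real ^ 'n \<Rightarrow> real) \<Rightarrow> ((real ^ 'n) \<times> (real ^ 'n)) \<Rightarrow> ((real ^ 'n) \<times> (real ^ 'n)) set" where
  "omega_limit W g \<sigma> U z = (\<Inter>s\<in>{0..}. closure {w. \<exists>t\<ge>s. el_flow W g \<sigma> U z t w})"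


subsection \<open>Relation to the Lagrangian\<close>

lemma partial_derivI:
  assumes "(f has_derivative D) (at x)"
  shows "partial_deriv i f x = D (axis i 1)"
  using assms by (simp add: partial_deriv_def frechet_derivative_at[symmetric])

lemma has_derivative_partials:
  assumes "f differentiable at x"
  shows "(f has_derivative (\<lambda>h. \<Sum>k\<in>UNIV. partial_deriv k f x * h $ k)) (at x)"
proof -
  obtain D where D: "(f has_derivative D) (at x)"
    using assms by (auto simp: differentiable_def)
  interpret linear D using D has_derivative_linear by blast
  have "D h = (\<Sum>k\<in>UNIV. partial_deriv k f x * h $ k)" for h
  proof -
    have "D h = D (\<Sum>k\<in>UNIV. h $ k *\<^sub>R axis k 1)"
      using basis_expansion[of h] by (simp add: scalar_mult_eq_scaleR)
    then show ?thesis
      by (simp add: sum scaleR partial_derivI[OF D] mult.commute)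
  qed
  then show ?thesis using D by presburger
qed

lemma lagrangian_sum:
  "lagrangian g \<sigma> U x v =
     (1/2) * (\<Sum>j\<in>UNIV. \<Sum>k\<in>UNIV. g x $ j $ k * v $ j * v $ k) + (\<Sum>j\<in>UNIV. \<sigma> x $ j * v $ j) - U x"
  by (simp add: lagrangian_def inner_vec_def matrix_vector_mult_def sum_distrib_left mult_ac)

lemma lagrangian_partial_velocity:
  assumes "transpose (g x) = g x"
  shows "partial_deriv i (lagrangian g \<sigma> U x) v = (\<Sum>j\<in>UNIV. g x $ i $ j * v $ j) + \<sigma> x $ i"
proof -
  have sym: "g x $ j $ k = g x $ k $ j" for j k
    using arg_cong[OF assms, of "\<lambda>A. A $ k $ j"] by (simp add: transpose_def)
  have "(lagrangian g \<sigma> U x has_derivative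
     (\<lambda>h. (1/2) * (\<Sum>j\<in>UNIV. \<Sum>k\<in>UNIV. g x $ j $ k * (h $ j * v $ k + v $ j * h $ k))
        + (\<Sum>j\<in>UNIV. \<sigma> x $ j * h $ j))) (at v)"
  proof -
    have nth: "((\<lambda>u :: real ^ 'a. u $ j) has_derivative (\<lambda>h. h $ j)) (at v)" for j
      by (rule bounded_linear_imp_has_derivative) (rule bounded_linear_vec_nth)
    show ?thesis
      unfolding lagrangian_sum
      by (rule has_derivative_eq_rhs,
          (rule has_derivative_diff has_derivative_add has_derivative_mult_right has_derivative_sum
            has_derivative_mult has_derivative_const nth)+)
        (simp add: distrib_left mult_ac add.commute)
  qed
  from partial_derivI[OF this, of i]
  have "partial_deriv i (lagrangian g \<sigma> U x) v = (1/2) *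
      ((\<Sum>j\<in>UNIV. \<Sum>k\<in>UNIV. if j = i then g x $ i $ k * v $ k else 0)
        + (\<Sum>j\<in>UNIV. \<Sum>k\<in>UNIV. if k = i then g x $ j $ i * v $ j else 0))
      + (\<Sum>j\<in>UNIV. if j = i then \<sigma> x $ i else 0)"
    unfolding sum.distrib[symmetric]
    by (elim trans) (intro arg_cong2[where f = "(+)"] arg_cong2[where f = "(*)"] refl sum.cong; auto simp: axis_def)
  moreover have "(\<Sum>j\<in>UNIV. \<Sum>k\<in>UNIV. if j = i then g x $ i $ k * v $ k else 0) = (\<Sum>k\<in>UNIV. g x $ i $ k * v $ k)"
    by (subst sum.swap) simp
  ultimately show ?thesis
    by (simp add: sym[of _ i])
qed


lemma lagrangian_partial_position:
  assumes "\<And>j k. (\<lambda>y. g y $ j $ k) differentiable at x"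
    and "\<And>j. (\<lambda>y. \<sigma> y $ j) differentiable at x" and "U differentiable at x"
  shows "partial_deriv i (\<lambda>y. lagrangian g \<sigma> U y v) x =
     (1/2) * (\<Sum>j\<in>UNIV. \<Sum>k\<in>UNIV. partial_deriv i (\<lambda>y. g y $ j $ k) x * v $ j * v $ k)
     + (\<Sum>j\<in>UNIV. partial_deriv i (\<lambda>y. \<sigma> y $ j) x * v $ j) - partial_deriv i U x"
proof -
  have D: "(f has_derivative frechet_derivative f (at x)) (at x)" if "f differentiable at x"
    for f :: "real ^ 'a \<Rightarrow> real"
    using that frechet_derivative_works by blast
  have "((\<lambda>y. lagrangian g \<sigma> U y v) has_derivative (\<lambda>h.
      (1/2) * (\<Sum>j\<in>UNIV. \<Sum>k\<in>UNIV. frechet_derivative (\<lambda>y. g y $ j $ k) (at x) h * v $ j * v $ k)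
     + (\<Sum>j\<in>UNIV. frechet_derivative (\<lambda>y. \<sigma> y $ j) (at x) h * v $ j) - frechet_derivative U (at x) h)) (at x)"
    unfolding lagrangian_sum
    by (auto intro!: derivative_eq_intros D assms)
  then show ?thesis
    by (simp add: partial_derivI) (simp add: partial_deriv_def)
qed

lemma chain_partials:
  assumes "f differentiable at (x s)" and "(x has_vector_derivative u) (at s within S)"
  shows "((\<lambda>r. f (x r)) has_real_derivative (\<Sum>k\<in>UNIV. partial_deriv k f (x s) * u $ k)) (at s within S)"
proof -
  have "((\<lambda>r. f (x r)) has_derivative (\<lambda>h. \<Sum>k\<in>UNIV. partial_deriv k f (x s) * (h *\<^sub>R u) $ k)) (at s within S)"
    using assms(2) unfolding has_vector_derivative_def
    by (rule has_derivative_compose) (rule has_derivative_partials[OF assms(1)])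
  moreover have "(\<lambda>h. \<Sum>k\<in>UNIV. partial_deriv k f (x s) * (h *\<^sub>R u) $ k)
      = (*) (\<Sum>k\<in>UNIV. partial_deriv k f (x s) * u $ k)"
    by (simp add: fun_eq_iff sum_distrib_left mult_ac)
  ultimately show ?thesis
    by (simp add: has_field_derivative_def)
qed

lemma momentum_derivative:
  assumes "\<And>j k. (\<lambda>y. g y $ j $ k) differentiable at (x s)"
    and "\<And>j. (\<lambda>y. \<sigma> y $ j) differentiable at (x s)"
    and "(x has_vector_derivative v s) (at s within S)" and "(v has_vector_derivative a) (at s within S)"
  shows "((\<lambda>r. (\<Sum>j\<in>UNIV. g (x r) $ i $ j * v r $ j) + \<sigma> (x r) $ i) has_real_derivative
     (\<Sum>j\<in>UNIV. (\<Sum>k\<in>UNIV. partial_deriv k (\<lambda>y. g y $ i $ j) (x s) * v s $ k) * v s $ j + g (x s) $ i $ j * a $ j)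
      + (\<Sum>k\<in>UNIV. partial_deriv k (\<lambda>y. \<sigma> y $ i) (x s) * v s $ k)) (at s within S)"
proof -
  have v: "((\<lambda>r. v r $ j) has_real_derivative a $ j) (at s within S)" for j
    using bounded_linear.has_vector_derivative[OF bounded_linear_vec_nth assms(4)]
    by (simp add: has_real_derivative_iff_has_vector_derivative)
  show ?thesis
    by (auto intro!: derivative_eq_intros chain_partials[OF _ assms(3)] v assms(1,2) simp: algebra_simps)
qed

lemma el_equation_lowered:
  assumes "invertible (g x)" and sym: "\<And>y. y \<in> W \<Longrightarrow> transpose (g y) = g y" and "open W" "x \<in> W"
    and diff: "\<And>j k. (\<lambda>y. g y $ j $ k) differentiable at x"
  shows "el_equation g \<sigma> U x v a \<longleftrightarrow> (\<forall>i.
     (\<Sum>j\<in>UNIV. g x $ i $ j * a $ j) + (\<Sum>j\<in>UNIV. \<Sum>k\<in>UNIV. 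
        (partial_deriv k (\<lambda>y. g y $ i $ j) x - (1/2) * partial_deriv i (\<lambda>y. g y $ j $ k) x) * v $ j * v $ k)
     = - partial_deriv i U x - (\<Sum>j\<in>UNIV. (partial_deriv j (\<lambda>y. \<sigma> y $ i) x - partial_deriv i (\<lambda>y. \<sigma> y $ j) x) * v $ j))"
proof -
  let ?G = "g x" and ?dg = "\<lambda>l j k. partial_deriv l (\<lambda>y. g y $ j $ k) x"
  have inv: "matrix_inv ?G ** ?G = mat 1" "?G ** matrix_inv ?G = mat 1"
    using someI_ex[OF assms(1)[unfolded invertible_def]] by (auto simp: matrix_inv_def)
  have canc: "?G *v p = ?G *v q \<longleftrightarrow> p = q" for p q
    using inv(1) by (metis matrix_vector_mul_assoc matrix_vector_mul_lid)
  have GR: "?G *v riesz g x \<beta> = \<beta>" for \<beta>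
    by (simp add: riesz_def matrix_vector_mul_assoc inv)
  have neg: "?G *v (- p) = - (?G *v p)" for p
    using matrix_vector_mult_diff_distrib[of ?G 0 p] by simp
  have dsym: "?dg l j k = ?dg l k j" for l j k
  proof -
    have eq: "g y $ j $ k = g y $ k $ j" if "y \<in> W" for y
      using arg_cong[OF sym[OF that], of "\<lambda>A. A $ k $ j"] by (simp add: transpose_def)
    show ?thesis
      unfolding partial_deriv_def
      using frechet_derivative_transform_within_open[OF diff assms(3,4) eq] by metis
  qed
  define w where "w = (\<chi> l. (1/2) * (\<Sum>i\<in>UNIV. \<Sum>j\<in>UNIV. (?dg i j l + ?dg j i l - ?dg l i j) * v $ i * v $ j))"
  have "(\<chi> k. \<Sum>i\<in>UNIV. \<Sum>j\<in>UNIV. christoffel g x k i j * v $ i * v $ j) = riesz g x w"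
  proof -
    have "(\<Sum>i\<in>UNIV. \<Sum>j\<in>UNIV. christoffel g x k i j * v $ i * v $ j)
      = (\<Sum>i\<in>UNIV. \<Sum>j\<in>UNIV. \<Sum>l\<in>UNIV. (1/2) * matrix_inv ?G $ k $ l * ((?dg i j l + ?dg j i l - ?dg l i j) * v $ i * v $ j))" for k
      unfolding christoffel_def by (simp add: sum_distrib_left sum_distrib_right mult_ac)
    also have "\<dots> k = (\<Sum>i\<in>UNIV. \<Sum>l\<in>UNIV. \<Sum>j\<in>UNIV. (1/2) * matrix_inv ?G $ k $ l * ((?dg i j l + ?dg j i l - ?dg l i j) * v $ i * v $ j))" for k
      by (rule sum.cong[OF refl], rule sum.swap)
    also have "\<dots> k = (\<Sum>l\<in>UNIV. \<Sum>i\<in>UNIV. \<Sum>j\<in>UNIV. (1/2) * matrix_inv ?G $ k $ l * ((?dg i j l + ?dg j i l - ?dg l i j) * v $ i * v $ j))" for k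
      by (rule sum.swap)
    finally show ?thesis
      by (simp add: vec_eq_iff riesz_def matrix_vector_mult_def w_def sum_distrib_left mult_ac)
  qed
  then have "el_equation g \<sigma> U x v a \<longleftrightarrow>
      ?G *v (a + riesz g x w) = ?G *v (- riem_grad g U x - riesz g x (contract_d \<sigma> x v))"
    unfolding el_equation_def cov_deriv_def canc by simp
  also have "\<dots> \<longleftrightarrow> ?G *v a + w = - (\<chi> i. partial_deriv i U x) - contract_d \<sigma> x v"
    by (simp add: matrix_vector_right_distrib matrix_vector_mult_diff_distrib riem_grad_def GR neg)
  also have "w = (\<chi> i. \<Sum>j\<in>UNIV. \<Sum>k\<in>UNIV. (?dg k i j - (1/2) * ?dg i j k) * v $ j * v $ k)"
  proof -
    define T where "T l = (\<Sum>j\<in>UNIV. \<Sum>k\<in>UNIV. ?dg k l j * v $ j * v $ k)" for l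
    have "(\<Sum>i\<in>UNIV. \<Sum>j\<in>UNIV. ?dg i j l * v $ i * v $ j)
        = (\<Sum>j\<in>UNIV. \<Sum>i\<in>UNIV. ?dg i j l * v $ i * v $ j)" for l
      by (rule sum.swap)
    also have "\<dots> l = T l" for l
      unfolding T_def by (intro sum.cong refl) (simp add: dsym[of _ _ l])
    finally have T1: "(\<Sum>i\<in>UNIV. \<Sum>j\<in>UNIV. ?dg i j l * v $ i * v $ j) = T l" for l .
    have T2: "(\<Sum>i\<in>UNIV. \<Sum>j\<in>UNIV. ?dg j i l * v $ i * v $ j) = T l" for l
      unfolding T_def by (intro sum.cong refl) (simp add: dsym[of _ _ l])
    have "w $ l = T l - (1/2) * (\<Sum>i\<in>UNIV. \<Sum>j\<in>UNIV. ?dg l i j * v $ i * v $ j)" for l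
      by (simp add: w_def ring_distribs sum.distrib sum_subtractf T1 T2)
    moreover have "(\<Sum>j\<in>UNIV. \<Sum>k\<in>UNIV. (?dg k l j - (1/2) * ?dg l j k) * v $ j * v $ k)
        = T l - (1/2) * (\<Sum>i\<in>UNIV. \<Sum>j\<in>UNIV. ?dg l i j * v $ i * v $ j)" for l
      by (simp add: T_def left_diff_distrib sum_subtractf sum_divide_distrib)
    ultimately show ?thesis
      by (simp add: vec_eq_iff)
  qed
  finally show ?thesis
    by (simp add: vec_eq_iff matrix_vector_mult_def contract_d_def)
qed

text \<open>\<open>el_equation\<close> is the Euler--Lagrange equation
  \<open>d/dt (\<partial>L/\<partial>v\<^sub>i) = \<partial>L/\<partial>x\<^sub>i\<close> of the Lagrangian.\<close>

proposition el_equation_iff_euler_lagrange: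
  assumes "open W" and g: "riemannian_metric_on g W"
    and diff: "\<And>j k. (\<lambda>y. g y $ j $ k) differentiable at (x s)"
      "\<And>j. (\<lambda>y. \<sigma> y $ j) differentiable at (x s)" "U differentiable at (x s)"
    and "s \<in> {0..t}" "0 < t" and W: "x ` {0..t} \<subseteq> W"
    and x: "(x has_vector_derivative v s) (at s within {0..t})"
    and v: "(v has_vector_derivative a) (at s within {0..t})"
  shows "el_equation g \<sigma> U (x s) (v s) a \<longleftrightarrow>
    (\<forall>i. ((\<lambda>r. partial_deriv i (lagrangian g \<sigma> U (x r)) (v r)) has_real_derivative
            partial_deriv i (\<lambda>y. lagrangian g \<sigma> U y (v s)) (x s)) (at s within {0..t}))"
proof -
  have sW: "x s \<in> W" using W assms(6) by auto
  have sym: "transpose (g y) = g y" if "y \<in> W" for y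
    using g that by (auto simp: riemannian_metric_on_def)
  have "invertible (g (x s))"
  proof -
    have "u = 0" if "g (x s) *v u = 0" for u
      using g sW that by (metis inner_zero_right less_irrefl riemannian_metric_on_def)
    then show ?thesis
      by (metis invertible_left_inverse matrix_left_invertible_ker)
  qed
  then have low: "el_equation g \<sigma> U (x s) (v s) a \<longleftrightarrow> (\<forall>i.
     (\<Sum>j\<in>UNIV. g (x s) $ i $ j * a $ j) + (\<Sum>j\<in>UNIV. \<Sum>k\<in>UNIV. 
        (partial_deriv k (\<lambda>y. g y $ i $ j) (x s) - (1/2) * partial_deriv i (\<lambda>y. g y $ j $ k) (x s)) * v s $ j * v s $ k)
     = - partial_deriv i U (x s) - (\<Sum>j\<in>UNIV. (partial_deriv j (\<lambda>y. \<sigma> y $ i) (x s) - partial_deriv i (\<lambda>y. \<sigma> y $ j) (x s)) * v s $ j))"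
    using el_equation_lowered[where W = W] sym assms(1) sW diff(1) by blast
  define P where "P i = (\<Sum>j\<in>UNIV. (\<Sum>k\<in>UNIV. partial_deriv k (\<lambda>y. g y $ i $ j) (x s) * v s $ k) * v s $ j + g (x s) $ i $ j * a $ j)
      + (\<Sum>k\<in>UNIV. partial_deriv k (\<lambda>y. \<sigma> y $ i) (x s) * v s $ k)" for i
  have P: "((\<lambda>r. partial_deriv i (lagrangian g \<sigma> U (x r)) (v r)) has_real_derivative P i) (at s within {0..t})" for i
    using momentum_derivative[OF diff(1,2) x v, of i] 
    unfolding P_def
    by (rule has_field_derivative_transform_within[OF _ zero_less_one assms(6)])
       (use W sym in \<open>auto simp: lagrangian_partial_velocity image_subset_iff\<close>)
  have uniq: "((\<lambda>r. partial_deriv i (lagrangian g \<sigma> U (x r)) (v r)) has_real_derivative b) (at s within {0..t}) \<longleftrightarrow> P i = b" for i b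
  proof -
    have "at s within {0..t} \<noteq> bot"
      using assms(6,7) by (simp add: trivial_limit_within islimpt_Icc)
    then show ?thesis using P[of i] vector_derivative_unique_within
      by (metis has_real_derivative_iff_has_vector_derivative)
  qed
  define A T H S S' where "A i = (\<Sum>j\<in>UNIV. g (x s) $ i $ j * a $ j)"
    and "T i = (\<Sum>j\<in>UNIV. \<Sum>k\<in>UNIV. partial_deriv k (\<lambda>y. g y $ i $ j) (x s) * v s $ j * v s $ k)"
    and "H i = (\<Sum>j\<in>UNIV. \<Sum>k\<in>UNIV. partial_deriv i (\<lambda>y. g y $ j $ k) (x s) * v s $ j * v s $ k)"
    and "S i = (\<Sum>j\<in>UNIV. partial_deriv j (\<lambda>y. \<sigma> y $ i) (x s) * v s $ j)"
    and "S' i = (\<Sum>j\<in>UNIV. partial_deriv i (\<lambda>y. \<sigma> y $ j) (x s) * v s $ j)" for i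
  have "P i = T i + A i + S i" for i
    by (simp add: P_def T_def A_def S_def sum.distrib sum_distrib_left mult_ac)
  moreover have "(\<Sum>j\<in>UNIV. \<Sum>k\<in>UNIV. (partial_deriv k (\<lambda>y. g y $ i $ j) (x s)
      - (1/2) * partial_deriv i (\<lambda>y. g y $ j $ k) (x s)) * v s $ j * v s $ k) = T i - (1/2) * H i" for i
    by (simp add: T_def H_def left_diff_distrib sum_subtractf sum_divide_distrib)
  moreover have "(\<Sum>j\<in>UNIV. (partial_deriv j (\<lambda>y. \<sigma> y $ i) (x s)
      - partial_deriv i (\<lambda>y. \<sigma> y $ j) (x s)) * v s $ j) = S i - S' i" for i
    by (simp add: S_def S'_def left_diff_distrib sum_subtractf)
  ultimately show ?thesis
    unfolding low uniq lagrangian_partial_position[OF diff] A_def[symmetric] H_def[symmetric] S'_def[symmetric]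
    by (intro all_cong1) (simp only:, argo)
qed

end

theory Submission
  imports Defs "HOL-Library.Landau_Symbols"
begin

text \<open>Let \<open>N\<close> be the gradient of \<open>U\<^sub>l\<^sub>1\<close> and \<open>k = \<kappa>\<close>. Where \<open>H \<le> 0\<close>, the derivative of the virial
  \<open>\<langle>g v, x\<rangle>\<close> along an orbit is at least \<open>|v|\<^sup>2/2 - (l\<^sub>2 - l\<^sub>1) U\<^sub>l\<^sub>2(x)\<close> up to smaller terms: the metric only
  contributes \<open>O(|x| |v|\<^sup>2)\<close>, and the condition on \<open>d\<close> makes the magnetic term \<open>\<epsilon> |v|\<^sup>2 + o(|x|\<^bsup>l\<^sub>1 + k\<^esup>)\<close>.
  Subtracting \<open>\<eta> |x|\<^bsup>k + 2 - l\<^sub>1\<^esup> \<langle>g v, N(x)\<rangle>\<close> gains \<open>\<eta> |x|\<^bsup>k + 2 - l\<^sub>1\<^esup> |N(x)|\<^sup>2\<close>, a term of the same order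
  \<open>|x|\<^bsup>l\<^sub>1 + k\<^esup>\<close>, and costs \<open>O(|x|\<^bsup>k\<^esup> |v|\<^sup>2)\<close> only. By Euler's identity a zero \<open>q\<close> of \<open>N\<close> on the sphere is a
  critical point of \<open>f\<close> with \<open>f(q) = 0\<close>, so \<open>\<C>(q) > 0\<close> is there the positivity of the \<open>U\<^sub>l\<^sub>2\<close> term; by
  compactness some \<open>\<eta>\<close> makes the derivative of the resulting function \<open>\<Phi>\<close> at least \<open>c |x|\<^bsup>l\<^sub>1 + k\<^esup>\<close>.
  As \<open>|v| = O(|x|)\<close> where \<open>H \<le> 0\<close>, \<open>\<Phi>\<close> is bounded, hence \<open>|x|\<close> cannot stay away from \<open>0\<close>, and when
  \<open>|x|\<close> is small so are \<open>|v|\<close> and the constant \<open>H\<close>. Uniqueness of solutions is never needed: \<open>\<Phi>\<close> may fail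
  to be differentiable at \<open>x = 0\<close>, but an orbit that reaches \<open>x = 0\<close> has \<open>v = 0\<close> there and can be
  continued by the equilibrium.\<close>

subsection \<open>Power series graded by degree\<close>

text \<open>Along an orbit the virial has derivative Q - x . dU plus errors, with Q = <g v, v>.
  Because U <= -Q/2 <= 0, the quantity l1 U can be added at no cost, and Euler's identity turns l1 U
  - x . dU into -(l2 - l1) times the term of degree l2 plus higher order. No part of Q >= |v|^2/2 is
  spent on this, so all of it can absorb errors: those of size |x| |v|^2 directly, the magnetic ones
  of size |x|^d |v| by Young's inequality, which leaves |x|^(2d); d > l1/2 + \<kappa> makes this
  negligible. If \<kappa> < l2 - l1, then C(q) = 0 at every zero q of N on the sphere, since there
  the leading term of U vanishes; the assumption then says that N has no such zero, and the gradient
  term alone gives positivity. The exponent \<kappa> + 2 - l1 may be negative: the weight can be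
  singular at the origin, but its product with |N| stays bounded. An orbit that exists only for a
  finite time has an empty omega-limit set. Existence for all times is obtained from a local
  existence time that is uniform on the bounded set of states to which H <= 0 confines the
  orbit.\<close>

definition coeff_mass :: "(('n::finite \<Rightarrow> nat) \<Rightarrow> real) \<Rightarrow> nat \<Rightarrow> real" where
  "coeff_mass c k = (\<Sum>\<alpha> | (\<Sum>i\<in>UNIV. \<alpha> i) = k. \<bar>c \<alpha>\<bar>)"

text \<open>Grading the multi-index sums by degree turns power series at the origin into ordinary series of
  functions, to which the termwise differentiation theorem of the library applies.\<close>

definition hom_series :: "(real ^ 'n \<Rightarrow> real) \<Rightarrow> (('n::finite \<Rightarrow> nat) \<Rightarrow> real) \<Rightarrow> bool" where
  "hom_series f c \<longleftrightarrow> (\<exists>\<rho>>0. summable (\<lambda>k. coeff_mass c k * \<rho> ^ k) \<and>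
     (\<forall>x\<in>ball 0 \<rho>. (\<lambda>k. hom_poly c k x) sums f x))"

text \<open>Coefficients of the formal partial derivative in the direction i.\<close>

definition dcoeff :: "'n \<Rightarrow> (('n::finite \<Rightarrow> nat) \<Rightarrow> real) \<Rightarrow> ('n \<Rightarrow> nat) \<Rightarrow> real" where
  "dcoeff i c \<alpha> = real (\<alpha> i + 1) * c (\<alpha>(i := \<alpha> i + 1))"

section \<open>Homogeneous polynomials, their derivatives and Euler's identity\<close>

lemma finite_multi_indices: "finite {\<alpha> :: 'n::finite \<Rightarrow> nat. (\<Sum>i\<in>UNIV. \<alpha> i) = k}"
proof (rule finite_subset)
  show "{\<alpha> :: 'n \<Rightarrow> nat. (\<Sum>i\<in>UNIV. \<alpha> i) = k} \<subseteq> PiE UNIV (\<lambda>_. {..k})"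
  proof
    fix \<alpha> :: "'n \<Rightarrow> nat" assume "\<alpha> \<in> {\<alpha>. (\<Sum>i\<in>UNIV. \<alpha> i) = k}"
    then have "\<alpha> i \<le> k" for i
      using member_le_sum[of i UNIV \<alpha>] by simp
    then show "\<alpha> \<in> PiE UNIV (\<lambda>_. {..k})" by auto
  qed
qed (simp add: finite_PiE)

lemma monomial_fun_scaleR:
  "monomial_fun \<alpha> (t *\<^sub>R x) = t ^ (\<Sum>i\<in>UNIV. \<alpha> i) * monomial_fun \<alpha> (x :: real ^ 'n::finite)"
  by (simp add: monomial_fun_def power_mult_distrib prod.distrib power_sum)

lemma hom_poly_scaleR: "hom_poly c k (t *\<^sub>R x) = t ^ k * hom_poly c k x"
  by (simp add: hom_poly_def monomial_fun_scaleR sum_distrib_left mult_ac)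

lemma coeff_mass_nonneg: "0 \<le> coeff_mass c k"
  by (simp add: coeff_mass_def sum_nonneg)

lemma monomial_fun_bound:
  fixes x :: "real ^ 'n::finite"
  shows "\<bar>monomial_fun \<alpha> x\<bar> \<le> norm x ^ (\<Sum>i\<in>UNIV. \<alpha> i)"
proof -
  have "\<bar>monomial_fun \<alpha> x\<bar> \<le> (\<Prod>i\<in>UNIV. norm x ^ \<alpha> i)"
    unfolding monomial_fun_def abs_prod power_abs
    by (intro prod_mono) (auto intro!: power_mono component_le_norm_cart)
  then show ?thesis by (simp add: power_sum)
qed

text \<open>Each monomial of degree k is at most |x|^k. With this majorant, summability of
  \<open>coeff_mass c k * \<rho> ^ k\<close> controls the graded series on the whole ball of radius
  \<rho>, and tails are estimated by real series.\<close>

lemma hom_poly_bound: "\<bar>hom_poly c k x\<bar> \<le> coeff_mass c k * norm x ^ k"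
proof -
  have "\<bar>hom_poly c k x\<bar> \<le> (\<Sum>\<alpha> | (\<Sum>i\<in>UNIV. \<alpha> i) = k. \<bar>c \<alpha> * monomial_fun \<alpha> x\<bar>)"
    unfolding hom_poly_def by (rule sum_abs)
  also have "\<dots> \<le> (\<Sum>\<alpha> | (\<Sum>i\<in>UNIV. \<alpha> i) = k. \<bar>c \<alpha>\<bar> * norm x ^ k)"
    using monomial_fun_bound[of _ x] by (intro sum_mono) (auto simp: abs_mult intro!: mult_left_mono)
  finally show ?thesis by (simp add: coeff_mass_def sum_distrib_right)
qed

lemma monomial_fun_has_derivative:
  fixes x :: "real ^ 'n::finite"
  shows "(monomial_fun \<alpha> has_derivative
     (\<lambda>h. \<Sum>i\<in>UNIV. real (\<alpha> i) * monomial_fun (\<alpha>(i := \<alpha> i - 1)) x * h $ i)) (at x)"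
proof -
  have nth: "((\<lambda>u :: real ^ 'n. u $ j) has_derivative (\<lambda>h. h $ j)) (at x)" for j
    by (rule bounded_linear_imp_has_derivative) (rule bounded_linear_vec_nth)
  have "((\<lambda>x. \<Prod>i\<in>UNIV. (x $ i) ^ \<alpha> i) has_derivative
     (\<lambda>h. \<Sum>i\<in>UNIV. (of_nat (\<alpha> i) * h $ i * (x $ i) ^ (\<alpha> i - 1)) * (\<Prod>j\<in>UNIV - {i}. (x $ j) ^ \<alpha> j))) (at x)"
    by (intro has_derivative_prod has_derivative_power nth)
  moreover have "monomial_fun (\<alpha>(i := \<alpha> i - 1)) x = (x $ i) ^ (\<alpha> i - 1) * (\<Prod>j\<in>UNIV - {i}. (x $ j) ^ \<alpha> j)" for i
    unfolding monomial_fun_def by (subst prod.remove[of _ i]) auto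
  ultimately show ?thesis
    unfolding monomial_fun_def[abs_def] by (simp add: mult_ac)
qed

text \<open>Lowering the exponent of i by one is a bijection from the multi-indices of degree k + 1
  with positive exponent at i onto those of degree k. The weight \<open>w\<close> sees both indices,
  so the same shift serves for differentiating polynomials and for estimating
  \<open>coeff_mass\<close>.\<close>

lemma sum_multi_index_shift:
  fixes i :: "'n::finite"
  shows "(\<Sum>\<alpha> | (\<Sum>j\<in>UNIV. \<alpha> j) = Suc k. real (\<alpha> i) * w \<alpha> (\<alpha>(i := \<alpha> i - 1))) =
    (\<Sum>\<beta> | (\<Sum>j\<in>UNIV. \<beta> j) = k. real (\<beta> i + 1) * w (\<beta>(i := \<beta> i + 1)) \<beta>)"
proof -
  have s: "(\<Sum>j\<in>UNIV. (\<beta>(i := b)) j) = b + (\<Sum>j\<in>UNIV - {i}. \<beta> j)" for \<beta> :: "'n \<Rightarrow> nat" and b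
    by (subst sum.remove[of _ i]) auto
  have s0: "(\<Sum>j\<in>UNIV. \<beta> j) = \<beta> i + (\<Sum>j\<in>UNIV - {i}. \<beta> j)" for \<beta> :: "'n \<Rightarrow> nat"
    by (subst sum.remove[of _ i]) auto
  \<comment> \<open>Indices with \<open>\<alpha> i = 0\<close>, where the truncated subtraction
    would spoil the bijection, carry the factor 0.\<close>
  have "(\<Sum>\<alpha> | (\<Sum>j\<in>UNIV. \<alpha> j) = Suc k. real (\<alpha> i) * w \<alpha> (\<alpha>(i := \<alpha> i - 1)))
     = (\<Sum>\<alpha> | (\<Sum>j\<in>UNIV. \<alpha> j) = Suc k \<and> 0 < \<alpha> i. real (\<alpha> i) * w \<alpha> (\<alpha>(i := \<alpha> i - 1)))"
    by (rule sum.mono_neutral_right) (auto simp: finite_multi_indices)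
  also have "\<dots> = (\<Sum>\<beta> | (\<Sum>j\<in>UNIV. \<beta> j) = k. real (\<beta> i + 1) * w (\<beta>(i := \<beta> i + 1)) \<beta>)"
    by (rule sum.reindex_bij_witness[of _ "\<lambda>\<beta>. \<beta>(i := \<beta> i + 1)" "\<lambda>\<alpha>. \<alpha>(i := \<alpha> i - 1)"])
      (auto simp: s s0 simp del: fun_upd_apply, auto)
  finally show ?thesis .
qed

lemma hom_poly_has_derivative:
  fixes x :: "real ^ 'n::finite"
  shows "(hom_poly c (Suc k) has_derivative (\<lambda>h. \<Sum>i\<in>UNIV. hom_poly (dcoeff i c) k x * h $ i)) (at x)"
proof -
  let ?A = "\<lambda>k. {\<alpha> :: 'n \<Rightarrow> nat. (\<Sum>i\<in>UNIV. \<alpha> i) = k}"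
  let ?m = "\<lambda>\<alpha> i. monomial_fun (\<alpha>(i := \<alpha> i - 1)) x"
  have "((\<lambda>y. \<Sum>\<alpha>\<in>?A (Suc k). c \<alpha> * monomial_fun \<alpha> y) has_derivative
      (\<lambda>h. \<Sum>\<alpha>\<in>?A (Suc k). c \<alpha> * (\<Sum>i\<in>UNIV. real (\<alpha> i) * ?m \<alpha> i * h $ i))) (at x)"
    by (intro has_derivative_sum has_derivative_mult_right monomial_fun_has_derivative)
  moreover have "hom_poly c (Suc k) = (\<lambda>y. \<Sum>\<alpha>\<in>?A (Suc k). c \<alpha> * monomial_fun \<alpha> y)"
    by (rule ext) (simp only: hom_poly_def)
  moreover have "(\<Sum>\<alpha>\<in>?A (Suc k). c \<alpha> * (\<Sum>i\<in>UNIV. real (\<alpha> i) * ?m \<alpha> i * h $ i))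
     = (\<Sum>i\<in>UNIV. hom_poly (dcoeff i c) k x * h $ i)" for h
  proof -
    have "(\<Sum>\<alpha>\<in>?A (Suc k). c \<alpha> * (\<Sum>i\<in>UNIV. real (\<alpha> i) * ?m \<alpha> i * h $ i))
      = (\<Sum>\<alpha>\<in>?A (Suc k). \<Sum>i\<in>UNIV. (real (\<alpha> i) * (c \<alpha> * ?m \<alpha> i)) * h $ i)"
      unfolding sum_distrib_left by (simp only: mult_ac)
    also have "\<dots> = (\<Sum>i\<in>UNIV. \<Sum>\<alpha>\<in>?A (Suc k). (real (\<alpha> i) * (c \<alpha> * ?m \<alpha> i)) * h $ i)"
      by (rule sum.swap)
    also have "\<dots> = (\<Sum>i\<in>UNIV. (\<Sum>\<alpha>\<in>?A (Suc k). real (\<alpha> i) * (c \<alpha> * ?m \<alpha> i)) * h $ i)"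
      by (simp only: sum_distrib_right)
    also have "\<dots> = (\<Sum>i\<in>UNIV. hom_poly (dcoeff i c) k x * h $ i)"
      unfolding sum_multi_index_shift[where w = "\<lambda>\<alpha> \<beta>. c \<alpha> * monomial_fun \<beta> x"]
      by (simp only: hom_poly_def dcoeff_def mult.assoc)
    finally show ?thesis .
  qed
  ultimately show ?thesis by simp
qed

lemma hom_poly_0_has_derivative: "(hom_poly c 0 has_derivative (\<lambda>_. 0)) (at x)"
proof -
  have "monomial_fun \<alpha> y = 1" if "(\<Sum>i\<in>UNIV. \<alpha> i) = 0" for \<alpha> and y :: "real ^ 'a"
    using that by (simp add: monomial_fun_def)
  then have "hom_poly c 0 = (\<lambda>_. \<Sum>\<alpha> | (\<Sum>i\<in>UNIV. \<alpha> i) = 0. c \<alpha>)"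
    by (intro ext) (simp add: hom_poly_def)
  then show ?thesis by simp
qed

text \<open>Differentiate \<open>hom_poly c (Suc k) (t *\<^sub>R x)\<close> at t = 1, once by the
  chain rule and once through homogeneity.\<close>

lemma euler_identity:
  fixes x :: "real ^ 'n::finite"
  shows "(\<Sum>i\<in>UNIV. x $ i * hom_poly (dcoeff i c) k x) = real (Suc k) * hom_poly c (Suc k) x"
proof -
  let ?D = "\<Sum>i\<in>UNIV. x $ i * hom_poly (dcoeff i c) k x"
  have s: "((\<lambda>t :: real. t *\<^sub>R x) has_derivative (\<lambda>h. h *\<^sub>R x)) (at 1)"
    by (auto intro!: derivative_eq_intros)
  have "((\<lambda>t :: real. hom_poly c (Suc k) (t *\<^sub>R x)) has_derivative
     (\<lambda>h. \<Sum>i\<in>UNIV. hom_poly (dcoeff i c) k (1 *\<^sub>R x) * (h *\<^sub>R x) $ i)) (at 1)"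
    by (rule has_derivative_compose[OF s hom_poly_has_derivative])
  moreover have "(\<lambda>h. \<Sum>i\<in>UNIV. hom_poly (dcoeff i c) k (1 *\<^sub>R x) * (h *\<^sub>R x) $ i) = (*) ?D"
    by (rule ext) (simp add: sum_distrib_left mult_ac)
  ultimately have "((\<lambda>t. hom_poly c (Suc k) (t *\<^sub>R x)) has_real_derivative ?D) (at 1)"
    unfolding has_field_derivative_def by metis
  moreover have "((\<lambda>t. t ^ Suc k * hom_poly c (Suc k) x) has_real_derivative
      real (Suc k) * hom_poly c (Suc k) x) (at 1)"
    using DERIV_cmult_right[OF DERIV_pow[of "Suc k" 1]] by simp
  ultimately show ?thesis
    unfolding hom_poly_scaleR by (rule DERIV_unique)
qed

lemma coeff_mass_dcoeff: "coeff_mass (dcoeff i c) k \<le> real (Suc k) * coeff_mass c (Suc k)"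
proof -
  have "coeff_mass (dcoeff i c) k
     = (\<Sum>\<beta> | (\<Sum>j\<in>UNIV. \<beta> j) = k. real (\<beta> i + 1) * \<bar>c (\<beta>(i := \<beta> i + 1))\<bar>)"
    by (simp add: coeff_mass_def dcoeff_def abs_mult)
  also have "\<dots> = (\<Sum>\<alpha> | (\<Sum>j\<in>UNIV. \<alpha> j) = Suc k. real (\<alpha> i) * \<bar>c \<alpha>\<bar>)"
    by (rule sum_multi_index_shift[symmetric, where w = "\<lambda>\<alpha> \<beta>. \<bar>c \<alpha>\<bar>"])
  also have "\<dots> \<le> (\<Sum>\<alpha> | (\<Sum>j\<in>UNIV. \<alpha> j) = Suc k. real (Suc k) * \<bar>c \<alpha>\<bar>)"
    proof (intro sum_mono mult_right_mono)
    fix \<alpha> :: "'a \<Rightarrow> nat" assume "\<alpha> \<in> {\<alpha>. (\<Sum>j\<in>UNIV. \<alpha> j) = Suc k}"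
    then show "real (\<alpha> i) \<le> real (Suc k)"
      using member_le_sum[of i UNIV \<alpha>] by simp
  qed simp
  finally show ?thesis by (simp add: coeff_mass_def sum_distrib_left)
qed

section \<open>Graded series: convergence, remainders and termwise differentiation\<close>

lemma multi_index_sums:
  fixes F :: "('n::finite \<Rightarrow> nat) \<Rightarrow> real"
  assumes "(F has_sum s) UNIV"
  shows "(\<lambda>k. \<Sum>\<alpha> | (\<Sum>i\<in>UNIV. \<alpha> i) = k. F \<alpha>) sums s"
proof -
  let ?A = "\<lambda>k. {\<alpha> :: 'n \<Rightarrow> nat. (\<Sum>i\<in>UNIV. \<alpha> i) = k}"
  have "bij_betw snd (Sigma UNIV ?A) UNIV"
    by (auto simp: bij_betw_def inj_on_def image_def)
  then have "((\<lambda>p. F (snd p)) has_sum s) (Sigma UNIV ?A)"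
    using assms has_sum_reindex_bij_betw by blast
  then have "((\<lambda>k. \<Sum>\<alpha>\<in>?A k. F \<alpha>) has_sum s) UNIV"
    by (rule has_sum_Sigma[OF isUCont_plus]) (simp add: has_sum_finite finite_multi_indices)
  then show ?thesis by (rule has_sum_imp_sums)
qed

text \<open>At the diagonal point with all coordinates \<rho> the monomial of index \<alpha> is
  \<rho>^|\<alpha>|, and unconditional convergence of a real family is absolute. Hence convergence
  at this one point makes the masses summable.\<close>

lemma power_series_imp_hom_series:
  fixes f :: "real ^ 'n::finite \<Rightarrow> real"
  assumes "has_power_series_at f 0 c"
  shows "hom_series f c"
proof -
  obtain r where r: "r > 0"
    "\<And>x. x \<in> ball 0 r \<Longrightarrow> ((\<lambda>\<alpha>. c \<alpha> * monomial_fun \<alpha> x) has_sum f x) UNIV"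
    using assms by (auto simp: has_power_series_at_def)
  \<comment> \<open>This gives the diagonal point the l1-norm r/2, so it lies in the ball of
    convergence.\<close>
  define \<rho> where "\<rho> = r / (2 * CARD('n))"
  have \<rho>: "\<rho> > 0" using r(1) by (simp add: \<rho>_def)
  define p :: "real ^ 'n" where "p = (\<chi> i. \<rho>)"
  have "norm p \<le> (\<Sum>i\<in>(UNIV :: 'n set). \<rho>)"
    using norm_le_l1_cart[of p] \<rho> by (simp add: p_def)
  also have "\<dots> < r" using r(1) by (simp add: \<rho>_def)
  finally have p: "p \<in> ball 0 r" by simp
  have "\<rho> \<le> r / 2"
    using r(1) by (auto simp: \<rho>_def field_simps mult_le_cancel_left1)
  then have "\<rho> < r" using r(1) by linarith
  have "monomial_fun \<alpha> p = \<rho> ^ (\<Sum>i\<in>UNIV. \<alpha> i)" for \<alpha>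
    by (simp add: monomial_fun_def p_def power_sum)
  then have "(\<lambda>\<alpha>. c \<alpha> * \<rho> ^ (\<Sum>i\<in>UNIV. \<alpha> i)) summable_on UNIV"
    using r(2)[OF p] by (auto simp: summable_on_def)
  then have "(\<lambda>\<alpha>. \<bar>c \<alpha>\<bar> * \<rho> ^ (\<Sum>i\<in>UNIV. \<alpha> i)) summable_on UNIV"
    using \<rho> by (subst (asm) summable_on_iff_abs_summable_on_real) (simp add: abs_mult)
  then obtain s where "((\<lambda>\<alpha>. \<bar>c \<alpha>\<bar> * \<rho> ^ (\<Sum>i\<in>UNIV. \<alpha> i)) has_sum s) UNIV"
    by (auto simp: summable_on_def)
  from multi_index_sums[OF this] have "(\<lambda>k. coeff_mass c k * \<rho> ^ k) sums s"
    by (simp add: coeff_mass_def sum_distrib_right)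
  moreover have "(\<lambda>k. hom_poly c k x) sums f x" if "x \<in> ball 0 \<rho>" for x
    unfolding hom_poly_def using that \<open>\<rho> < r\<close> by (intro multi_index_sums r(2)) auto
  ultimately show ?thesis
    unfolding hom_series_def using \<rho> by (blast intro: sums_summable)
qed

text \<open>The power |x|^N is factored out of the tail; what remains is bounded by a real series
  that does not depend on x.\<close>

lemma hom_series_remainder:
  assumes "hom_series f c"
  shows "\<exists>K \<epsilon>. 0 < \<epsilon> \<and> 0 \<le> K \<and> (\<forall>x\<in>ball 0 \<epsilon>. \<bar>f x - (\<Sum>k<N. hom_poly c k x)\<bar> \<le> K * norm x ^ N)"
proof -
  obtain \<rho> where \<rho>: "\<rho> > 0" "summable (\<lambda>k. coeff_mass c k * \<rho> ^ k)"
    "\<And>x. x \<in> ball 0 \<rho> \<Longrightarrow> (\<lambda>k. hom_poly c k x) sums f x"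
    using assms by (auto simp: hom_series_def)
  have "summable (\<lambda>k. coeff_mass c (k + N) * \<rho> ^ (k + N) / \<rho> ^ N)"
    using \<rho>(2) by (intro summable_divide summable_ignore_initial_segment)
  then have sm: "summable (\<lambda>k. coeff_mass c (k + N) * \<rho> ^ k)"
    using \<rho>(1) by (simp add: power_add)
  define K where "K = (\<Sum>k. coeff_mass c (k + N) * \<rho> ^ k)"
  have "\<bar>f x - (\<Sum>k<N. hom_poly c k x)\<bar> \<le> K * norm x ^ N" if "x \<in> ball 0 \<rho>" for x
  proof -
    have s: "(\<lambda>k. hom_poly c (k + N) x) sums (f x - (\<Sum>k<N. hom_poly c k x))"
      using \<rho>(3)[OF that] by (rule sums_split_initial_segment)
    have b: "norm (hom_poly c (k + N) x) \<le> coeff_mass c (k + N) * \<rho> ^ k * norm x ^ N" for k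
    proof -
      have "norm (hom_poly c (k + N) x) \<le> coeff_mass c (k + N) * (norm x ^ k * norm x ^ N)"
        using hom_poly_bound[of c "k + N" x] by (simp add: power_add)
      also have "\<dots> \<le> coeff_mass c (k + N) * (\<rho> ^ k * norm x ^ N)"
        using that by (intro mult_left_mono mult_right_mono power_mono) (auto simp: coeff_mass_nonneg)
      finally show ?thesis by (simp add: mult_ac)
    qed
    have "norm (\<Sum>k. hom_poly c (k + N) x) \<le> (\<Sum>k. coeff_mass c (k + N) * \<rho> ^ k * norm x ^ N)"
      using b summable_mult2[OF sm] by (rule norm_suminf_le)
    then show ?thesis
      using sums_unique[OF s] suminf_mult2[OF sm, of "norm x ^ N"] by (simp add: K_def)
  qed
  moreover have "0 \<le> K"
    unfolding K_def using sm \<rho>(1) by (intro suminf_nonneg) (auto simp: coeff_mass_nonneg)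
  ultimately show ?thesis using \<rho>(1) by blast
qed

text \<open>Differentiation costs a factor k + 1 <= 2^k, which is absorbed by halving the
  radius.\<close>

lemma summable_coeff_mass_dcoeff:
  assumes "\<rho> > 0" "summable (\<lambda>k. coeff_mass c k * \<rho> ^ k)"
  shows "summable (\<lambda>k. coeff_mass (dcoeff i c) k * (\<rho> / 2) ^ k)"
proof (rule summable_comparison_test')
  show "summable (\<lambda>k. coeff_mass c (Suc k) * \<rho> ^ Suc k / \<rho>)"
    using assms(2) by (intro summable_divide) (subst summable_Suc_iff)
  show "norm (coeff_mass (dcoeff i c) k * (\<rho> / 2) ^ k) \<le> coeff_mass c (Suc k) * \<rho> ^ Suc k / \<rho>" for k
  proof -
    have "Suc k \<le> 2 ^ k" by (induction k) auto
    then have "real (Suc k) \<le> 2 ^ k" by (metis of_nat_le_iff of_nat_numeral of_nat_power)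
    then have "real (Suc k) * (coeff_mass c (Suc k) * (\<rho> / 2) ^ k) \<le> 2 ^ k * (coeff_mass c (Suc k) * (\<rho> / 2) ^ k)"
      using assms(1) by (intro mult_right_mono) (auto simp: coeff_mass_nonneg)
    also have "\<dots> = coeff_mass c (Suc k) * \<rho> ^ k"
      by (simp add: power_divide)
    finally have "real (Suc k) * coeff_mass c (Suc k) * (\<rho> / 2) ^ k \<le> coeff_mass c (Suc k) * \<rho> ^ k"
      by (simp add: mult.assoc)
    moreover have "coeff_mass (dcoeff i c) k * (\<rho> / 2) ^ k \<le> real (Suc k) * coeff_mass c (Suc k) * (\<rho> / 2) ^ k"
      using assms(1) by (intro mult_right_mono coeff_mass_dcoeff) auto
    moreover have "coeff_mass c (Suc k) * \<rho> ^ Suc k / \<rho> = coeff_mass c (Suc k) * \<rho> ^ k"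
      using assms(1) by simp
    moreover have "0 \<le> coeff_mass (dcoeff i c) k * (\<rho> / 2) ^ k"
      using assms(1) by (intro mult_nonneg_nonneg coeff_mass_nonneg) auto
    ultimately show ?thesis unfolding real_norm_def by linarith
  qed
qed

text \<open>The masses of the differentiated coefficients are a Weierstrass majorant, so the
  derivatives of the partial sums converge uniformly and the series may be differentiated term by
  term.\<close>

lemma hom_series_derivative:
  fixes f :: "real ^ 'n::finite \<Rightarrow> real"
  assumes "hom_series f c"
  shows "\<exists>\<rho>>0. (\<forall>x\<in>ball 0 \<rho>. f differentiable (at x)) \<and>
     (\<forall>i. summable (\<lambda>k. coeff_mass (dcoeff i c) k * \<rho> ^ k)) \<and>
     (\<forall>i. \<forall>x\<in>ball 0 \<rho>. (\<lambda>k. hom_poly (dcoeff i c) k x) sums partial_deriv i f x)"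
proof -
  obtain \<rho>' where \<rho>': "\<rho>' > 0" "summable (\<lambda>k. coeff_mass c k * \<rho>' ^ k)"
    "\<And>x. x \<in> ball 0 \<rho>' \<Longrightarrow> (\<lambda>k. hom_poly c k x) sums f x"
    using assms by (auto simp: hom_series_def)
  define \<rho> where "\<rho> = \<rho>' / 2"
  have \<rho>: "0 < \<rho>" "\<rho> < \<rho>'" using \<rho>'(1) by (auto simp: \<rho>_def)
  have sm: "summable (\<lambda>k. coeff_mass (dcoeff i c) k * \<rho> ^ k)" for i
    unfolding \<rho>_def by (rule summable_coeff_mass_dcoeff[OF \<rho>'(1,2)])
  define S :: "(real ^ 'n) set" where "S = ball 0 \<rho>"
  \<comment> \<open>Entry n is the partial derivative of the term of degree n, hence of degree n -
    1, with 0 for the constant term; both series keep the same index.\<close>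
  define P where "P i n x = (case n of 0 \<Rightarrow> 0 | Suc k \<Rightarrow> hom_poly (dcoeff i c) k x)" for i n and x :: "real ^ 'n"
  define M where "M i n = (case n of 0 \<Rightarrow> 0 | Suc k \<Rightarrow> coeff_mass (dcoeff i c) k * \<rho> ^ k)" for i n
  have PM: "norm (P i n x) \<le> M i n" if "x \<in> S" for i n x
  proof (cases n)
    case (Suc k)
    have "norm (hom_poly (dcoeff i c) k x) \<le> coeff_mass (dcoeff i c) k * norm x ^ k"
      using hom_poly_bound[of "dcoeff i c" k x] by simp
    also have "\<dots> \<le> coeff_mass (dcoeff i c) k * \<rho> ^ k"
      using that by (intro mult_left_mono power_mono) (auto simp: S_def coeff_mass_nonneg)
    finally show ?thesis by (simp add: P_def M_def Suc)
  qed (simp add: P_def M_def)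
  have sM: "summable (M i)" for i
    using sm[of i] by (subst summable_Suc_iff[symmetric]) (simp add: M_def)
  define G where "G i x = (\<Sum>n. P i n x)" for i x
  have unif: "uniform_limit S (\<lambda>n x. \<Sum>j<n. P i j x) (G i) sequentially" for i
    unfolding G_def[abs_def] using PM sM by (rule Weierstrass_m_test)
  define f' where "f' n x h = (\<Sum>i\<in>UNIV. P i n x * h $ i)" for n x and h :: "real ^ 'n"
  define g' where "g' x h = (\<Sum>i\<in>UNIV. G i x * h $ i)" for x and h :: "real ^ 'n"
  have "\<exists>g. \<forall>x\<in>S. (\<lambda>n. hom_poly c n x) sums (g x) \<and> (g has_derivative g' x) (at x within S)"
  proof (rule has_derivative_series)
    show "convex S" by (simp add: S_def)
    show "(hom_poly c n has_derivative f' n x) (at x within S)" for n x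
    proof (cases n)
      case 0
      then show ?thesis
        using hom_poly_0_has_derivative[of c x] by (simp add: f'_def[abs_def] P_def has_derivative_at_withinI)
    next
      case (Suc k)
      then show ?thesis
        using hom_poly_has_derivative[of c k x] by (simp add: f'_def[abs_def] P_def has_derivative_at_withinI)
    qed
    show "\<forall>\<^sub>F n in sequentially. \<forall>x\<in>S. \<forall>h. norm ((\<Sum>j<n. f' j x h) - g' x h) \<le> e * norm h" if "e > 0" for e
    proof -
      define e' where "e' = e / CARD('n)"
      have e': "e' > 0" using that by (simp add: e'_def)
      have "\<forall>\<^sub>F n in sequentially. \<forall>i. \<forall>x\<in>S. dist (\<Sum>j<n. P i j x) (G i x) < e'"
        using unif e' by (intro eventually_all_finite) (auto simp: uniform_limit_iff)
      then show ?thesis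
      proof eventually_elim
        case (elim n)
        show ?case
        proof (intro ballI allI)
          fix x and h :: "real ^ 'n" assume x: "x \<in> S"
          have "(\<Sum>j<n. f' j x h) = (\<Sum>i\<in>UNIV. (\<Sum>j<n. P i j x) * h $ i)"
            unfolding f'_def by (subst sum.swap) (simp only: sum_distrib_right)
          then have "(\<Sum>j<n. f' j x h) - g' x h = (\<Sum>i\<in>UNIV. ((\<Sum>j<n. P i j x) - G i x) * h $ i)"
            by (simp only: g'_def sum_subtractf left_diff_distrib)
          also have "norm \<dots> \<le> (\<Sum>i\<in>(UNIV :: 'n set). e' * norm h)"
          proof (rule sum_norm_le)
            fix i :: 'n
            have "norm ((\<Sum>j<n. P i j x) - G i x) \<le> e'"
              using elim x by (auto simp: dist_norm intro: less_imp_le)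
            then show "norm (((\<Sum>j<n. P i j x) - G i x) * h $ i) \<le> e' * norm h"
              unfolding norm_mult using component_le_norm_cart[of h i] e' by (intro mult_mono) auto
          qed
          also have "\<dots> = e * norm h" by (simp add: e'_def)
          finally show "norm ((\<Sum>j<n. f' j x h) - g' x h) \<le> e * norm h" .
        qed
      qed
    qed
    show "0 \<in> S" "(\<lambda>n. hom_poly c n 0) sums f 0"
      using \<rho> \<rho>'(1,3) by (auto simp: S_def)
  qed
  then obtain g where g: "\<And>x. x \<in> S \<Longrightarrow> (\<lambda>n. hom_poly c n x) sums (g x)"
      "\<And>x. x \<in> S \<Longrightarrow> (g has_derivative g' x) (at x within S)" by blast
  have gf: "g x = f x" if "x \<in> S" for x
    using g(1)[OF that] \<rho>'(3)[of x] that \<rho>(2) sums_unique2 by (fastforce simp: S_def)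
  have D: "(f has_derivative g' x) (at x)" if "x \<in> S" for x
  proof -
    have "open S" by (simp add: S_def)
    have "(g has_derivative g' x) (at x)"
      using g(2)[OF that] at_within_open[OF that \<open>open S\<close>] by simp
    then show ?thesis
      by (rule has_derivative_transform_within_open[OF _ \<open>open S\<close> that gf])
  qed
  have "(\<lambda>k. hom_poly (dcoeff i c) k x) sums partial_deriv i f x" if "x \<in> S" for i x
  proof -
    have "partial_deriv i f x = G i x"
      unfolding partial_derivI[OF D[OF that]] g'_def
      by (simp add: axis_def if_distrib cong: if_cong)
    moreover have "(\<lambda>n. P i n x) sums G i x"
      unfolding G_def using PM[OF that] by (intro summable_sums summable_comparison_test'[OF sM])
    ultimately show ?thesis
      using sums_Suc_iff[of "\<lambda>n. P i n x" "G i x"] by (simp add: P_def)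
  qed
  moreover have "f differentiable (at x)" if "x \<in> S" for x
    using D[OF that] unfolding differentiable_def by blast
  ultimately show ?thesis
    using \<rho>(1) sm unfolding S_def by blast
qed

lemma hom_series_partial_deriv:
  assumes "hom_series f c"
  shows "hom_series (partial_deriv i f) (dcoeff i c)"
proof -
  from hom_series_derivative[OF assms] obtain \<rho> where \<rho>: "\<rho> > 0"
    "\<forall>i. summable (\<lambda>k. coeff_mass (dcoeff i c) k * \<rho> ^ k)"
    "\<forall>i. \<forall>x\<in>ball 0 \<rho>. (\<lambda>k. hom_poly (dcoeff i c) k x) sums partial_deriv i f x"
    by (elim exE conjE)
  show ?thesis
    unfolding hom_series_def
    by (intro exI[of _ \<rho>] conjI \<rho>(1) spec[OF \<rho>(2)] spec[OF \<rho>(3)])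
qed

lemma hom_series_differentiable:
  assumes "hom_series f c"
  shows "\<exists>\<epsilon>>0. \<forall>x\<in>ball 0 \<epsilon>. f differentiable (at x)"
proof -
  from hom_series_derivative[OF assms] obtain \<rho> where "\<rho> > 0" "\<forall>x\<in>ball 0 \<rho>. f differentiable (at x)"
    by (elim exE conjE)
  then show ?thesis by (intro exI[of _ \<rho>] conjI)
qed

lemma hom_series_bounded:
  assumes "hom_series f c"
  shows "\<exists>K \<epsilon>. 0 < \<epsilon> \<and> 0 \<le> K \<and> (\<forall>x\<in>ball 0 \<epsilon>. \<bar>f x\<bar> \<le> K)"
  using hom_series_remainder[OF assms, of 0] by simp

text \<open>Bounded partial derivatives on a convex ball give a Lipschitz constant. This is used for
  the coefficients of the equation of motion, as Picard iteration demands.\<close>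

lemma hom_series_lipschitz:
  fixes f :: "real ^ 'n::finite \<Rightarrow> real"
  assumes "hom_series f c"
  shows "\<exists>\<epsilon>>0. \<exists>L. L-lipschitz_on (ball 0 \<epsilon>) f"
proof -
  obtain \<rho> where \<rho>: "\<rho> > 0" "\<And>x. x \<in> ball 0 \<rho> \<Longrightarrow> f differentiable (at x)"
    using hom_series_differentiable[OF assms] by blast
  have "\<forall>i. \<exists>K \<epsilon>. 0 < \<epsilon> \<and> 0 \<le> K \<and> (\<forall>x\<in>ball 0 \<epsilon>. \<bar>partial_deriv i f x\<bar> \<le> K)"
    using hom_series_bounded[OF hom_series_partial_deriv[OF assms]] by blast
  then obtain K \<epsilon> where K: "\<And>i. 0 < \<epsilon> i" "\<And>i. 0 \<le> K i"
    "\<And>i x. x \<in> ball 0 (\<epsilon> i) \<Longrightarrow> \<bar>partial_deriv i f x\<bar> \<le> K i"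
    by metis
  define r where "r = min \<rho> (Min (range \<epsilon>))"
  have r: "r > 0" using \<rho>(1) K(1) by (auto simp: r_def)
  have r_le: "r \<le> \<epsilon> i" for i
    unfolding r_def by (intro min.coboundedI2 Min_le) auto
  have "(\<Sum>i\<in>UNIV. K i)-lipschitz_on (ball 0 r) f"
  proof (rule bounded_derivative_imp_lipschitz)
    show "(f has_derivative (\<lambda>h. \<Sum>k\<in>UNIV. partial_deriv k f x * h $ k)) (at x within ball 0 r)"
      if "x \<in> ball 0 r" for x
      using that by (intro has_derivative_at_withinI[OF has_derivative_partials] \<rho>(2)) (simp add: r_def)
    show "onorm (\<lambda>h. \<Sum>k\<in>UNIV. partial_deriv k f x * h $ k) \<le> (\<Sum>i\<in>UNIV. K i)"
      if "x \<in> ball 0 r" for x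
    proof (rule onorm_le)
      fix h :: "real ^ 'n"
      have "norm (\<Sum>k\<in>UNIV. partial_deriv k f x * h $ k) \<le> (\<Sum>k\<in>UNIV. K k * norm h)"
      proof (rule sum_norm_le)
        fix k
        have "x \<in> ball 0 (\<epsilon> k)" using that r_le[of k] by auto
        then show "norm (partial_deriv k f x * h $ k) \<le> K k * norm h"
          unfolding norm_mult using K(2,3) component_le_norm_cart[of h k] by (intro mult_mono) auto
      qed
      then show "norm (\<Sum>k\<in>UNIV. partial_deriv k f x * h $ k) \<le> (\<Sum>i\<in>UNIV. K i) * norm h"
        by (simp add: sum_distrib_right)
    qed
  qed (use K(2) in \<open>auto intro: sum_nonneg\<close>)
  then show ?thesis using r by blast
qed

subsection \<open>Local existence of integral curves\<close>

text \<open>Banach's theorem needs a complete metric space, here that of bounded continuous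
  functions on the whole line. Continuity and boundedness of \<open>Op y\<close> are what allows it
  to be wrapped as an element of this space.\<close>

lemma bcontfun_contraction_fixed_point:
  fixes Op :: "(real \<Rightarrow>\<^sub>C 'a::euclidean_space) \<Rightarrow> real \<Rightarrow> 'a"
  assumes "0 \<le> c" "c < 1"
    and "\<And>y. continuous_on UNIV (Op y)" and "\<And>y. bounded (range (Op y))"
    and "\<And>y y' t. dist (Op y t) (Op y' t) \<le> c * dist y y'"
  shows "\<exists>y. \<forall>t. apply_bcontfun y t = Op y t"
proof -
  have "Op y \<in> bcontfun" for y
    using assms(3,4) by (simp add: bcontfun_def)
  then have ap: "apply_bcontfun (Bcontfun (Op y)) = Op y" for y
    by (simp add: Bcontfun_inverse)
  have "\<exists>!y. Bcontfun (Op y) = y"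
    by (rule banach_fix_type[OF assms(1,2)]) (use assms(5) in \<open>auto intro!: dist_bound simp: ap\<close>)
  then obtain y where "Bcontfun (Op y) = y" by blast
  then show ?thesis using ap by metis
qed

text \<open>F is composed with the closest point projection onto K, which is nonexpansive since K is
  convex, so the integral operator is defined on all curves. The fixed point moves by at most M h,
  hence stays in K, where the projection is the identity. The time h depends on z only through the
  inclusion of the ball, which permits a uniform choice.\<close>

lemma picard_local_existence:
  fixes F :: "'a::euclidean_space \<Rightarrow> 'a"
  assumes F: "L-lipschitz_on K F" and K: "convex K" "closed K"
    and bound: "\<And>y. y \<in> K \<Longrightarrow> norm (F y) \<le> M"
    and h: "0 < h" "L * h < 1" and z: "cball z (M * h) \<subseteq> K" and M: "0 \<le> M"
  shows "\<exists>y. y 0 = z \<and> (\<forall>t\<in>{0..h}. y t \<in> K \<and> (y has_vector_derivative F (y t)) (at t within {0..h}))"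
proof -
  have ne: "K \<noteq> {}" using z M h by (metis all_not_in_conv centre_in_cball less_le mult_nonneg_nonneg subset_empty)
  have L: "0 \<le> L" using F by (rule lipschitz_on_nonneg)
  define E where "E y = F (closest_point K y)" for y
  have cp: "closest_point K y \<in> K" for y
    using closest_point_in_set K ne by blast
  have E_lip: "dist (E y) (E y') \<le> L * dist y y'" for y y'
  proof -
    have "dist (E y) (E y') \<le> L * dist (closest_point K y) (closest_point K y')"
      unfolding E_def by (rule lipschitz_onD[OF F cp cp])
    also have "\<dots> \<le> L * dist y y'"
      using L closest_point_lipschitz[OF K ne] by (simp add: mult_left_mono)
    finally show ?thesis .
  qed
  have E_cont: "continuous_on S E" for S
    using E_lip L by (intro lipschitz_on_continuous_on[of L]) (auto intro: lipschitz_onI)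
  have E_bound: "norm (E y) \<le> M" for y
    using bound cp by (simp add: E_def)
  \<comment> \<open>Time is clamped to the interval because the fixed point is sought among
    functions on the whole line.\<close>
  define cl where "cl t = max 0 (min h t)" for t :: real
  have cl: "cl t \<in> {0..h}" for t using h by (auto simp: cl_def)
  have cl_id: "cl t = t" if "t \<in> {0..h}" for t using that by (auto simp: cl_def)
  define Op where "Op y t = z + integral {0..cl t} (\<lambda>s. E (apply_bcontfun y s))" for y t
  have cE: "continuous_on S (\<lambda>s. E (apply_bcontfun y s))" for y S
    by (rule continuous_on_compose2[OF E_cont[of UNIV]]) auto
  have int: "(\<lambda>s. E (apply_bcontfun y s)) integrable_on {0..t}" for y and t :: real
    using cE integrable_continuous_real by blast
  have nI: "norm (integral {0..t} (\<lambda>s. E (apply_bcontfun y s))) \<le> M * t" if "t \<ge> 0" for y and t :: real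
    using integral_bound[of 0 t "\<lambda>s. E (apply_bcontfun y s)" M] that cE E_bound by auto
  have deriv: "((\<lambda>t. z + integral {0..t} (\<lambda>s. E (apply_bcontfun y s))) has_vector_derivative E (apply_bcontfun y t))
      (at t within {0..h})" if "t \<in> {0..h}" for t y
    using has_vector_derivative_add[OF has_vector_derivative_const integral_has_vector_derivative[OF cE that]] by simp
  have "\<exists>y. \<forall>t. apply_bcontfun y t = Op y t"
  proof (rule bcontfun_contraction_fixed_point)
    show "0 \<le> L * h" "L * h < 1" using L h by auto
    show "continuous_on UNIV (Op y)" for y
    proof -
      have "continuous_on {0..h} (\<lambda>t. z + integral {0..t} (\<lambda>s. E (apply_bcontfun y s)))"
        using deriv by (intro continuous_on_vector_derivative) blast
      moreover have "continuous_on UNIV cl"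
        unfolding cl_def by (intro continuous_intros)
      ultimately show ?thesis
        unfolding Op_def using cl continuous_on_compose2[of "{0..h}" _ UNIV cl] by blast
    qed
    show "bounded (range (Op y))" for y
    proof (rule boundedI)
      fix w assume "w \<in> range (Op y)"
      then obtain t where "w = Op y t" by auto
      then have "norm w \<le> norm z + M * cl t"
        using nI[of "cl t" y] cl[of t] norm_triangle_ineq[of z "integral {0..cl t} (\<lambda>s. E (apply_bcontfun y s))"]
        by (simp add: Op_def)
      also have "\<dots> \<le> norm z + M * h" using cl[of t] M by (simp add: mult_left_mono)
      finally show "norm w \<le> norm z + M * h" .
    qed
    show "dist (Op y t) (Op y' t) \<le> L * h * dist y y'" for y y' t
    proof -
      have "dist (Op y t) (Op y' t) = norm (integral {0..cl t} (\<lambda>s. E (apply_bcontfun y s) - E (apply_bcontfun y' s)))"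
        by (simp add: Op_def dist_norm integral_diff[OF int int])
      also have "\<dots> \<le> L * dist y y' * (cl t - 0)"
      proof (rule integral_bound)
        show "0 \<le> cl t" using cl[of t] by simp
        show "continuous_on {0..cl t} (\<lambda>s. E (apply_bcontfun y s) - E (apply_bcontfun y' s))"
          by (intro continuous_intros cE)
        show "norm (E (apply_bcontfun y s) - E (apply_bcontfun y' s)) \<le> L * dist y y'" for s
          using order_trans[OF E_lip mult_left_mono[OF dist_bounded L]] by (simp add: dist_norm)
      qed
      also have "\<dots> \<le> L * dist y y' * h"
        using cl[of t] L by (intro mult_left_mono) auto
      finally show ?thesis by (simp add: mult_ac)
    qed
  qed
  then obtain y where y: "apply_bcontfun y t = Op y t" for t by blast
  let ?y = "\<lambda>t. z + integral {0..t} (\<lambda>s. E (apply_bcontfun y s))"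
  have eq: "apply_bcontfun y t = ?y t" if "t \<in> {0..h}" for t
    using y[of t] cl_id[OF that] by (simp add: Op_def)
  have inK: "?y t \<in> K" if "t \<in> {0..h}" for t
  proof -
    have "dist z (?y t) \<le> M * h"
      using order_trans[OF nI[of t y] mult_left_mono[of t h M]] that M by (simp add: dist_norm)
    then show ?thesis using z by auto
  qed
  have "(?y has_vector_derivative F (?y t)) (at t within {0..h})" if "t \<in> {0..h}" for t
    using deriv[OF that, of y] eq[OF that] closest_point_self[OF inK[OF that]] by (simp add: E_def)
  then show ?thesis using inK by (intro exI[of _ ?y]) auto
qed

subsection \<open>The Lyapunov inequality\<close>

text \<open>Read r = |x|, p = g v, N the gradient of the leading term of U and M its derivative
  along the orbit, \<Gamma> and S the metric and magnetic terms, \<theta> = r^(k - a). Only sizes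
  enter, no curves or coordinates. The budget is |v|^2/2 <= Q: one half of it absorbs the errors of
  size r |v|^2, the other half the magnetic errors; all else has size r^(a + 2 + k + 1) and is taken
  from c.\<close>

lemma lyapunov_inequality:
  fixes x v p dp dU N M S \<Gamma> :: "'a::real_inner" and r K c \<eta> Q H u \<theta> \<theta>' E :: real and a k D :: nat
  assumes r: "0 < r" "r \<le> 1" "norm x \<le> r" and K: "1 \<le> K" and k: "1 \<le> k" and \<eta>: "0 \<le> \<eta>"
    and dp: "dp = (1/2) *\<^sub>R \<Gamma> - dU - S"
    and \<Gamma>: "norm \<Gamma> \<le> K * (norm v)\<^sup>2" and S: "norm S \<le> K * r ^ D * norm v" and D: "a + 2 + 2 * k + 1 \<le> 2 * D + 2"
    and \<theta>: "0 < \<theta>" "\<theta> * r ^ (a + 2) = r ^ (k + 2)" and \<theta>': "\<bar>\<theta>'\<bar> * r \<le> K * \<theta> * norm v"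
    and N: "norm N \<le> K * r ^ (a + 1)" and dU: "norm (dU - N) \<le> K * r ^ (a + 2)"
    and M: "norm M \<le> K * r ^ a * norm v"
    and p: "norm p \<le> K * norm v" and Q: "p \<bullet> v = Q" "(norm v)\<^sup>2 \<le> 2 * Q"
    and H: "H = Q / 2 + u" "H \<le> 0"
    and restoring: "c * r ^ (a + 2 + k) - K * r ^ (a + 2 + k + 1) \<le> real (a + 2) * u - x \<bullet> dU + \<eta> * \<theta> * (norm N)\<^sup>2"
    and E: "E = 2 * K + 4 * \<eta> * K ^ 3" and small: "E * r \<le> 1 / 4" "(E + E\<^sup>2) * r \<le> c / 2"
  shows "c / 2 * r ^ (a + 2 + k) \<le> dp \<bullet> (x - (\<eta> * \<theta>) *\<^sub>R N) + p \<bullet> (v - \<eta> *\<^sub>R (\<theta>' *\<^sub>R N + \<theta> *\<^sub>R M))"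
proof -
  define w where "w = norm v"
  have w: "0 \<le> w" by (simp add: w_def)
  have K0: "0 \<le> K" using K by simp
  have \<theta>0: "\<theta> * r ^ a = r ^ k"
    using \<theta>(2) r(1) by (simp add: power_add power2_eq_square)
  have \<theta>1: "\<theta> * r ^ (a + 1) = r ^ k * r"
    using \<theta>0 by (simp add: mult_ac)
  have rk: "r ^ k \<le> r"
    using power_decreasing[of 1 k r] r k by simp
  have rD: "r ^ D \<ge> 0" using r by simp
  have b1: "\<bar>x \<bullet> \<Gamma>\<bar> \<le> K * (r * w\<^sup>2)"
  proof -
    have "\<bar>x \<bullet> \<Gamma>\<bar> \<le> r * (K * w\<^sup>2)"
      using r \<Gamma> unfolding w_def
      by (intro order_trans[OF Cauchy_Schwarz_ineq2] mult_mono) auto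
    then show ?thesis by (simp add: mult_ac)
  qed
  have b2: "\<bar>x \<bullet> S\<bar> \<le> K * (r ^ (D + 1) * w)"
  proof -
    have "\<bar>x \<bullet> S\<bar> \<le> r * (K * r ^ D * w)"
      using r S unfolding w_def
      by (intro order_trans[OF Cauchy_Schwarz_ineq2] mult_mono) auto
    then show ?thesis by (simp add: mult_ac)
  qed
  have b3: "\<bar>\<theta> * (\<Gamma> \<bullet> N)\<bar> \<le> K\<^sup>2 * (r * w\<^sup>2)"
  proof -
    have "\<bar>\<Gamma> \<bullet> N\<bar> \<le> (K * w\<^sup>2) * (K * r ^ (a + 1))"
      using N \<Gamma> K0 unfolding w_def
      by (intro order_trans[OF Cauchy_Schwarz_ineq2] mult_mono) auto
    then have "\<bar>\<theta> * (\<Gamma> \<bullet> N)\<bar> \<le> \<theta> * ((K * w\<^sup>2) * (K * r ^ (a + 1)))"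
      using \<theta>(1) by (simp add: abs_mult mult_left_mono)
    also have "\<dots> = K\<^sup>2 * w\<^sup>2 * (\<theta> * r ^ (a + 1))" by (simp add: power2_eq_square mult_ac)
    also have "\<dots> = K\<^sup>2 * w\<^sup>2 * (r ^ k * r)" by (simp only: \<theta>1)
    also have "\<dots> \<le> K\<^sup>2 * w\<^sup>2 * (1 * r)"
      using r rk by (intro mult_left_mono mult_right_mono) auto
    finally show ?thesis by (simp add: mult_ac)
  qed
  have b4: "\<bar>\<theta> * ((dU - N) \<bullet> N)\<bar> \<le> K\<^sup>2 * r ^ (a + 2 + k + 1)"
  proof -
    have "\<bar>(dU - N) \<bullet> N\<bar> \<le> (K * r ^ (a + 2)) * (K * r ^ (a + 1))"
      using N dU K0 r by (intro order_trans[OF Cauchy_Schwarz_ineq2] mult_mono) auto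
    then have "\<bar>\<theta> * ((dU - N) \<bullet> N)\<bar> \<le> \<theta> * ((K * r ^ (a + 2)) * (K * r ^ (a + 1)))"
      using \<theta>(1) by (simp add: abs_mult mult_left_mono)
    also have "\<dots> = K\<^sup>2 * r ^ (a + 2) * (\<theta> * r ^ (a + 1))" by (simp add: power2_eq_square mult_ac)
    also have "\<dots> = K\<^sup>2 * r ^ (a + 2) * (r ^ k * r)" by (simp only: \<theta>1)
    finally show ?thesis by (simp add: power_add mult_ac)
  qed
  have b5: "\<bar>\<theta> * (S \<bullet> N)\<bar> \<le> K\<^sup>2 * (r ^ (D + 1) * w)"
  proof -
    have "\<bar>S \<bullet> N\<bar> \<le> (K * r ^ D * w) * (K * r ^ (a + 1))"
      using N S K0 w rD unfolding w_def by (intro order_trans[OF Cauchy_Schwarz_ineq2] mult_mono) auto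
    then have "\<bar>\<theta> * (S \<bullet> N)\<bar> \<le> \<theta> * ((K * r ^ D * w) * (K * r ^ (a + 1)))"
      using \<theta>(1) by (simp add: abs_mult mult_left_mono)
    also have "\<dots> = K\<^sup>2 * r ^ D * w * (\<theta> * r ^ (a + 1))" by (simp add: power2_eq_square mult_ac)
    also have "\<dots> = K\<^sup>2 * r ^ D * w * (r ^ k * r)" by (simp only: \<theta>1)
    also have "\<dots> \<le> K\<^sup>2 * r ^ D * w * (1 * r)"
      using r rk w by (intro mult_left_mono mult_right_mono) auto
    finally show ?thesis by (simp add: mult_ac)
  qed
  have b6: "\<bar>\<theta>' * (p \<bullet> N)\<bar> \<le> K ^ 3 * (r * w\<^sup>2)"
  proof -
    have "\<bar>p \<bullet> N\<bar> \<le> (K * w) * (K * r ^ (a + 1))"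
      using N p K0 w unfolding w_def by (intro order_trans[OF Cauchy_Schwarz_ineq2] mult_mono) auto
    then have "\<bar>\<theta>' * (p \<bullet> N)\<bar> \<le> \<bar>\<theta>'\<bar> * ((K * w) * (K * r ^ (a + 1)))"
      by (simp add: abs_mult mult_left_mono)
    also have "\<dots> = (\<bar>\<theta>'\<bar> * r) * (K\<^sup>2 * w * r ^ a)" by (simp add: power2_eq_square mult_ac)
    also have "\<dots> \<le> (K * \<theta> * w) * (K\<^sup>2 * w * r ^ a)"
      using \<theta>' w r unfolding w_def by (intro mult_right_mono) auto
    also have "\<dots> = K ^ 3 * w\<^sup>2 * (\<theta> * r ^ a)"
      by (simp add: power2_eq_square power3_eq_cube mult_ac)
    also have "\<dots> \<le> K ^ 3 * w\<^sup>2 * r"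
      unfolding \<theta>0 using rk K0 by (intro mult_left_mono) auto
    finally show ?thesis by (simp add: mult_ac)
  qed
  have b7: "\<bar>\<theta> * (p \<bullet> M)\<bar> \<le> K\<^sup>2 * (r * w\<^sup>2)"
  proof -
    have "\<bar>p \<bullet> M\<bar> \<le> (K * w) * (K * r ^ a * w)"
      using M p K0 w unfolding w_def by (intro order_trans[OF Cauchy_Schwarz_ineq2] mult_mono) auto
    then have "\<bar>\<theta> * (p \<bullet> M)\<bar> \<le> \<theta> * ((K * w) * (K * r ^ a * w))"
      using \<theta>(1) by (simp add: abs_mult mult_left_mono)
    also have "\<dots> = K\<^sup>2 * w\<^sup>2 * (\<theta> * r ^ a)" by (simp add: power2_eq_square mult_ac)
    also have "\<dots> \<le> K\<^sup>2 * w\<^sup>2 * r"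
      unfolding \<theta>0 using rk by (intro mult_left_mono) auto
    finally show ?thesis by (simp add: mult_ac)
  qed
  define R where "R = r ^ (a + 2 + k)"
  have R1: "r ^ (a + 2 + k + 1) = R * r" by (simp add: R_def mult_ac)
  have R0: "0 \<le> R" using r by (simp add: R_def)
  \<comment> \<open>The magnetic terms have size y |v|, and Young's inequality leaves y^2. By
    \<open>D\<close> the exponent 2 * (D + 1) exceeds a + 2 + k, which spares a factor r.\<close>
  define y where "y = r ^ (D + 1)"
  have y0: "0 \<le> y" using r by (simp add: y_def)
  have y2: "y\<^sup>2 \<le> R * r"
  proof -
    have "y\<^sup>2 = r ^ (2 * D + 2)" by (simp add: y_def power_add power_mult power2_eq_square mult_ac flip: power_mult_distrib)
    also have "\<dots> \<le> r ^ (a + 2 + k + 1)" using r D by (intro power_decreasing) auto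
    finally show ?thesis by (simp only: R1)
  qed
  define Z where "Z = r * w\<^sup>2"
  have Z0: "0 \<le> Z" using r by (simp add: Z_def)
  have expand: "dp \<bullet> (x - (\<eta> * \<theta>) *\<^sub>R N) + p \<bullet> (v - \<eta> *\<^sub>R (\<theta>' *\<^sub>R N + \<theta> *\<^sub>R M))
    = Q + (1/2) * (x \<bullet> \<Gamma>) - x \<bullet> dU - x \<bullet> S - (1/2) * \<eta> * (\<theta> * (\<Gamma> \<bullet> N)) + \<eta> * \<theta> * (norm N)\<^sup>2
      + \<eta> * (\<theta> * ((dU - N) \<bullet> N)) + \<eta> * (\<theta> * (S \<bullet> N)) - \<eta> * (\<theta>' * (p \<bullet> N)) - \<eta> * (\<theta> * (p \<bullet> M))"
    unfolding dp power2_norm_eq_inner Q(1)[symmetric]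
    by (simp add: inner_diff_left inner_diff_right inner_add_left inner_add_right inner_commute algebra_simps)
  have "K\<^sup>2 \<le> K ^ 3" using K by (intro power_increasing) auto
  have K3: "\<eta> * K\<^sup>2 \<le> \<eta> * K ^ 3" "0 \<le> \<eta> * K\<^sup>2"
    using \<open>K\<^sup>2 \<le> K ^ 3\<close> \<eta> by (auto intro: mult_left_mono)
  have e3: "\<bar>\<eta> * (\<theta> * (\<Gamma> \<bullet> N))\<bar> \<le> \<eta> * K\<^sup>2 * Z"
    using mult_left_mono[OF b3 \<eta>] \<eta> by (simp add: abs_mult Z_def mult_ac)
  have e4: "\<bar>\<eta> * (\<theta> * ((dU - N) \<bullet> N))\<bar> \<le> \<eta> * K\<^sup>2 * (R * r)"
    using mult_left_mono[OF b4 \<eta>] \<eta> unfolding R1 by (simp add: abs_mult mult_ac)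
  have e5: "\<bar>\<eta> * (\<theta> * (S \<bullet> N))\<bar> \<le> \<eta> * K\<^sup>2 * (y * w)"
    using mult_left_mono[OF b5 \<eta>] \<eta> by (simp add: abs_mult y_def mult_ac)
  have e6: "\<bar>\<eta> * (\<theta>' * (p \<bullet> N))\<bar> \<le> \<eta> * K ^ 3 * Z"
    using mult_left_mono[OF b6 \<eta>] \<eta> by (simp add: abs_mult Z_def mult_ac)
  have e7: "\<bar>\<eta> * (\<theta> * (p \<bullet> M))\<bar> \<le> \<eta> * K\<^sup>2 * Z"
    using mult_left_mono[OF b7 \<eta>] \<eta> by (simp add: abs_mult Z_def mult_ac)
  have e1: "\<bar>x \<bullet> \<Gamma>\<bar> \<le> K * Z" using b1 by (simp add: Z_def)
  have e2: "\<bar>x \<bullet> S\<bar> \<le> K * (y * w)" using b2 by (simp add: y_def)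
  \<comment> \<open>This pays for the term l1 u in \<open>restoring\<close>: the difference to the
    true derivative has the favourable sign.\<close>
  have lu: "0 \<le> - real (a + 2) * u"
  proof -
    have "Q \<ge> 0" using Q(2) by (smt (verit) zero_le_power2)
    then have "u \<le> 0" using H by linarith
    then have "real (a + 2) * u \<le> 0" by (rule mult_nonneg_nonpos[OF of_nat_0_le_iff])
    then show ?thesis by linarith
  qed
  have EZ: "K * Z / 2 + \<eta> * K\<^sup>2 * Z / 2 + \<eta> * K ^ 3 * Z + \<eta> * K\<^sup>2 * Z \<le> E * Z"
  proof -
    have "(K / 2 + \<eta> * K\<^sup>2 / 2 + \<eta> * K ^ 3 + \<eta> * K\<^sup>2) * Z \<le> E * Z"
      using K3 K0 Z0 unfolding E by (intro mult_right_mono) (linarith, simp)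
    then show ?thesis by (simp add: algebra_simps)
  qed
  have Ey: "K * (y * w) + \<eta> * K\<^sup>2 * (y * w) \<le> E * (y * w)"
  proof -
    have "(K + \<eta> * K\<^sup>2) * (y * w) \<le> E * (y * w)"
      using K3 K0 y0 w unfolding E by (intro mult_right_mono) (linarith, simp)
    then show ?thesis by (simp add: algebra_simps)
  qed
  have ER: "K * (R * r) + \<eta> * K\<^sup>2 * (R * r) \<le> E * (R * r)"
  proof -
    have "(K + \<eta> * K\<^sup>2) * (R * r) \<le> E * (R * r)"
      using K3 K0 R0 r unfolding E by (intro mult_right_mono) (linarith, simp)
    then show ?thesis by (simp add: algebra_simps)
  qed
  \<comment> \<open>Young's inequality, weighted so that it spends exactly half of w^2/2.\<close>
  have yw: "E * (y * w) \<le> w\<^sup>2 / 4 + E\<^sup>2 * (R * r)"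
  proof -
    have "0 \<le> (w / 2 - E * y)\<^sup>2" by simp
    then have "E * (y * w) \<le> w\<^sup>2 / 4 + E\<^sup>2 * y\<^sup>2"
      by (simp add: power2_eq_square algebra_simps)
    moreover have "E\<^sup>2 * y\<^sup>2 \<le> E\<^sup>2 * (R * r)" using y2 by (intro mult_left_mono) auto
    ultimately show ?thesis by linarith
  qed
  have "E * Z \<le> w\<^sup>2 / 4"
    using mult_right_mono[OF small(1), of "w\<^sup>2"] by (simp add: Z_def mult_ac)
  moreover have "E * (R * r) + E\<^sup>2 * (R * r) \<le> c / 2 * R"
    using mult_left_mono[OF small(2) R0] by (simp add: algebra_simps)
  moreover have "w\<^sup>2 \<le> 2 * Q" using Q(2) by (simp add: w_def)
  moreover have "c * R - K * (R * r) \<le> real (a + 2) * u - x \<bullet> dU + \<eta> * \<theta> * (norm N)\<^sup>2"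
    using restoring unfolding R1 by (simp only: R_def)
  moreover have "c * R = c / 2 * R + c / 2 * R" by simp
  ultimately have "c / 2 * R \<le> dp \<bullet> (x - (\<eta> * \<theta>) *\<^sub>R N) + p \<bullet> (v - \<eta> *\<^sub>R (\<theta>' *\<^sub>R N + \<theta> *\<^sub>R M))"
    unfolding expand using e1 e2 e3 e4 e5 e6 e7 lu EZ Ey ER yw unfolding abs_le_iff
    by linarith
  then show ?thesis by (simp only: R_def)
qed

text \<open>On the compact set where A <= 0, B has a positive minimum, so a large multiple of B
  outweighs A there; elsewhere A > 0 and B >= 0. The minimum of the sum over S then provides
  c.\<close>

lemma compact_penalization:
  fixes A B :: "'a::metric_space \<Rightarrow> real"
  assumes S: "compact S" and A: "continuous_on S A" and B: "continuous_on S B"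
    and nonneg: "\<And>q. q \<in> S \<Longrightarrow> 0 \<le> B q" and pos: "\<And>q. q \<in> S \<Longrightarrow> B q = 0 \<Longrightarrow> 0 < A q"
  shows "\<exists>\<eta> c. 0 \<le> \<eta> \<and> 0 < c \<and> (\<forall>q\<in>S. c \<le> A q + \<eta> * B q)"
proof -
  define Z where "Z = {q \<in> S. A q \<le> 0}"
  have "closedin (top_of_set S) Z"
    using continuous_closedin_preimage[OF A closed_atMost[of 0]]
    by (simp add: Z_def vimage_def Collect_conj_eq Int_commute)
  then have Z: "compact Z" by (rule closedin_compact[OF S])
  have "Z \<subseteq> S" by (auto simp: Z_def)
  have "\<exists>\<eta>\<ge>0. \<forall>q\<in>S. 0 < A q + \<eta> * B q"
  proof (cases "Z = {}")
    case True
    then show ?thesis by (intro exI[of _ 0]) (auto simp: Z_def)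
  next
    case False
    obtain q1 where q1: "q1 \<in> Z" "\<And>q. q \<in> Z \<Longrightarrow> B q1 \<le> B q"
      using continuous_attains_inf[OF Z False continuous_on_subset[OF B \<open>Z \<subseteq> S\<close>]] by blast
    obtain q2 where q2: "q2 \<in> Z" "\<And>q. q \<in> Z \<Longrightarrow> A q2 \<le> A q"
      using continuous_attains_inf[OF Z False continuous_on_subset[OF A \<open>Z \<subseteq> S\<close>]] by blast
    have b: "0 < B q1"
      using q1(1) nonneg[of q1] pos[of q1] by (force simp: Z_def)
    \<comment> \<open>Makes the sum at least min A + (1 - min A) = 1 on Z.\<close>
    define \<eta> where "\<eta> = (1 - A q2) / B q1"
    have a: "A q2 \<le> 0" using q2(1) by (simp add: Z_def)
    have \<eta>: "0 \<le> \<eta>" using a b by (simp add: \<eta>_def)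
    have "0 < A q + \<eta> * B q" if "q \<in> S" for q
    proof (cases "q \<in> Z")
      case True
      have "\<eta> * B q1 \<le> \<eta> * B q" using q1(2)[OF True] \<eta> by (rule mult_left_mono)
      then show ?thesis using b q2(2)[OF True] by (simp add: \<eta>_def)
    next
      case False
      then show ?thesis
        using that nonneg[OF that] \<eta> by (simp add: Z_def add_pos_nonneg)
    qed
    then show ?thesis using \<eta> by blast
  qed
  then obtain \<eta> where \<eta>: "0 \<le> \<eta>" "\<And>q. q \<in> S \<Longrightarrow> 0 < A q + \<eta> * B q" by blast
  show ?thesis
  proof (cases "S = {}")
    case True
    then show ?thesis by (intro exI[of _ 0] exI[of _ 1]) auto
  next
    case False
    have "continuous_on S (\<lambda>q. A q + \<eta> * B q)" by (intro continuous_intros A B)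
    from continuous_attains_inf[OF S False this] obtain q0 where
      "q0 \<in> S" "\<And>q. q \<in> S \<Longrightarrow> A q0 + \<eta> * B q0 \<le> A q + \<eta> * B q" by blast
    then show ?thesis using \<eta> by (intro exI[of _ \<eta>] exI[of _ "A q0 + \<eta> * B q0"]) auto
  qed
qed

subsection \<open>The Euler--Lagrange flow\<close>

lemma vec_has_vector_derivative:
  assumes "\<And>i. ((\<lambda>t. F t $ i) has_real_derivative F' $ i) (at t within S)"
  shows "(F has_vector_derivative F') (at t within S)"
  unfolding has_vector_derivative_def
proof (subst has_derivative_componentwise_within, rule)
  fix b :: "real ^ 'a" assume "b \<in> Basis"
  then obtain i where b: "b = axis i 1" by (auto simp: Basis_vec_def)
  show "((\<lambda>t. F t \<bullet> b) has_derivative (\<lambda>h. (h *\<^sub>R F') \<bullet> b)) (at t within S)"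
    using assms[of i] unfolding b has_field_derivative_def
    by (simp add: inner_axis mult_commute_abs)
qed

lemma norm_vec_le_sum:
  fixes F :: "real ^ 'n"
  assumes "\<And>i. \<bar>F $ i\<bar> \<le> b i"
  shows "norm F \<le> (\<Sum>i\<in>UNIV. b i)"
  using norm_le_l1_cart[of F] sum_mono[of UNIV "\<lambda>i. \<bar>F $ i\<bar>" b] assms by fastforce

section \<open>Solutions of the equation of motion and their concatenation\<close>

text \<open>The equation solved for the acceleration: \<open>cov_deriv\<close> is its last argument
  plus the Christoffel term, which is therefore its value at 0.\<close>

definition el_acc :: "(real ^ 'n \<Rightarrow> real ^ 'n ^ 'n) \<Rightarrow> (real ^ 'n \<Rightarrow> real ^ 'n) \<Rightarrow>
    (real ^ 'n \<Rightarrow> real) \<Rightarrow> real ^ 'n \<Rightarrow> real ^ 'n \<Rightarrow> real ^ 'n" where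
  "el_acc g \<sigma> U x v = - riem_grad g U x - riesz g x (contract_d \<sigma> x v) - cov_deriv g x v v 0"

lemma el_equation_iff_acc: "el_equation g \<sigma> U x v a \<longleftrightarrow> a = el_acc g \<sigma> U x v"
proof -
  have "cov_deriv g x v v a = a + cov_deriv g x v v 0" by (simp add: cov_deriv_def)
  then show ?thesis unfolding el_equation_def el_acc_def by (metis add_diff_cancel_right' diff_add_cancel)
qed

definition el_solution :: "(real ^ 'n) set \<Rightarrow> (real ^ 'n \<Rightarrow> real ^ 'n ^ 'n) \<Rightarrow> (real ^ 'n \<Rightarrow> real ^ 'n) \<Rightarrow>
    (real ^ 'n \<Rightarrow> real) \<Rightarrow> real \<Rightarrow> (real \<Rightarrow> real ^ 'n) \<Rightarrow> (real \<Rightarrow> real ^ 'n) \<Rightarrow> bool" where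
  "el_solution W g \<sigma> U t x v \<longleftrightarrow> (\<forall>s\<in>{0..t}. x s \<in> W \<and> (x has_vector_derivative v s) (at s within {0..t}) \<and>
     (v has_vector_derivative el_acc g \<sigma> U (x s) (v s)) (at s within {0..t}))"

lemma el_flow_iff:
  "el_flow W g \<sigma> U z t w \<longleftrightarrow> 0 \<le> t \<and>
     (\<exists>x v. (x 0, v 0) = z \<and> (x t, v t) = w \<and> el_solution W g \<sigma> U t x v)"
  unfolding el_flow_def el_equation_iff_acc el_solution_def by simp

lemma el_solution_restrict:
  assumes "el_solution W g \<sigma> U t x v" "s \<le> t"
  shows "el_solution W g \<sigma> U s x v"
  unfolding el_solution_def
proof (intro ballI conjI)
  fix r assume "r \<in> {0..s}"
  then have r: "r \<in> {0..t}" and sub: "{0..s} \<subseteq> {0..t}" using assms(2) by auto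
  have *: "x r \<in> W" "(x has_vector_derivative v r) (at r within {0..t})"
    "(v has_vector_derivative el_acc g \<sigma> U (x r) (v r)) (at r within {0..t})"
    using assms(1) r by (auto simp: el_solution_def)
  show "x r \<in> W" by (rule *(1))
  show "(x has_vector_derivative v r) (at r within {0..s})"
    by (rule has_vector_derivative_within_subset[OF *(2) sub])
  show "(v has_vector_derivative el_acc g \<sigma> U (x r) (v r)) (at r within {0..s})"
    by (rule has_vector_derivative_within_subset[OF *(3) sub])
qed

lemma el_solution_flow:
  assumes "el_solution W g \<sigma> U t x v" "s \<in> {0..t}"
  shows "el_flow W g \<sigma> U (x 0, v 0) s (x s, v s)"
  using assms el_solution_restrict[OF assms(1), of s] unfolding el_flow_iff by auto

text \<open>At the junction both one-sided derivatives exist, and \<open>f1' t = f2' 0\<close> makes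
  them agree.\<close>

lemma has_vector_derivative_concat:
  fixes f1 f2 :: "real \<Rightarrow> 'a::real_normed_vector"
  assumes t: "0 \<le> t" "0 \<le> h" "s \<in> {0..t + h}"
    and f1: "s \<in> {0..t} \<Longrightarrow> (f1 has_vector_derivative f1' s) (at s within {0..t})"
    and f2: "s \<in> {t..t + h} \<Longrightarrow> (f2 has_vector_derivative f2' (s - t)) (at (s - t) within {0..h})"
    and eq: "f1 t = f2 0" "f1' t = f2' 0"
  shows "((\<lambda>s. if s \<in> {0..t} then f1 s else f2 (s - t)) has_vector_derivative
     (if s \<in> {0..t} then f1' s else f2' (s - t))) (at s within {0..t + h})"
proof -
  have un: "{0..t + h} = {0..t} \<union> {t..t + h}" using t by auto
  have sh: "((\<lambda>s. f2 (s - t)) has_vector_derivative f2' (s - t)) (at s within {t..t + h})" if "s \<in> {t..t + h}"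
  proof -
    have im: "(\<lambda>s. s - t) ` {t..t + h} = {0..h}" by (simp add: image_diff_atLeastAtMost)
    have "((\<lambda>s. s - t) has_vector_derivative 1) (at s within {t..t + h})"
      by (auto intro!: derivative_eq_intros)
    from vector_diff_chain_within[OF this, of f2] f2[OF that] show ?thesis
      unfolding im by (simp add: o_def)
  qed
  have int: "{0..t} \<inter> {t..t + h} = {t}" using t by auto
  show ?thesis
  proof (rule has_vector_derivative_If_within_closures[where S = "{0..t}" and T = "{t..t + h}"
        and f = f1 and f' = f1' and g = "\<lambda>s. f2 (s - t)" and g' = "\<lambda>s. f2' (s - t)"])
    show "s \<in> {0..t} \<union> {t..t + h}" using t(3) un by simp
    show "(f1 has_vector_derivative f1' s) (at s within {0..t} \<union> closure {0..t} \<inter> closure {t..t + h})"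
      if "s \<in> {0..t} \<union> closure {0..t} \<inter> closure {t..t + h}"
    proof -
      have "{0..t} \<union> closure {0..t} \<inter> closure {t..t + h} = {0..t}" using t by auto
      then show ?thesis using f1 that by simp
    qed
    show "((\<lambda>s. f2 (s - t)) has_vector_derivative f2' (s - t)) (at s within {t..t + h} \<union> closure {0..t} \<inter> closure {t..t + h})"
      if "s \<in> {t..t + h} \<union> closure {0..t} \<inter> closure {t..t + h}"
    proof -
      have "{t..t + h} \<union> closure {0..t} \<inter> closure {t..t + h} = {t..t + h}" using t by auto
      then show ?thesis using sh that by simp
    qed
    show "f1 s = f2 (s - t)" "f1' s = f2' (s - t)" if "s \<in> closure {0..t}" "s \<in> closure {t..t + h}"
    proof -
      have "s = t" using that by auto
      then show "f1 s = f2 (s - t)" "f1' s = f2' (s - t)" using eq by simp_all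
    qed
  qed (use un in auto)
qed

text \<open>The acceleration is a function of the state, so two solutions that share the state at
  the junction have matching derivatives of position and velocity there and can be glued.\<close>

lemma el_flow_trans:
  assumes "el_flow W g \<sigma> U z t w" "el_flow W g \<sigma> U w h y"
  shows "el_flow W g \<sigma> U z (t + h) y"
proof -
  obtain x1 v1 where 1: "(x1 0, v1 0) = z" "(x1 t, v1 t) = w" "el_solution W g \<sigma> U t x1 v1" and t: "0 \<le> t"
    using assms(1) by (auto simp: el_flow_iff)
  obtain x2 v2 where 2: "(x2 0, v2 0) = w" "(x2 h, v2 h) = y" "el_solution W g \<sigma> U h x2 v2" and h: "0 \<le> h"
    using assms(2) by (auto simp: el_flow_iff)
  have eq: "x1 t = x2 0" "v1 t = v2 0" using 1(2) 2(1) by auto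
  define x where "x s = (if s \<in> {0..t} then x1 s else x2 (s - t))" for s
  define v where "v s = (if s \<in> {0..t} then v1 s else v2 (s - t))" for s
  have "el_solution W g \<sigma> U (t + h) x v"
    unfolding el_solution_def
  proof (intro ballI conjI)
    fix s assume s: "s \<in> {0..t + h}"
    show "x s \<in> W"
      using s 1(3) 2(3) unfolding x_def el_solution_def by auto
    show "(x has_vector_derivative v s) (at s within {0..t + h})"
      unfolding x_def[abs_def] v_def
      by (rule has_vector_derivative_concat[OF t h s]) (use 1(3) 2(3) eq in \<open>auto simp: el_solution_def\<close>)
    have "(v has_vector_derivative (if s \<in> {0..t} then el_acc g \<sigma> U (x1 s) (v1 s)
        else el_acc g \<sigma> U (x2 (s - t)) (v2 (s - t)))) (at s within {0..t + h})"
      unfolding v_def[abs_def]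
      by (rule has_vector_derivative_concat[OF t h s, where f2' = "\<lambda>r. el_acc g \<sigma> U (x2 r) (v2 r)"])
        (use 1(3) 2(3) eq in \<open>auto simp: el_solution_def\<close>)
    moreover have "(if s \<in> {0..t} then el_acc g \<sigma> U (x1 s) (v1 s)
        else el_acc g \<sigma> U (x2 (s - t)) (v2 (s - t))) = el_acc g \<sigma> U (x s) (v s)"
      by (simp add: x_def v_def)
    ultimately show "(v has_vector_derivative el_acc g \<sigma> U (x s) (v s)) (at s within {0..t + h})"
      by simp
  qed
  moreover have "(x 0, v 0) = z" using 1(1) t by (simp add: x_def v_def)
  moreover have "(x (t + h), v (t + h)) = y"
    using 1(2) 2(1,2) t h by (cases "h = 0") (auto simp: x_def v_def)
  ultimately show ?thesis using t h unfolding el_flow_iff by auto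
qed

section \<open>Lipschitz calculus for the vector field\<close>

text \<open>Boundedness is what keeps products of Lipschitz functions Lipschitz. The pair of
  properties is closed under sums and products, so an expression polynomial in v and in the
  coefficient functions is treated structurally.\<close>

definition lipschitz_bounded :: "'a::metric_space set \<Rightarrow> ('a \<Rightarrow> real) \<Rightarrow> bool" where
  "lipschitz_bounded S f \<longleftrightarrow> (\<exists>L. L-lipschitz_on S f) \<and> (\<exists>M. \<forall>z\<in>S. \<bar>f z\<bar> \<le> M)"

lemma lipschitz_boundedI:
  assumes f: "L-lipschitz_on S f" and "bounded S"
  shows "lipschitz_bounded S f"
proof (cases "S = {}")
  case True
  then show ?thesis using f by (auto simp: lipschitz_bounded_def)
next
  case False
  then obtain z0 where z0: "z0 \<in> S" by blast
  obtain e where e: "\<And>z. z \<in> S \<Longrightarrow> dist z0 z \<le> e" using assms(2) bounded_any_center[of S z0] by auto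
  have "\<bar>f z\<bar> \<le> \<bar>f z0\<bar> + L * e" if "z \<in> S" for z
  proof -
    have "\<bar>f z0 - f z\<bar> \<le> L * dist z0 z" using lipschitz_onD[OF f z0 that] by (simp add: dist_real_def)
    also have "\<dots> \<le> L * e" using e[OF that] lipschitz_on_nonneg[OF f] by (rule mult_left_mono)
    finally show ?thesis by linarith
  qed
  then show ?thesis using f unfolding lipschitz_bounded_def by blast
qed

lemma lipschitz_bounded_const: "lipschitz_bounded S (\<lambda>_. c)"
  unfolding lipschitz_bounded_def using lipschitz_on_constant[of S c] by (metis order_refl)

lemma lipschitz_bounded_add:
  assumes "lipschitz_bounded S f" "lipschitz_bounded S h"
  shows "lipschitz_bounded S (\<lambda>z. f z + h z)"
proof -
  obtain L L' M M' where *: "L-lipschitz_on S f" "L'-lipschitz_on S h" "\<And>z. z \<in> S \<Longrightarrow> \<bar>f z\<bar> \<le> M" "\<And>z. z \<in> S \<Longrightarrow> \<bar>h z\<bar> \<le> M'"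
    using assms unfolding lipschitz_bounded_def by blast
  have "\<bar>f z + h z\<bar> \<le> M + M'" if "z \<in> S" for z
    using *(3,4)[OF that] by linarith
  then show ?thesis
    using lipschitz_on_add[OF *(1,2)] unfolding lipschitz_bounded_def by blast
qed

lemma lipschitz_bounded_mult:
  assumes "lipschitz_bounded S f" "lipschitz_bounded S h"
  shows "lipschitz_bounded S (\<lambda>z. f z * h z)"
proof -
  obtain L L' M M' where *: "L-lipschitz_on S f" "L'-lipschitz_on S h" "\<And>z. z \<in> S \<Longrightarrow> \<bar>f z\<bar> \<le> M" "\<And>z. z \<in> S \<Longrightarrow> \<bar>h z\<bar> \<le> M'"
    using assms unfolding lipschitz_bounded_def by blast
  have L: "0 \<le> L" "0 \<le> L'" using *(1,2) lipschitz_on_nonneg by blast+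
  have "\<bar>f z * h z\<bar> \<le> M * M'" if "z \<in> S" for z
    unfolding abs_mult using *(3,4)[OF that] by (intro mult_mono) auto
  moreover have "(\<bar>M\<bar> * L' + \<bar>M'\<bar> * L)-lipschitz_on S (\<lambda>z. f z * h z)"
  proof (rule lipschitz_onI)
    fix z w assume zw: "z \<in> S" "w \<in> S"
    have "\<bar>f z * (h z - h w)\<bar> \<le> \<bar>M\<bar> * (L' * dist z w)"
      unfolding abs_mult using *(3)[OF zw(1)] lipschitz_onD[OF *(2) zw] by (intro mult_mono) (auto simp: dist_real_def)
    moreover have "\<bar>h w * (f z - f w)\<bar> \<le> \<bar>M'\<bar> * (L * dist z w)"
      unfolding abs_mult using *(4)[OF zw(2)] lipschitz_onD[OF *(1) zw] by (intro mult_mono) (auto simp: dist_real_def)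
    moreover have "f z * h z - f w * h w = f z * (h z - h w) + h w * (f z - f w)" by (simp add: algebra_simps)
    ultimately have "\<bar>f z * h z - f w * h w\<bar> \<le> \<bar>M\<bar> * (L' * dist z w) + \<bar>M'\<bar> * (L * dist z w)" by linarith
    then show "dist (f z * h z) (f w * h w) \<le> (\<bar>M\<bar> * L' + \<bar>M'\<bar> * L) * dist z w"
      by (simp add: dist_real_def algebra_simps)
  qed (use L in auto)
  ultimately show ?thesis unfolding lipschitz_bounded_def by blast
qed

lemma lipschitz_bounded_minus:
  assumes "lipschitz_bounded S f" shows "lipschitz_bounded S (\<lambda>z. - f z)"
  using lipschitz_bounded_mult[OF lipschitz_bounded_const[of S "-1"] assms] by simp

lemma lipschitz_bounded_diff:
  assumes "lipschitz_bounded S f" "lipschitz_bounded S h"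
  shows "lipschitz_bounded S (\<lambda>z. f z - h z)"
  using lipschitz_bounded_add[OF assms(1) lipschitz_bounded_minus[OF assms(2)]] by simp

lemma lipschitz_bounded_sum:
  assumes "\<And>i. i \<in> I \<Longrightarrow> lipschitz_bounded S (f i)"
  shows "lipschitz_bounded S (\<lambda>z. \<Sum>i\<in>I. f i z)"
  using assms
proof (induction I rule: infinite_finite_induct)
  case (insert i I)
  then show ?case using lipschitz_bounded_add[of S "f i" "\<lambda>z. \<Sum>i\<in>I. f i z"] by simp
qed (simp_all add: lipschitz_bounded_const)

lemma lipschitz_bounded_fst:
  assumes "L-lipschitz_on A f" "S \<subseteq> A \<times> UNIV" "bounded S"
  shows "lipschitz_bounded S (\<lambda>z. f (fst z))"
proof (rule lipschitz_boundedI[OF _ assms(3)])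
  show "L-lipschitz_on S (\<lambda>z. f (fst z))"
  proof (rule lipschitz_onI)
    fix z w assume "z \<in> S" "w \<in> S"
    then have "dist (f (fst z)) (f (fst w)) \<le> L * dist (fst z) (fst w)"
      using assms(2) by (intro lipschitz_onD[OF assms(1)]) auto
    also have "\<dots> \<le> L * dist z w"
      using lipschitz_on_nonneg[OF assms(1)] by (intro mult_left_mono dist_fst_le)
    finally show "dist (f (fst z)) (f (fst w)) \<le> L * dist z w" .
  qed (rule lipschitz_on_nonneg[OF assms(1)])
qed

lemma lipschitz_bounded_snd_nth:
  fixes S :: "('a::metric_space \<times> (real ^ 'n)) set"
  assumes "bounded S"
  shows "lipschitz_bounded S (\<lambda>z. snd z $ j)"
proof (rule lipschitz_boundedI[OF _ assms])
  show "1-lipschitz_on S (\<lambda>z. snd z $ j)"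
  proof (rule lipschitz_onI)
    fix z w :: "'a \<times> (real ^ 'n)"
    have "dist (snd z $ j) (snd w $ j) \<le> dist (snd z) (snd w)" by (rule dist_vec_nth_le)
    also have "\<dots> \<le> dist z w" by (rule dist_snd_le)
    finally show "dist (snd z $ j) (snd w $ j) \<le> 1 * dist z w" by simp
  qed simp
qed

lemma lipschitz_bounded_components:
  fixes F :: "'a::metric_space \<Rightarrow> real ^ 'n"
  assumes "\<And>i. lipschitz_bounded S (\<lambda>z. F z $ i)"
  shows "\<exists>L M. 0 \<le> M \<and> L-lipschitz_on S F \<and> (\<forall>z\<in>S. norm (F z) \<le> M)"
proof -
  have "\<forall>i. \<exists>L. L-lipschitz_on S (\<lambda>z. F z $ i)" "\<forall>i. \<exists>M. \<forall>z\<in>S. \<bar>F z $ i\<bar> \<le> M"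
    using assms unfolding lipschitz_bounded_def by blast+
  then obtain L M where L: "\<And>i. (L i)-lipschitz_on S (\<lambda>z. F z $ i)" and M: "\<And>i z. z \<in> S \<Longrightarrow> \<bar>F z $ i\<bar> \<le> M i"
    by metis
  have "(\<Sum>i\<in>UNIV. L i)-lipschitz_on S F"
  proof (rule lipschitz_onI)
    show "0 \<le> (\<Sum>i\<in>UNIV. L i)" using lipschitz_on_nonneg[OF L] by (simp add: sum_nonneg)
    fix z w assume zw: "z \<in> S" "w \<in> S"
    have "norm (F z - F w) \<le> (\<Sum>i\<in>UNIV. L i * dist z w)"
      using lipschitz_onD[OF L zw] by (intro norm_vec_le_sum) (simp add: dist_real_def)
    then show "dist (F z) (F w) \<le> (\<Sum>i\<in>UNIV. L i) * dist z w"
      by (simp add: dist_norm sum_distrib_right)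
  qed
  moreover have "norm (F z) \<le> \<bar>\<Sum>i\<in>UNIV. M i\<bar>" if "z \<in> S" for z
    using norm_vec_le_sum[of "F z" M] M[OF that] by fastforce
  ultimately show ?thesis by (intro exI[of _ "\<Sum>i\<in>UNIV. L i"] exI[of _ "\<bar>\<Sum>i\<in>UNIV. M i\<bar>"]) auto
qed

section \<open>The equation of motion for the momentum g v, and conservation of energy\<close>

definition diff_vec :: "(real ^ 'n \<Rightarrow> real) \<Rightarrow> real ^ 'n \<Rightarrow> real ^ 'n" where
  "diff_vec U x = (\<chi> i. partial_deriv i U x)"

text \<open>The differential in x of the quadratic form g_x(v, v); half of it is the kinetic part of
  the x-derivative of the Lagrangian.\<close>

definition metric_force :: "(real ^ 'n \<Rightarrow> real ^ 'n ^ 'n) \<Rightarrow> real ^ 'n \<Rightarrow> real ^ 'n \<Rightarrow> real ^ 'n" where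
  "metric_force g x v = (\<chi> i. \<Sum>j\<in>UNIV. \<Sum>k\<in>UNIV. partial_deriv i (\<lambda>y. g y $ j $ k) x * v $ j * v $ k)"

text \<open>The derivative of the matrix g in the direction v, applied to v: the part of d/dt (g v)
  that is free of the acceleration.\<close>

definition metric_transport :: "(real ^ 'n \<Rightarrow> real ^ 'n ^ 'n) \<Rightarrow> real ^ 'n \<Rightarrow> real ^ 'n \<Rightarrow> real ^ 'n" where
  "metric_transport g x v = (\<chi> i. \<Sum>j\<in>UNIV. \<Sum>k\<in>UNIV. partial_deriv k (\<lambda>y. g y $ i $ j) x * v $ j * v $ k)"

text \<open>Both sides are the same cubic form in v with summation indices renamed. It is the
  identity by which the kinetic terms cancel in the conservation of energy.\<close>

lemma inner_metric_transport: "v \<bullet> metric_transport g x v = v \<bullet> metric_force g x v"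
proof -
  let ?d = "\<lambda>i j k. partial_deriv i (\<lambda>y. g y $ j $ k) x"
  have "v \<bullet> metric_transport g x v = (\<Sum>i\<in>UNIV. \<Sum>j\<in>UNIV. \<Sum>k\<in>UNIV. ?d k i j * v $ i * v $ j * v $ k)"
    by (simp add: inner_vec_def metric_transport_def sum_distrib_left mult_ac)
  also have "\<dots> = (\<Sum>i\<in>UNIV. \<Sum>k\<in>UNIV. \<Sum>j\<in>UNIV. ?d k i j * v $ i * v $ j * v $ k)"
    by (rule sum.cong[OF refl], rule sum.swap)
  also have "\<dots> = (\<Sum>k\<in>UNIV. \<Sum>i\<in>UNIV. \<Sum>j\<in>UNIV. ?d k i j * v $ i * v $ j * v $ k)"
    by (rule sum.swap)
  also have "\<dots> = v \<bullet> metric_force g x v"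
    by (simp add: inner_vec_def metric_force_def sum_distrib_left mult_ac)
  finally show ?thesis .
qed

text \<open>Antisymmetry of d\<sigma>: the magnetic force does no work.\<close>

lemma inner_contract_d: "v \<bullet> contract_d \<sigma> x v = 0"
proof -
  let ?d = "\<lambda>i j. partial_deriv j (\<lambda>y. \<sigma> y $ i) x"
  have "v \<bullet> contract_d \<sigma> x v = (\<Sum>i\<in>UNIV. \<Sum>j\<in>UNIV. ?d i j * v $ i * v $ j) - (\<Sum>i\<in>UNIV. \<Sum>j\<in>UNIV. ?d j i * v $ i * v $ j)"
    by (simp add: inner_vec_def contract_d_def sum_distrib_left algebra_simps flip: sum_subtractf)
  also have "(\<Sum>i\<in>UNIV. \<Sum>j\<in>UNIV. ?d j i * v $ i * v $ j) = (\<Sum>j\<in>UNIV. \<Sum>i\<in>UNIV. ?d j i * v $ i * v $ j)"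
    by (rule sum.swap)
  also have "\<dots> = (\<Sum>i\<in>UNIV. \<Sum>j\<in>UNIV. ?d i j * v $ i * v $ j)"
    by (simp add: mult_ac)
  finally show ?thesis by simp
qed

locale lagrangian_ball =
  fixes W :: "(real ^ 'n) set" and g :: "real ^ 'n \<Rightarrow> real ^ 'n ^ 'n"
    and \<sigma> :: "real ^ 'n \<Rightarrow> real ^ 'n" and U :: "real ^ 'n \<Rightarrow> real" and \<rho> K :: real
  assumes openW: "open W" and \<rho>: "0 < \<rho>" "ball 0 \<rho> \<subseteq> W" and metric: "riemannian_metric_on g W"
    and K: "1 \<le> K"
    and U_diff: "\<And>x. x \<in> ball 0 \<rho> \<Longrightarrow> U differentiable (at x)"
    and g_diff: "\<And>i j x. x \<in> ball 0 \<rho> \<Longrightarrow> (\<lambda>y. g y $ i $ j) differentiable (at x)"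
    and elliptic: "\<And>x v. x \<in> ball 0 \<rho> \<Longrightarrow> (norm v)\<^sup>2 \<le> 2 * (v \<bullet> (g x *v v))"
    and g_bound: "\<And>x v. x \<in> ball 0 \<rho> \<Longrightarrow> norm (g x *v v) \<le> K * norm v"
    and U_bound: "\<And>x. x \<in> ball 0 \<rho> \<Longrightarrow> \<bar>U x\<bar> \<le> K * (norm x)\<^sup>2"
    and g_lip: "\<And>i j. \<exists>L. L-lipschitz_on (ball 0 \<rho>) (\<lambda>y. g y $ i $ j)"
    and dg_lip: "\<And>k i j. \<exists>L. L-lipschitz_on (ball 0 \<rho>) (partial_deriv k (\<lambda>y. g y $ i $ j))"
    and dU_lip: "\<And>i. \<exists>L. L-lipschitz_on (ball 0 \<rho>) (partial_deriv i U)"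
    and d\<sigma>_lip: "\<And>k i. \<exists>L. L-lipschitz_on (ball 0 \<rho>) (partial_deriv k (\<lambda>y. \<sigma> y $ i))"
begin

text \<open>The time derivative of g v, not of the canonical momentum g v + \<sigma>: the derivative
  of \<sigma> along the orbit is moved to the right, where it combines with the x-derivative of
  \<sigma> . v to the contraction of d\<sigma>.\<close>

definition force :: "real ^ 'n \<Rightarrow> real ^ 'n \<Rightarrow> real ^ 'n" where
  "force x v = (1/2) *\<^sub>R metric_force g x v - diff_vec U x - contract_d \<sigma> x v"

abbreviation acc :: "real ^ 'n \<Rightarrow> real ^ 'n \<Rightarrow> real ^ 'n" where
  "acc \<equiv> el_acc g \<sigma> U"

lemma g_sym: "x \<in> W \<Longrightarrow> transpose (g x) = g x"
  using metric by (auto simp: riemannian_metric_on_def)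

lemma acc_lowered:
  assumes x: "x \<in> ball 0 \<rho>"
  shows "g x *v acc x v = force x v - metric_transport g x v"
proof -
  have xW: "x \<in> W" using x \<rho>(2) by auto
  have "u = 0" if "g x *v u = 0" for u
    using elliptic[OF x, of u] that by simp
  then have "invertible (g x)"
    by (metis invertible_left_inverse matrix_left_invertible_ker)
  then have "\<forall>i. (\<Sum>j\<in>UNIV. g x $ i $ j * acc x v $ j) + (\<Sum>j\<in>UNIV. \<Sum>k\<in>UNIV. 
        (partial_deriv k (\<lambda>y. g y $ i $ j) x - (1/2) * partial_deriv i (\<lambda>y. g y $ j $ k) x) * v $ j * v $ k)
     = - partial_deriv i U x - (\<Sum>j\<in>UNIV. (partial_deriv j (\<lambda>y. \<sigma> y $ i) x - partial_deriv i (\<lambda>y. \<sigma> y $ j) x) * v $ j)"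
    using el_equation_lowered[where g = g and \<sigma> = \<sigma> and U = U and v = v and a = "acc x v",
        OF _ g_sym openW xW g_diff[OF x]] el_equation_iff_acc by blast
  moreover have "(\<Sum>j\<in>UNIV. \<Sum>k\<in>UNIV. 
        (partial_deriv k (\<lambda>y. g y $ i $ j) x - (1/2) * partial_deriv i (\<lambda>y. g y $ j $ k) x) * v $ j * v $ k)
      = metric_transport g x v $ i - (1/2) * metric_force g x v $ i" for i
    by (simp add: metric_transport_def metric_force_def left_diff_distrib sum_subtractf sum_divide_distrib)
  ultimately have "(g x *v acc x v) $ i = (force x v - metric_transport g x v) $ i" for i
    by (simp add: matrix_vector_mult_def force_def contract_d_def diff_vec_def eq_diff_eq' add_divide_distrib)
  then show ?thesis by (simp add: vec_eq_iff)
qed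

lemma momentum_has_vector_derivative:
  assumes x: "x s \<in> ball 0 \<rho>"
    and "(x has_vector_derivative v s) (at s within S)" "(v has_vector_derivative acc (x s) (v s)) (at s within S)"
  shows "((\<lambda>r. g (x r) *v v r) has_vector_derivative force (x s) (v s)) (at s within S)"
proof (rule vec_has_vector_derivative)
  fix i
  have [simp]: "partial_deriv k (\<lambda>y :: real ^ 'n. 0 :: real) y = 0" for k y
    by (rule partial_derivI) simp
  \<comment> \<open>\<open>momentum_derivative\<close> treats g v + \<sigma>; the zero one-form
    leaves g v alone.\<close>
  have "((\<lambda>r. (\<Sum>j\<in>UNIV. g (x r) $ i $ j * v r $ j) + (0 :: real ^ 'n) $ i) has_real_derivative
     (\<Sum>j\<in>UNIV. (\<Sum>k\<in>UNIV. partial_deriv k (\<lambda>y. g y $ i $ j) (x s) * v s $ k) * v s $ j + g (x s) $ i $ j * acc (x s) (v s) $ j)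
      + (\<Sum>k\<in>UNIV. partial_deriv k (\<lambda>y. (0 :: real ^ 'n) $ i) (x s) * v s $ k)) (at s within S)"
    by (rule momentum_derivative[where \<sigma> = "\<lambda>_. 0"]) (use g_diff[OF x] assms in auto)
  moreover have "(\<Sum>j\<in>UNIV. (\<Sum>k\<in>UNIV. partial_deriv k (\<lambda>y. g y $ i $ j) (x s) * v s $ k) * v s $ j + g (x s) $ i $ j * acc (x s) (v s) $ j)
      = metric_transport g (x s) (v s) $ i + (g (x s) *v acc (x s) (v s)) $ i"
    by (simp add: metric_transport_def matrix_vector_mult_def sum.distrib sum_distrib_left mult_ac)
  ultimately show "((\<lambda>r. (g (x r) *v v r) $ i) has_real_derivative force (x s) (v s) $ i) (at s within S)"
    unfolding acc_lowered[OF x] by (simp add: matrix_vector_mult_def)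
qed

text \<open>By symmetry of g the form v . g v has derivative v . force + v . (g acc) = 2 v . force -
  v . \<open>metric_force\<close>, which reduces to -2 v . dU. Half of it cancels against the
  derivative of U.\<close>

lemma energy_constant:
  assumes sol: "el_solution W g \<sigma> U t x v" and ball: "\<And>s. s \<in> {0..t} \<Longrightarrow> x s \<in> ball 0 \<rho>" and s: "s \<in> {0..t}"
  shows "energy g U (x s, v s) = energy g U (x 0, v 0)"
proof -
  have "((\<lambda>r. energy g U (x r, v r)) has_vector_derivative 0) (at s within {0..t})" if s: "s \<in> {0..t}" for s
  proof -
    have x: "(x has_vector_derivative v s) (at s within {0..t})"
      and v: "(v has_vector_derivative acc (x s) (v s)) (at s within {0..t})"
      using sol s by (auto simp: el_solution_def)
    let ?p = "\<lambda>r. g (x r) *v v r"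
    have sym: "?p s \<bullet> acc (x s) (v s) = v s \<bullet> (g (x s) *v acc (x s) (v s))"
      using g_sym[of "x s"] ball[OF s] \<rho>(2) by (metis dot_lmul_matrix in_mono transpose_matrix_vector inner_commute)
    have U: "((\<lambda>r. U (x r)) has_vector_derivative diff_vec U (x s) \<bullet> v s) (at s within {0..t})"
      using chain_partials[OF U_diff[OF ball[OF s]] x]
      by (simp add: has_real_derivative_iff_has_vector_derivative diff_vec_def inner_vec_def)
    have "((\<lambda>r. v r \<bullet> ?p r) has_vector_derivative v s \<bullet> force (x s) (v s) + acc (x s) (v s) \<bullet> ?p s) (at s within {0..t})"
      by (rule bounded_bilinear.has_vector_derivative[OF bounded_bilinear_inner v momentum_has_vector_derivative[OF ball[OF s] x v]])
    then have "((\<lambda>r. (1/2) * (v r \<bullet> ?p r)) has_vector_derivative (1/2) * (v s \<bullet> force (x s) (v s) + acc (x s) (v s) \<bullet> ?p s)) (at s within {0..t})"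
      by (rule has_vector_derivative_mult_right)
    from has_vector_derivative_add[OF this U]
    have "((\<lambda>r. energy g U (x r, v r)) has_vector_derivative
       (1/2) * (v s \<bullet> force (x s) (v s) + acc (x s) (v s) \<bullet> ?p s) + diff_vec U (x s) \<bullet> v s) (at s within {0..t})"
      by (simp add: energy_def)
    moreover have "(1/2) * (v s \<bullet> force (x s) (v s) + acc (x s) (v s) \<bullet> ?p s) + diff_vec U (x s) \<bullet> v s = 0"
    proof -
      have "v s \<bullet> force (x s) (v s) = (1/2) * (v s \<bullet> metric_force g (x s) (v s)) - v s \<bullet> diff_vec U (x s)"
        by (simp add: force_def inner_diff_right inner_contract_d)
      moreover have "acc (x s) (v s) \<bullet> ?p s = v s \<bullet> force (x s) (v s) - v s \<bullet> metric_force g (x s) (v s)"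
        unfolding inner_commute[of "acc (x s) (v s)"] sym acc_lowered[OF ball[OF s]]
        by (simp add: inner_diff_right inner_metric_transport)
      ultimately show ?thesis by (simp add: inner_commute[of "diff_vec U (x s)"])
    qed
    ultimately show ?thesis by simp
  qed
  then obtain c where "\<And>r. r \<in> {0..t} \<Longrightarrow> energy g U (x r, v r) = c"
    using has_vector_derivative_zero_constant[of "{0..t}" "\<lambda>r. energy g U (x r, v r)"] by blast
  then show ?thesis using s by auto
qed

lemma velocity_bound:
  assumes "fst z \<in> ball 0 \<rho>" "energy g U z \<le> 0"
  shows "norm (snd z) \<le> 2 * K * norm (fst z)"
proof -
  have "(norm (snd z))\<^sup>2 \<le> 4 * \<bar>U (fst z)\<bar>"
    using elliptic[OF assms(1), of "snd z"] assms(2) by (simp add: energy_def)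
  also have "\<dots> \<le> 4 * (K * (norm (fst z))\<^sup>2)"
    using U_bound[OF assms(1)] by simp
  \<comment> \<open>K <= K^2 produces a perfect square.\<close>
  also have "\<dots> \<le> 4 * (K\<^sup>2 * (norm (fst z))\<^sup>2)"
    using K by (intro mult_left_mono mult_right_mono) (auto simp: power2_eq_square)
  also have "\<dots> = (2 * K * norm (fst z))\<^sup>2" by (simp add: power_mult_distrib)
  finally show ?thesis by (rule power2_le_imp_le) (use K in simp)
qed

lemma energy_bound:
  assumes "fst z \<in> ball 0 \<rho>"
  shows "\<bar>energy g U z\<bar> \<le> K * ((norm (snd z))\<^sup>2 + (norm (fst z))\<^sup>2)"
proof -
  have "\<bar>snd z \<bullet> (g (fst z) *v snd z)\<bar> \<le> norm (snd z) * (K * norm (snd z))"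
    using g_bound[OF assms, of "snd z"] by (intro order_trans[OF Cauchy_Schwarz_ineq2] mult_left_mono) auto
  then have "\<bar>(1/2) * (snd z \<bullet> (g (fst z) *v snd z))\<bar> \<le> K * (norm (snd z))\<^sup>2"
    using K by (simp add: power2_eq_square mult_ac abs_mult) 
  then show ?thesis
    using U_bound[OF assms] unfolding energy_def by (simp add: distrib_left)
qed

end

section \<open>A uniform existence time\<close>

context lagrangian_ball begin

text \<open>The point is that h is independent of z, so that steps can be repeated without
  shrinking. The set \<open>S\<close> leaves room for a displacement of \<rho>/4 in position and of
  1 in velocity.\<close>

lemma flow_step:
  "\<exists>h>0. \<forall>z. norm (fst z) \<le> \<rho> / 4 \<and> norm (snd z) \<le> V \<longrightarrow> (\<exists>w. el_flow W g \<sigma> U z h w)"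
proof -
  define S where "S = cball (0 :: real ^ 'n) (\<rho> / 2) \<times> cball (0 :: real ^ 'n) (\<bar>V\<bar> + 1)"
  have S: "bounded S" "convex S" "closed S"
    by (auto simp: S_def intro: bounded_Times convex_Times closed_Times)
  have Sb: "fst z \<in> ball 0 \<rho>" if "z \<in> S" for z
    using that \<rho>(1) by (auto simp: S_def)
  then have sub: "S \<subseteq> ball 0 \<rho> \<times> UNIV" by auto
  have lb: "lipschitz_bounded S (\<lambda>z. f (fst z))" if "\<exists>L. L-lipschitz_on (ball 0 \<rho>) f" for f :: "real ^ 'n \<Rightarrow> real"
    using that lipschitz_bounded_fst[OF _ sub S(1)] by blast
  define b where "b z = force (fst z) (snd z) - metric_transport g (fst z) (snd z)" for z
  have b_comp: "lipschitz_bounded S (\<lambda>z. b z $ i)" for i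
  proof -
    have "lipschitz_bounded S (\<lambda>z.
       (1/2) * (\<Sum>j\<in>UNIV. \<Sum>k\<in>UNIV. partial_deriv i (\<lambda>y. g y $ j $ k) (fst z) * snd z $ j * snd z $ k)
       - partial_deriv i U (fst z)
       - (\<Sum>j\<in>UNIV. (partial_deriv j (\<lambda>y. \<sigma> y $ i) (fst z) - partial_deriv i (\<lambda>y. \<sigma> y $ j) (fst z)) * snd z $ j)
       - (\<Sum>j\<in>UNIV. \<Sum>k\<in>UNIV. partial_deriv k (\<lambda>y. g y $ i $ j) (fst z) * snd z $ j * snd z $ k))"
      by (intro lipschitz_bounded_diff lipschitz_bounded_mult lipschitz_bounded_const lipschitz_bounded_sum
          lipschitz_bounded_snd_nth[OF S(1)] lb dg_lip dU_lip d\<sigma>_lip)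
    then show ?thesis
      by (simp add: b_def force_def metric_transport_def metric_force_def diff_vec_def contract_d_def)
  qed
  obtain Lb Mb where Mb: "0 \<le> Mb" "\<And>z. z \<in> S \<Longrightarrow> norm (b z) \<le> Mb" and Lb: "Lb-lipschitz_on S b"
    using lipschitz_bounded_components[of S b] b_comp by blast
  have Lb0: "0 \<le> Lb" using Lb by (rule lipschitz_on_nonneg)
  obtain Lg where Lg: "\<And>i j. (Lg i j)-lipschitz_on (ball 0 \<rho>) (\<lambda>y. g y $ i $ j)"
    using g_lip by metis
  define G where "G = (\<Sum>i\<in>UNIV. \<Sum>j\<in>UNIV. Lg i j)"
  have Lg0: "0 \<le> Lg i j" for i j using Lg by (rule lipschitz_on_nonneg)
  have G0: "0 \<le> G" unfolding G_def by (intro sum_nonneg Lg0)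
  have inv_bound: "norm u \<le> 2 * norm (g x *v u)" if "x \<in> ball 0 \<rho>" for x u
  proof (cases "u = 0")
    case False
    have "norm u * norm u \<le> norm u * (2 * norm (g x *v u))"
      using elliptic[OF that, of u] norm_cauchy_schwarz[of u "g x *v u"] by (simp add: power2_eq_square)
    then show ?thesis using False by simp
  qed simp
  define A where "A z = acc (fst z) (snd z)" for z
  have gA: "g (fst z) *v A z = b z" if "z \<in> S" for z
    unfolding A_def b_def by (rule acc_lowered[OF Sb[OF that]])
  have A_bound: "norm (A z) \<le> 2 * Mb" if "z \<in> S" for z
    using inv_bound[OF Sb[OF that], of "A z"] gA[OF that] Mb(2)[OF that] by simp
  have A_lip: "norm (A z - A w) \<le> (2 * Lb + 4 * G * Mb) * dist z w" if zw: "z \<in> S" "w \<in> S" for z w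
  proof -
    \<comment> \<open>This avoids Lipschitz estimates for the inverse matrix: the difference of the
      metrics acts on the bounded vector \<open>A w\<close>, and ellipticity gives |u| <= 2 |g
      u|.\<close>
    have "g (fst z) *v (A z - A w) = (b z - b w) + (g (fst w) - g (fst z)) *v A w"
      unfolding matrix_vector_mult_diff_distrib matrix_vector_mult_diff_rdistrib gA[OF zw(1)] gA[OF zw(2)] by simp
    then have "norm (g (fst z) *v (A z - A w)) \<le> norm (b z - b w) + norm ((g (fst w) - g (fst z)) *v A w)"
      by (metis norm_triangle_ineq)
    moreover have "norm (b z - b w) \<le> Lb * dist z w"
      using lipschitz_onD[OF Lb zw] by (simp add: dist_norm)
    moreover have "norm ((g (fst w) - g (fst z)) *v A w) \<le> (\<Sum>i\<in>UNIV. \<Sum>j\<in>UNIV. Lg i j * dist z w * (2 * Mb))"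
    proof (rule norm_vec_le_sum)
      fix i
      have "norm (\<Sum>j\<in>UNIV. (g (fst w) - g (fst z)) $ i $ j * A w $ j) \<le> (\<Sum>j\<in>UNIV. Lg i j * dist z w * (2 * Mb))"
      proof (rule sum_norm_le)
        fix j
        have "\<bar>(g (fst w) - g (fst z)) $ i $ j\<bar> \<le> Lg i j * dist (fst w) (fst z)"
          using lipschitz_onD[OF Lg Sb[OF zw(2)] Sb[OF zw(1)]] by (simp add: dist_real_def)
        also have "\<dots> \<le> Lg i j * dist z w"
          using Lg0 dist_fst_le[of w z] by (simp add: mult_left_mono dist_commute)
        finally show "norm ((g (fst w) - g (fst z)) $ i $ j * A w $ j) \<le> Lg i j * dist z w * (2 * Mb)"
          unfolding norm_mult using component_le_norm_cart[of "A w" j] A_bound[OF zw(2)] Lg0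
          by (intro mult_mono) auto
      qed
      then show "\<bar>((g (fst w) - g (fst z)) *v A w) $ i\<bar> \<le> (\<Sum>j\<in>UNIV. Lg i j * dist z w * (2 * Mb))"
        by (simp add: matrix_vector_mult_def)
    qed
    moreover have "(\<Sum>i\<in>UNIV. \<Sum>j\<in>UNIV. Lg i j * dist z w * (2 * Mb)) = G * dist z w * (2 * Mb)"
      by (simp add: G_def sum_distrib_right)
    ultimately have "norm (g (fst z) *v (A z - A w)) \<le> Lb * dist z w + G * dist z w * (2 * Mb)" by linarith
    then have "2 * norm (g (fst z) *v (A z - A w)) \<le> 2 * (Lb * dist z w + G * dist z w * (2 * Mb))"
      by (rule mult_left_mono) simp
    with inv_bound[OF Sb[OF zw(1)]] have "norm (A z - A w) \<le> 2 * (Lb * dist z w + G * dist z w * (2 * Mb))"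
      by (rule order_trans)
    then show ?thesis by (simp add: algebra_simps)
  qed
  define F where "F z = (snd z, A z)" for z
  define L where "L = 1 + (2 * Lb + 4 * G * Mb)"
  define M where "M = \<bar>V\<bar> + 1 + 2 * Mb"
  have L: "1 \<le> L" using Lb0 G0 Mb(1) by (simp add: L_def)
  have M: "0 < M" using Mb(1) by (simp add: M_def)
  have F_lip: "L-lipschitz_on S F"
  proof (rule lipschitz_onI)
    fix z w assume zw: "z \<in> S" "w \<in> S"
    have "dist (F z) (F w) \<le> dist (snd z) (snd w) + dist (A z) (A w)"
      unfolding F_def dist_Pair_Pair by (rule sqrt_sum_squares_le_sum) auto
    also have "\<dots> \<le> dist z w + (2 * Lb + 4 * G * Mb) * dist z w"
      using A_lip[OF zw] dist_snd_le[of z w] by (simp add: dist_norm)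
    finally show "dist (F z) (F w) \<le> L * dist z w" by (simp add: L_def algebra_simps)
  qed (use L in simp)
  have F_bound: "norm (F z) \<le> M" if "z \<in> S" for z
  proof -
    have "norm (F z) \<le> norm (snd z) + norm (A z)" unfolding F_def by (rule norm_Pair_le)
    also have "norm (snd z) \<le> \<bar>V\<bar> + 1" using that by (auto simp: S_def)
    finally show ?thesis using A_bound[OF that] by (simp add: M_def)
  qed
  \<comment> \<open>The first bound makes the iteration a contraction, the second keeps the ball of
    radius M h around z inside S.\<close>
  define h where "h = min (1 / (2 * L)) (min (\<rho> / 4) 1 / M)"
  have h: "0 < h" using L M \<rho>(1) by (simp add: h_def)
  have "L * h \<le> L * (1 / (2 * L))" using L by (intro mult_left_mono) (auto simp: h_def)
  then have Lh: "L * h < 1" using L by simp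
  have "M * h \<le> M * (min (\<rho> / 4) 1 / M)" using M by (intro mult_left_mono) (auto simp: h_def)
  then have Mh: "M * h \<le> \<rho> / 4" "M * h \<le> 1" using M by simp_all
  have "\<exists>w. el_flow W g \<sigma> U z h w" if z: "norm (fst z) \<le> \<rho> / 4" "norm (snd z) \<le> V" for z
  proof -
    have "cball z (M * h) \<subseteq> S"
    proof
      fix w assume w: "w \<in> cball z (M * h)"
      have "norm (fst w) \<le> norm (fst z) + dist (fst w) (fst z)" "norm (snd w) \<le> norm (snd z) + dist (snd w) (snd z)"
        unfolding dist_norm by (simp_all add: norm_triangle_sub)
      moreover have "dist (fst w) (fst z) \<le> M * h" "dist (snd w) (snd z) \<le> M * h"
        using w dist_fst_le[of w z] dist_snd_le[of w z] by (simp_all add: dist_commute)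
      ultimately have "norm (fst w) \<le> \<rho> / 2" "norm (snd w) \<le> \<bar>V\<bar> + 1"
        using z Mh by linarith+
      then show "w \<in> S" by (cases w) (simp add: S_def)
    qed
    from picard_local_existence[OF F_lip S(2,3) F_bound h Lh this less_imp_le[OF M]]
    obtain y where y: "y 0 = z" "\<And>t. t \<in> {0..h} \<Longrightarrow> y t \<in> S"
      "\<And>t. t \<in> {0..h} \<Longrightarrow> (y has_vector_derivative F (y t)) (at t within {0..h})" by blast
    have "el_solution W g \<sigma> U h (\<lambda>t. fst (y t)) (\<lambda>t. snd (y t))"
      unfolding el_solution_def
    proof (intro ballI conjI)
      fix t assume t: "t \<in> {0..h}"
      show "fst (y t) \<in> W" using Sb[OF y(2)[OF t]] \<rho>(2) by auto
      show "((\<lambda>t. fst (y t)) has_vector_derivative snd (y t)) (at t within {0..h})"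
        using bounded_linear.has_vector_derivative[OF bounded_linear_fst y(3)[OF t]] by (simp add: F_def)
      show "((\<lambda>t. snd (y t)) has_vector_derivative acc (fst (y t)) (snd (y t))) (at t within {0..h})"
        using bounded_linear.has_vector_derivative[OF bounded_linear_snd y(3)[OF t]] by (simp add: F_def A_def)
    qed
    then show ?thesis
      using el_solution_flow[of W g \<sigma> U h _ _ h] h y(1) by fastforce
  qed
  then show ?thesis using h by blast
qed

end

subsection \<open>A Lyapunov function near the origin\<close>

text \<open>Within a one-point interval every vector is a derivative, so constant functions form a
  solution of length 0.\<close>

lemma el_flow_refl:
  assumes "fst z \<in> W" shows "el_flow W g \<sigma> U z 0 z"
  unfolding el_flow_iff el_solution_def
  by (intro conjI exI[of _ "\<lambda>_. fst z"] exI[of _ "\<lambda>_. snd z"])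
    (use assms in \<open>auto simp: has_vector_derivative_def has_derivative_within_singleton_iff
      intro: bounded_linear_scaleR_left\<close>)

text \<open>The factor is |x|^(k - a). Its exponent may be negative, which calls for a real power;
  multiplication by |x|^(a + 2) leads back to natural powers. The base \<open>x \<bullet> x\<close>
  is convenient for differentiation.\<close>

lemma inner_self_powr:
  fixes x :: "'a::real_inner"
  assumes "x \<noteq> 0"
  shows "(x \<bullet> x) powr ((real k - real a) / 2) * norm x ^ (a + 2) = norm x ^ (k + 2)"
proof -
  let ?\<theta> = "(x \<bullet> x) powr ((real k - real a) / 2)"
  have n: "0 < norm x" using assms by simp
  have "?\<theta> = (norm x powr 2) powr ((real k - real a) / 2)"
    by (simp add: dot_square_norm powr_numeral[OF less_imp_le[OF n]])
  also have "\<dots> = norm x powr (real k - real a)"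
    unfolding powr_powr by (simp add: diff_divide_distrib)
  finally have "?\<theta> * norm x ^ (a + 2) = norm x powr (real k - real a) * norm x powr real (a + 2)"
    by (simp only: powr_realpow[OF n])
  also have "\<dots> = norm x powr real (k + 2)"
    by (simp add: add.commute flip: powr_add)
  finally show ?thesis by (simp only: powr_realpow[OF n])
qed

text \<open>Here \<open>l\<^sub>1 = a + 2\<close> and \<open>\<kappa> = k\<close>, and the coefficients of \<open>\<sigma>\<close> vanish to order \<open>D + 1\<close>. The hypothesis on
  the critical points of \<open>f\<close> enters through \<open>restoring_bound\<close> only.\<close>

locale lagrangian_lyapunov = lagrangian_ball W g \<sigma> U \<rho> K
  for W :: "(real ^ 'n) set" and g \<sigma> U \<rho> K +
  fixes c :: "('n \<Rightarrow> nat) \<Rightarrow> real" and a k D :: nat and \<eta> c0 :: real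
  assumes k: "1 \<le> k" and D: "a + 2 + 2 * k + 1 \<le> 2 * D + 2" and \<eta>: "0 \<le> \<eta>" and c0: "0 < c0"
    and Kak: "real a + real k \<le> K"
    and metric_force_bound: "\<And>x v. x \<in> ball 0 \<rho> \<Longrightarrow> norm (metric_force g x v) \<le> K * (norm v)\<^sup>2"
    and contract_bound: "\<And>x v. x \<in> ball 0 \<rho> \<Longrightarrow> norm (contract_d \<sigma> x v) \<le> K * norm x ^ D * norm v"
    and dU_bound: "\<And>x. x \<in> ball 0 \<rho> \<Longrightarrow>
      norm (diff_vec U x - (\<chi> i. hom_poly (dcoeff i c) (a + 1) x)) \<le> K * norm x ^ (a + 2)"
    and N_bound: "\<And>x. norm (\<chi> i. hom_poly (dcoeff i c) (a + 1) x) \<le> K * norm x ^ (a + 1)"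
    and M_bound: "\<And>x v. norm (\<chi> i. \<Sum>j\<in>UNIV. hom_poly (dcoeff j (dcoeff i c)) a x * v $ j) \<le> K * norm x ^ a * norm v"
    and restoring_bound: "\<And>x. x \<in> ball 0 \<rho> \<Longrightarrow> x \<noteq> 0 \<Longrightarrow> U x \<le> 0 \<Longrightarrow>
      c0 * norm x ^ (a + 2 + k) - K * norm x ^ (a + 2 + k + 1) \<le> real (a + 2) * U x - x \<bullet> diff_vec U x
        + \<eta> * (x \<bullet> x) powr ((real k - real a) / 2) * (norm (\<chi> i. hom_poly (dcoeff i c) (a + 1) x))\<^sup>2"
begin

definition N :: "real ^ 'n \<Rightarrow> real ^ 'n" where "N x = (\<chi> i. hom_poly (dcoeff i c) (a + 1) x)"

text \<open>The Hessian of the leading term of U at x, applied to v.\<close>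

definition M :: "real ^ 'n \<Rightarrow> real ^ 'n \<Rightarrow> real ^ 'n" where
  "M x v = (\<chi> i. \<Sum>j\<in>UNIV. hom_poly (dcoeff j (dcoeff i c)) a x * v $ j)"

definition \<theta> :: "real ^ 'n \<Rightarrow> real" where "\<theta> x = (x \<bullet> x) powr ((real k - real a) / 2)"

definition \<Phi> :: "real ^ 'n \<Rightarrow> real ^ 'n \<Rightarrow> real" where
  "\<Phi> x v = (g x *v v) \<bullet> (x - (\<eta> * \<theta> x) *\<^sub>R N x)"

definition E :: real where "E = 2 * K + 4 * \<eta> * K ^ 3"

text \<open>\<rho>/4 bounds the positions from which \<open>flow_step\<close> starts, 1 makes higher
  powers of |x| smaller, and the last two entries are the smallness conditions of
  \<open>lyapunov_inequality\<close>.\<close>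

definition radius :: real where
  "radius = min (\<rho> / 4) (min 1 (min (1 / (4 * E)) (c0 / (2 * (E + E\<^sup>2)))))"

lemma E_pos: "0 < E"
  using K \<eta> by (simp add: E_def add_pos_nonneg)

lemma E2_pos: "0 < E + E\<^sup>2"
  using E_pos by (simp add: add_pos_nonneg)

lemma radius_pos: "0 < radius"
  unfolding radius_def min_less_iff_conj
  by (intro conjI divide_pos_pos mult_pos_pos \<rho>(1) E_pos E2_pos c0) simp_all

lemma radius_le: "radius \<le> \<rho> / 4" "radius \<le> 1"
  unfolding radius_def by (rule min.cobounded1) (intro min.coboundedI2 min.cobounded1)

lemma radius_small:
  assumes "r < radius"
  shows "E * r \<le> 1 / 4" "(E + E\<^sup>2) * r \<le> c0 / 2"
proof -
  have le: "y * r \<le> w" if "0 < y" "r \<le> w / y" for y w :: real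
    using that by (simp add: pos_le_divide_eq mult.commute)
  have "radius \<le> 1 / (4 * E)" "radius \<le> c0 / (2 * (E + E\<^sup>2))"
    unfolding radius_def
    by (intro min.coboundedI2 min.cobounded1) (intro min.coboundedI2 min.cobounded2)
  then have "r \<le> (1 / 4) / E" "r \<le> (c0 / 2) / (E + E\<^sup>2)"
    using assms unfolding divide_divide_eq_left by linarith+
  then show "E * r \<le> 1 / 4" "(E + E\<^sup>2) * r \<le> c0 / 2"
    using le[OF E_pos] le[OF E2_pos] by blast+
qed

lemma \<theta>_pos: "x \<noteq> 0 \<Longrightarrow> 0 < \<theta> x"
  by (simp add: \<theta>_def)

lemma \<theta>_power:
  "x \<noteq> 0 \<Longrightarrow> \<theta> x * norm x ^ (a + 2) = norm x ^ (k + 2)"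
  unfolding \<theta>_def by (rule inner_self_powr)

text \<open>The logarithmic derivative of |x|^(k - a) along the curve is at most |k - a| |v| / |x|,
  and |k - a| <= a + k <= K.\<close>

lemma \<theta>_has_derivative:
  assumes "x s \<noteq> 0" and x: "(x has_vector_derivative v s) (at s within S)"
  shows "\<exists>\<theta>'. ((\<lambda>r. \<theta> (x r)) has_real_derivative \<theta>') (at s within S) \<and>
     \<bar>\<theta>'\<bar> * norm (x s) \<le> K * \<theta> (x s) * norm (v s)"
proof -
  define b where "b = (real k - real a) / 2"
  have pos: "0 < x s \<bullet> x s" using assms(1) by simp
  have "((\<lambda>r. x r \<bullet> x r) has_vector_derivative (x s \<bullet> v s + v s \<bullet> x s)) (at s within S)"
    by (rule bounded_bilinear.has_vector_derivative[OF bounded_bilinear_inner x x])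
  then have "((\<lambda>r. x r \<bullet> x r) has_real_derivative 2 * (x s \<bullet> v s)) (at s within S)"
    by (simp add: has_real_derivative_iff_has_vector_derivative inner_commute)
  from DERIV_chain2[OF has_real_derivative_powr[OF pos, of b] this]
  have "((\<lambda>r. \<theta> (x r)) has_real_derivative b * (x s \<bullet> x s) powr (b - 1) * (2 * (x s \<bullet> v s))) (at s within S)"
    unfolding \<theta>_def b_def .
  moreover have "\<bar>b * (x s \<bullet> x s) powr (b - 1) * (2 * (x s \<bullet> v s))\<bar> * norm (x s) \<le> K * \<theta> (x s) * norm (v s)"
  proof -
    have p: "(x s \<bullet> x s) powr (b - 1) = \<theta> (x s) / (norm (x s))\<^sup>2"
      using pos by (simp add: \<theta>_def b_def powr_diff power2_norm_eq_inner)
    have "\<bar>2 * b\<bar> \<le> K" using Kak by (simp add: b_def)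
    have "\<bar>b * (x s \<bullet> x s) powr (b - 1) * (2 * (x s \<bullet> v s))\<bar> * norm (x s)
      = \<bar>2 * b\<bar> * (\<theta> (x s) / (norm (x s))\<^sup>2) * (\<bar>x s \<bullet> v s\<bar> * norm (x s))"
      unfolding p using \<theta>_pos[OF assms(1)] by (simp add: abs_mult)
    also have "\<dots> \<le> K * (\<theta> (x s) / (norm (x s))\<^sup>2) * ((norm (x s) * norm (v s)) * norm (x s))"
      using \<theta>_pos[OF assms(1)] \<open>\<bar>2 * b\<bar> \<le> K\<close> K Cauchy_Schwarz_ineq2[of "x s" "v s"]
      by (intro mult_mono) auto
    also have "\<dots> = K * \<theta> (x s) * norm (v s)"
      using assms(1) by (simp add: power2_eq_square)
    finally show ?thesis .
  qed
  ultimately show ?thesis by blast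
qed

lemma N_has_vector_derivative:
  assumes "(x has_vector_derivative v s) (at s within S)"
  shows "((\<lambda>r. N (x r)) has_vector_derivative M (x s) (v s)) (at s within S)"
proof (rule vec_has_vector_derivative)
  fix i
  let ?P = "hom_poly (dcoeff i c) (Suc a)"
  have D: "(?P has_derivative (\<lambda>h. \<Sum>j\<in>UNIV. hom_poly (dcoeff j (dcoeff i c)) a (x s) * h $ j)) (at (x s))"
    by (rule hom_poly_has_derivative)
  have "partial_deriv j ?P (x s) = hom_poly (dcoeff j (dcoeff i c)) a (x s)" for j
    unfolding partial_derivI[OF D] by (simp add: axis_def if_distrib cong: if_cong)
  moreover have "?P differentiable (at (x s))" using D unfolding differentiable_def by blast
  ultimately show "((\<lambda>r. N (x r) $ i) has_real_derivative M (x s) (v s) $ i) (at s within S)"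
    using chain_partials[OF _ assms, of ?P] by (simp add: N_def M_def)
qed

lemma \<Phi>_has_derivative:
  assumes xb: "x s \<in> ball 0 radius" "x s \<noteq> 0" and H: "energy g U (x s, v s) \<le> 0"
    and x: "(x has_vector_derivative v s) (at s within S)"
    and v: "(v has_vector_derivative acc (x s) (v s)) (at s within S)"
  shows "\<exists>d. ((\<lambda>r. \<Phi> (x r) (v r)) has_real_derivative d) (at s within S) \<and>
     c0 / 2 * norm (x s) ^ (a + 2 + k) \<le> d"
proof -
  have b: "x s \<in> ball 0 \<rho>" using xb(1) radius_le(1) \<rho>(1) by auto
  obtain \<theta>' where \<theta>': "((\<lambda>r. \<theta> (x r)) has_real_derivative \<theta>') (at s within S)"
     "\<bar>\<theta>'\<bar> * norm (x s) \<le> K * \<theta> (x s) * norm (v s)"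
    using \<theta>_has_derivative[of x s v S, OF xb(2) x] by blast
  define Y' where "Y' = v s - \<eta> *\<^sub>R (\<theta>' *\<^sub>R N (x s) + \<theta> (x s) *\<^sub>R M (x s) (v s))"
  have "((\<lambda>r. \<theta> (x r) *\<^sub>R N (x r)) has_vector_derivative (\<theta> (x s) *\<^sub>R M (x s) (v s) + \<theta>' *\<^sub>R N (x s))) (at s within S)"
    by (rule has_vector_derivative_scaleR[OF \<theta>'(1) N_has_vector_derivative[of x v s S, OF x]])
  from has_vector_derivative_diff[OF x bounded_linear.has_vector_derivative[OF bounded_linear_scaleR_right[of \<eta>] this]]
  have Y: "((\<lambda>r. x r - (\<eta> * \<theta> (x r)) *\<^sub>R N (x r)) has_vector_derivative Y') (at s within S)"
    by (simp add: Y'_def add.commute)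
  have "((\<lambda>r. \<Phi> (x r) (v r)) has_vector_derivative
      ((g (x s) *v v s) \<bullet> Y' + force (x s) (v s) \<bullet> (x s - (\<eta> * \<theta> (x s)) *\<^sub>R N (x s)))) (at s within S)"
    unfolding \<Phi>_def
    by (rule bounded_bilinear.has_vector_derivative[OF bounded_bilinear_inner momentum_has_vector_derivative[of x s v S, OF b x v] Y])
  moreover have "c0 / 2 * norm (x s) ^ (a + 2 + k)
      \<le> force (x s) (v s) \<bullet> (x s - (\<eta> * \<theta> (x s)) *\<^sub>R N (x s)) + (g (x s) *v v s) \<bullet> Y'"
    unfolding Y'_def
  proof (rule lyapunov_inequality)
    show "force (x s) (v s) = (1/2) *\<^sub>R metric_force g (x s) (v s) - diff_vec U (x s) - contract_d \<sigma> (x s) (v s)"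
      by (rule force_def)
    show "norm (x s) \<le> 1" using xb(1) radius_le(2) by simp
    show "\<theta> (x s) * norm (x s) ^ (a + 2) = norm (x s) ^ (k + 2)" by (rule \<theta>_power[OF xb(2)])
    show "energy g U (x s, v s) = ((g (x s) *v v s) \<bullet> v s) / 2 + U (x s)"
      by (simp add: energy_def inner_commute)
    have Q: "(norm (v s))\<^sup>2 \<le> 2 * (v s \<bullet> (g (x s) *v v s))" by (rule elliptic[OF b])
    then show "(norm (v s))\<^sup>2 \<le> 2 * ((g (x s) *v v s) \<bullet> v s)" by (simp add: inner_commute)
    have "U (x s) \<le> 0"
      using H Q zero_le_power2[of "norm (v s)"] unfolding energy_def fst_conv snd_conv by linarith
    then show "c0 * norm (x s) ^ (a + 2 + k) - K * norm (x s) ^ (a + 2 + k + 1)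
        \<le> real (a + 2) * U (x s) - x s \<bullet> diff_vec U (x s) + \<eta> * \<theta> (x s) * (norm (N (x s)))\<^sup>2"
      unfolding \<theta>_def N_def by (rule restoring_bound[OF b xb(2)])
    show "E = 2 * K + 4 * \<eta> * K ^ 3" by (rule E_def)
    show "E * norm (x s) \<le> 1 / 4" "(E + E\<^sup>2) * norm (x s) \<le> c0 / 2"
      using radius_small xb(1) by simp_all
    show "norm (N (x s)) \<le> K * norm (x s) ^ (a + 1)" unfolding N_def by (rule N_bound)
    show "norm (diff_vec U (x s) - N (x s)) \<le> K * norm (x s) ^ (a + 2)" unfolding N_def by (rule dU_bound[OF b])
    show "norm (M (x s) (v s)) \<le> K * norm (x s) ^ a * norm (v s)" unfolding M_def by (rule M_bound)
    show "norm (metric_force g (x s) (v s)) \<le> K * (norm (v s))\<^sup>2" by (rule metric_force_bound[OF b])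
    show "norm (contract_d \<sigma> (x s) (v s)) \<le> K * norm (x s) ^ D * norm (v s)" by (rule contract_bound[OF b])
    show "norm (g (x s) *v v s) \<le> K * norm (v s)" by (rule g_bound[OF b])
  qed (use xb(2) K k \<eta> D \<theta>_pos[OF xb(2)] \<theta>'(2) H in simp_all)
  ultimately show ?thesis
    by (intro exI[of _ "(g (x s) *v v s) \<bullet> Y' + force (x s) (v s) \<bullet> (x s - (\<eta> * \<theta> (x s)) *\<^sub>R N (x s))"])
      (simp add: has_real_derivative_iff_has_vector_derivative add.commute)
qed

text \<open>Even where the weight blows up, \<open>\<theta> x * norm (N x)\<close> is at most K
  |x|^(k + 1), because N has degree a + 1. So the bound holds uniformly up to the origin.\<close>

lemma \<Phi>_bound:
  assumes x: "x \<in> ball 0 radius" "x \<noteq> 0" and v: "norm v \<le> 2 * K * norm x"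
  shows "\<bar>\<Phi> x v\<bar> \<le> 2 * K\<^sup>2 * (1 + \<eta> * K)"
proof -
  have b: "x \<in> ball 0 \<rho>" using x(1) radius_le(1) \<rho>(1) by auto
  have r1: "norm x \<le> 1" using x(1) radius_le(2) by simp
  have n: "0 < norm x" using x(2) by simp
  have "\<theta> x * norm (N x) \<le> K"
  proof -
    have "\<theta> x * norm (N x) \<le> \<theta> x * (K * norm x ^ (a + 1))"
      unfolding N_def using \<theta>_pos[OF x(2)] by (intro mult_left_mono N_bound) auto
    also have "\<dots> = K * (\<theta> x * norm x ^ (a + 2)) / norm x"
      using n by (simp add: power_add field_simps)
    also have "\<dots> = K * norm x ^ (k + 1)"
      unfolding \<theta>_power[OF x(2)] using n by (simp add: power_add)
    also have "\<dots> \<le> K * 1"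
      using K r1 by (intro mult_left_mono power_le_one) auto
    finally show ?thesis by simp
  qed
  then have "norm ((\<eta> * \<theta> x) *\<^sub>R N x) \<le> \<eta> * K"
    using mult_left_mono[OF _ \<eta>] \<eta> \<theta>_pos[OF x(2)] by (simp add: mult.assoc)
  then have "norm (x - (\<eta> * \<theta> x) *\<^sub>R N x) \<le> 1 + \<eta> * K"
    using r1 norm_triangle_ineq4[of x "(\<eta> * \<theta> x) *\<^sub>R N x"] by linarith
  moreover have "norm (g x *v v) \<le> 2 * K\<^sup>2"
  proof -
    have "norm (g x *v v) \<le> K * norm v" by (rule g_bound[OF b])
    also have "\<dots> \<le> K * (2 * K * norm x)" using v K by (intro mult_left_mono) auto
    also have "\<dots> \<le> K * (2 * K * 1)" using r1 K by (intro mult_left_mono) auto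
    finally show ?thesis by (simp add: power2_eq_square)
  qed
  ultimately show ?thesis
    unfolding \<Phi>_def by (intro order_trans[OF Cauchy_Schwarz_ineq2] mult_mono) auto
qed

lemma equilibrium_flow:
  assumes "0 \<le> t" shows "el_flow W g \<sigma> U (0, 0) t (0, 0)"
proof -
  have b: "0 \<in> ball 0 \<rho>" using \<rho>(1) by simp
  \<comment> \<open>At the origin the right-hand sides of \<open>N_bound\<close> and
    \<open>dU_bound\<close> are positive powers of 0.\<close>
  have "N 0 = 0" using N_bound[of 0] by (simp add: N_def)
  then have "diff_vec U 0 = 0" using dU_bound[OF b] by (simp add: N_def)
  moreover have "contract_d \<sigma> 0 0 = 0" "metric_force g 0 0 = 0" "metric_transport g 0 0 = 0"
    by (simp_all add: contract_d_def metric_force_def metric_transport_def vec_eq_iff)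
  ultimately have "g 0 *v acc 0 0 = 0"
    using acc_lowered[OF b, of 0] by (simp add: force_def)
  then have "acc 0 0 = 0" using elliptic[OF b, of "acc 0 0"] by simp
  then have "el_solution W g \<sigma> U t (\<lambda>_. 0) (\<lambda>_. 0)"
    using b \<rho>(2) by (auto simp: el_solution_def)
  then show ?thesis
    using assms unfolding el_flow_iff by (intro conjI exI[of _ "\<lambda>_. 0"]) simp_all
qed

end

section \<open>Existence for all times and returns to the origin\<close>

context lagrangian_lyapunov begin

text \<open>Every intermediate state of a solution belongs to the positive orbit as well, so the
  whole curve stays in the ball, where energy conservation and the velocity bound apply.\<close>

lemma reachable:
  assumes orbit: "positive_orbit W g \<sigma> U z \<subseteq> ball 0 radius \<times> UNIV" and H: "energy g U z \<le> 0"
    and w: "el_flow W g \<sigma> U z t w"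
  shows "fst w \<in> ball 0 radius" "energy g U w = energy g U z" "norm (snd w) \<le> 2 * K * norm (fst w)"
proof -
  have sub: "ball 0 radius \<subseteq> ball (0 :: real ^ 'n) \<rho>"
    using radius_le(1) \<rho>(1) by (intro subset_ball) simp
  have fst_in: "fst u \<in> ball 0 radius" if "el_flow W g \<sigma> U z s u" for s u
  proof -
    have "0 \<le> s" using that by (simp add: el_flow_iff)
    then have "u \<in> positive_orbit W g \<sigma> U z"
      using that unfolding positive_orbit_def by blast
    then show ?thesis using orbit by auto
  qed
  show 1: "fst w \<in> ball 0 radius" by (rule fst_in[OF w])
  obtain x v where t: "0 \<le> t" and xv: "(x 0, v 0) = z" "(x t, v t) = w" and sol: "el_solution W g \<sigma> U t x v"
    using w by (auto simp: el_flow_iff)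
  have "x s \<in> ball 0 \<rho>" if "s \<in> {0..t}" for s
    using fst_in[of s "(x s, v s)"] el_solution_flow[OF sol that] xv(1) sub by auto
  from energy_constant[OF sol this, of t] show 2: "energy g U w = energy g U z"
    using t xv by simp
  show "norm (snd w) \<le> 2 * K * norm (fst w)"
    using 1 2 H sub by (intro velocity_bound) auto
qed

text \<open>The bounds |x| < \<open>radius\<close> and |v| <= 2 K hold at every state of the orbit,
  so the uniform step can be repeated indefinitely.\<close>

lemma flow_arbitrarily_long:
  assumes orbit: "positive_orbit W g \<sigma> U z \<subseteq> ball 0 radius \<times> UNIV" and H: "energy g U z \<le> 0"
    and z: "fst z \<in> W"
  shows "\<exists>t\<ge>T. \<exists>w. el_flow W g \<sigma> U z t w"
proof -
  obtain h where h: "0 < h"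
    "\<And>w. norm (fst w) \<le> \<rho> / 4 \<Longrightarrow> norm (snd w) \<le> 2 * K \<Longrightarrow> \<exists>u. el_flow W g \<sigma> U w h u"
    using flow_step[of "2 * K"] by metis
  have step: "\<exists>w. el_flow W g \<sigma> U z (real n * h) w" for n
  proof (induction n)
    case 0
    then show ?case by (intro exI[of _ z]) (simp add: el_flow_refl z)
  next
    case (Suc n)
    then obtain w where w: "el_flow W g \<sigma> U z (real n * h) w" by blast
    note r = reachable[OF orbit H w]
    have "norm (fst w) \<le> 1" "norm (fst w) \<le> \<rho> / 4"
      using r(1) radius_le by simp_all
    then have "2 * K * norm (fst w) \<le> 2 * K * 1"
      using K by (intro mult_left_mono) simp_all
    then have "norm (snd w) \<le> 2 * K" using r(3) by simp
    with \<open>norm (fst w) \<le> \<rho> / 4\<close> obtain u where "el_flow W g \<sigma> U w h u" using h(2) by blast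
    from el_flow_trans[OF w this] have "el_flow W g \<sigma> U z (real (Suc n) * h) u"
      by (simp add: distrib_right add.commute)
    then show ?case by blast
  qed
  obtain n where "T < real n * h" using reals_Archimedean3[OF h(1)] by blast
  then show ?thesis using step[of n] by (intro exI[of _ "real n * h"]) simp
qed

lemma visits_origin:
  assumes orbit: "positive_orbit W g \<sigma> U z \<subseteq> ball 0 radius \<times> UNIV" and H: "energy g U z \<le> 0"
    and z: "fst z \<in> W" and T: "0 \<le> T" and \<epsilon>: "0 < \<epsilon>"
  shows "\<exists>t\<ge>T. \<exists>w. el_flow W g \<sigma> U z t w \<and> norm (fst w) < \<epsilon>"
proof (cases "\<exists>t w. el_flow W g \<sigma> U z t w \<and> fst w = 0")
  case True
  then obtain t w where w: "el_flow W g \<sigma> U z t w" "fst w = 0" by blast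
  then have "snd w = 0" using reachable(3)[OF orbit H w(1)] by simp
  then have "w = (0, 0)" using w(2) by (cases w) simp
  then have "el_flow W g \<sigma> U z (t + T) (0, 0)"
    using el_flow_trans[OF w(1)] equilibrium_flow[OF T] by simp
  moreover have "T \<le> t + T" using w(1) by (simp add: el_flow_iff)
  ultimately show ?thesis using \<epsilon> by (intro exI[of _ "t + T"]) (auto intro!: exI[of _ "(0, 0)"])
next
  case False
  show ?thesis
  proof (rule ccontr)
    assume "\<not> ?thesis"
    then have far: "\<epsilon> \<le> norm (fst w)" if "el_flow W g \<sigma> U z t w" "T \<le> t" for t w
      using that by (meson not_le)
    define \<gamma> where "\<gamma> = c0 / 2 * \<epsilon> ^ (a + 2 + k)"
    have \<gamma>: "0 < \<gamma>" using c0 \<epsilon> by (simp add: \<gamma>_def)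
    define P where "P = 2 * K\<^sup>2 * (1 + \<eta> * K)"
    have P: "0 \<le> P" using K \<eta> by (simp add: P_def)
    \<comment> \<open>Long enough for growth at rate \<gamma> to exceed 2 P, the largest possible
      change of \<Phi>.\<close>
    obtain t u where t: "T + (2 * P / \<gamma> + 1) \<le> t" and u: "el_flow W g \<sigma> U z t u"
      using flow_arbitrarily_long[OF orbit H z] by blast
    have Tt: "T < t" using t P \<gamma> by (smt (verit) divide_nonneg_pos mult_nonneg_nonneg)
    obtain x v where xv: "(x 0, v 0) = z" and sol: "el_solution W g \<sigma> U t x v"
      using u by (auto simp: el_flow_iff)
    have flow: "el_flow W g \<sigma> U z s (x s, v s)" if "s \<in> {0..t}" for s
      using el_solution_flow[OF sol that] xv by simp
    have nz: "x s \<noteq> 0" if "s \<in> {0..t}" for s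
      using False flow[OF that] by (metis fst_conv)
    have "\<exists>d. ((\<lambda>r. \<Phi> (x r) (v r)) has_real_derivative d) (at s within {T..t}) \<and> \<gamma> \<le> d"
      if s: "s \<in> {T..t}" for s
    proof -
      have s0: "s \<in> {0..t}" and sub: "{T..t} \<subseteq> {0..t}" using s T by auto
      note r = reachable[OF orbit H flow[OF s0]]
      have "(x has_vector_derivative v s) (at s within {0..t})"
        "(v has_vector_derivative acc (x s) (v s)) (at s within {0..t})"
        using sol s0 unfolding el_solution_def by blast+
      then have "(x has_vector_derivative v s) (at s within {T..t})"
        "(v has_vector_derivative acc (x s) (v s)) (at s within {T..t})"
        using has_vector_derivative_within_subset[OF _ sub] by blast+
      moreover have "x s \<in> ball 0 radius" "energy g U (x s, v s) \<le> 0" using r(1,2) H by simp_all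
      ultimately obtain d where d: "((\<lambda>r. \<Phi> (x r) (v r)) has_real_derivative d) (at s within {T..t})"
        "c0 / 2 * norm (x s) ^ (a + 2 + k) \<le> d"
        using \<Phi>_has_derivative[of x s v "{T..t}"] nz[OF s0] by blast
      have "\<epsilon> \<le> norm (x s)" using far[OF flow[OF s0]] s by simp
      then have "\<gamma> \<le> c0 / 2 * norm (x s) ^ (a + 2 + k)"
        unfolding \<gamma>_def using \<epsilon> c0 by (intro mult_left_mono power_mono) auto
      then show ?thesis using d by (intro exI[of _ d]) simp
    qed
    then obtain d where d: "\<And>s. s \<in> {T..t} \<Longrightarrow> ((\<lambda>r. \<Phi> (x r) (v r)) has_real_derivative d s) (at s within {T..t})"
      "\<And>s. s \<in> {T..t} \<Longrightarrow> \<gamma> \<le> d s" by metis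
    have "((\<lambda>r. \<Phi> (x r) (v r)) has_derivative (\<lambda>h. d s * h)) (at s within {T..t})" if "T \<le> s" "s \<le> t" for s
      using d(1)[of s] that by (simp add: has_field_derivative_def)
    from mvt_simple[OF Tt this] obtain s where s: "s \<in> {T<..<t}"
      "\<Phi> (x t) (v t) - \<Phi> (x T) (v T) = d s * (t - T)" by blast
    have "\<gamma> * (t - T) \<le> d s * (t - T)"
      using d(2)[of s] s(1) Tt by (intro mult_right_mono) auto
    moreover have "\<bar>\<Phi> (x r) (v r)\<bar> \<le> P" if "r \<in> {0..t}" for r
      unfolding P_def using reachable[OF orbit H flow[OF that]] nz[OF that] by (intro \<Phi>_bound) simp_all
    ultimately have "\<gamma> * (t - T) \<le> 2 * P"
      using s(2) T Tt by (smt (verit) atLeastAtMost_iff)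
    moreover have "\<gamma> * (2 * P / \<gamma> + 1) \<le> \<gamma> * (t - T)"
      using t \<gamma> by (intro mult_left_mono) auto
    ultimately show False using \<gamma> by (simp add: distrib_left)
  qed
qed

theorem omega_limit_contains_origin:
  assumes orbit: "positive_orbit W g \<sigma> U z \<subseteq> ball 0 radius \<times> UNIV" and H: "energy g U z \<le> 0"
    and z: "fst z \<in> W"
  shows "(0, 0) \<in> omega_limit W g \<sigma> U z" "energy g U z = 0"
proof -
  have K1: "0 < 1 + 2 * K" using K by simp
  have "(0, 0) \<in> closure {w. \<exists>t\<ge>T. el_flow W g \<sigma> U z t w}" if T: "0 \<le> T" for T
    unfolding closure_approachable
  proof (intro allI impI)
    fix e :: real assume e: "0 < e"
    obtain t w where w: "T \<le> t" "el_flow W g \<sigma> U z t w" "norm (fst w) < e / (1 + 2 * K)"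
      using visits_origin[OF orbit H z T divide_pos_pos[OF e K1]] by blast
    have "dist w (0, 0) \<le> norm (fst w) + norm (snd w)"
      using norm_Pair_le[of "fst w" "snd w"] by (simp add: dist_norm zero_prod_def[symmetric])
    also have "\<dots> \<le> (1 + 2 * K) * norm (fst w)"
      using reachable(3)[OF orbit H w(2)] by (simp add: distrib_right)
    also have "\<dots> < e" using w(3) K1 by (simp add: pos_less_divide_eq mult.commute)
    finally show "\<exists>y\<in>{w. \<exists>t\<ge>T. el_flow W g \<sigma> U z t w}. dist y (0, 0) < e"
      using w(1,2) by blast
  qed
  then show "(0, 0) \<in> omega_limit W g \<sigma> U z" by (simp add: omega_limit_def)
  show "energy g U z = 0"
  proof (rule ccontr)
    assume nz: "energy g U z \<noteq> 0"
    \<comment> \<open>\<open>energy_bound\<close> with |v| <= 2 K |x| and |x|^2 <= |x| gives |H| <=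
      Q |x|. As H is constant and |x| becomes arbitrarily small, H = 0.\<close>
    define Q where "Q = K * (4 * K\<^sup>2 + 1)"
    have Q: "0 < Q" using K by (simp add: Q_def add_nonneg_pos)
    obtain t w where w: "el_flow W g \<sigma> U z t w" "norm (fst w) < \<bar>energy g U z\<bar> / Q"
      using visits_origin[OF orbit H z order_refl, of "\<bar>energy g U z\<bar> / Q"] nz Q by auto
    note r = reachable[OF orbit H w(1)]
    have b: "fst w \<in> ball 0 \<rho>" using r(1) radius_le(1) \<rho>(1) by simp
    have "norm (fst w) \<le> 1" using r(1) radius_le(2) by simp
    then have sq: "(norm (fst w))\<^sup>2 \<le> norm (fst w)"
      by (simp add: power2_eq_square mult_left_le_one_le)
    have "(norm (snd w))\<^sup>2 \<le> 4 * K\<^sup>2 * (norm (fst w))\<^sup>2"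
      using power_mono[OF r(3), of 2] by (simp add: power_mult_distrib)
    then have "(norm (snd w))\<^sup>2 + (norm (fst w))\<^sup>2 \<le> (4 * K\<^sup>2 + 1) * (norm (fst w))\<^sup>2"
      by (simp add: distrib_right)
    also have "\<dots> \<le> (4 * K\<^sup>2 + 1) * norm (fst w)" using sq by (intro mult_left_mono) auto
    finally have "K * ((norm (snd w))\<^sup>2 + (norm (fst w))\<^sup>2) \<le> Q * norm (fst w)"
      using K unfolding Q_def mult.assoc by (intro mult_left_mono) auto
    with energy_bound[OF b] have "\<bar>energy g U z\<bar> \<le> Q * norm (fst w)" unfolding r(2) by linarith
    moreover have "Q * norm (fst w) < \<bar>energy g U z\<bar>"
      using w(2) Q by (simp add: pos_less_divide_eq mult.commute)
    ultimately show False by simp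
  qed
qed

end

subsection \<open>Order estimates at the origin\<close>

text \<open>The filter is \<open>nhds 0\<close>, not \<open>at 0\<close>: the estimate includes the
  origin and so becomes a bound on a full ball.\<close>

abbreviation order_bound :: "(real ^ 'n \<Rightarrow> real) \<Rightarrow> nat \<Rightarrow> bool" where
  "order_bound f N \<equiv> f \<in> O[nhds 0](\<lambda>x. norm x ^ N)"

lemma order_boundI:
  assumes "\<forall>\<^sub>F x in nhds 0. \<bar>f x\<bar> \<le> K * norm x ^ N"
  shows "order_bound f N"
  by (rule bigoI[where c = K]) (use assms in simp)

lemma eventually_norm_le_1: "\<forall>\<^sub>F x :: real ^ 'n in nhds 0. norm x \<le> 1"
  unfolding eventually_nhds_metric by (intro exI[of _ 1]) auto

lemma order_bound_mono:
  assumes "order_bound f N" "M \<le> N"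
  shows "order_bound f M"
proof (rule landau_o.big_trans[OF assms(1)], rule order_boundI[where K = 1])
  show "\<forall>\<^sub>F x :: real ^ 'a in nhds 0. \<bar>norm x ^ N\<bar> \<le> 1 * norm x ^ M"
    using eventually_norm_le_1
    by eventually_elim (use assms(2) in \<open>auto intro: power_decreasing\<close>)
qed

lemma order_bound_mult:
  assumes "order_bound f N" "order_bound h M"
  shows "order_bound (\<lambda>x. f x * h x) (N + M)"
  using landau_o.big.mult[OF assms] by (simp add: power_add)

lemma order_bound_cmult: "order_bound f N \<Longrightarrow> order_bound (\<lambda>x. C * f x) N"
  by (cases "C = 0") auto

lemma order_bound_nth: "order_bound (\<lambda>x. x $ i) 1"
  by (rule order_boundI[where K = 1]) (simp add: component_le_norm_cart)

lemma order_bound_hom_poly: "order_bound (hom_poly c k) k"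
  by (rule order_boundI[where K = "coeff_mass c k"]) (simp add: hom_poly_bound)

lemma order_bound_norm:
  assumes "\<And>i. order_bound (\<lambda>x. F x $ i) N"
  shows "order_bound (\<lambda>x. norm (F x)) N"
proof -
  have "order_bound (\<lambda>x. \<Sum>i\<in>UNIV. \<bar>F x $ i\<bar>) N"
    using assms by (intro big_sum_in_bigo) simp
  moreover have "(\<lambda>x. norm (F x)) \<in> O[nhds 0](\<lambda>x. \<Sum>i\<in>UNIV. \<bar>F x $ i\<bar>)"
    by (rule bigoI[where c = 1]) (simp add: norm_le_l1_cart order_trans[OF norm_le_l1_cart abs_ge_self])
  ultimately show ?thesis by (rule landau_o.big_trans[rotated])
qed

text \<open>The hidden constant becomes "all sufficiently large K", so that finitely many estimates
  are combined by \<open>eventually_conj\<close> and share one K.\<close>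

lemma order_bound_at_top:
  assumes "order_bound f N"
  shows "\<forall>\<^sub>F K in at_top. \<forall>\<^sub>F x in nhds 0. \<bar>f x\<bar> \<le> K * norm x ^ N"
proof -
  obtain K0 where K0: "K0 > 0" "\<forall>\<^sub>F x in nhds 0. \<bar>f x\<bar> \<le> K0 * norm x ^ N"
    using landau_o.bigE[OF assms] by auto
  have "\<forall>\<^sub>F x in nhds 0. \<bar>f x\<bar> \<le> K * norm x ^ N" if "K0 \<le> K" for K
    using K0(2)
  proof eventually_elim
    case (elim x)
    also have "K0 * norm x ^ N \<le> K * norm x ^ N" using that by (intro mult_right_mono) auto
    finally show ?case .
  qed
  then show ?thesis unfolding eventually_at_top_linorder by blast
qed

lemma hom_series_order_bound:
  assumes "hom_series f c"
  shows "order_bound (\<lambda>x. f x - (\<Sum>k<N. hom_poly c k x)) N"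
proof -
  obtain K \<epsilon> where "0 < \<epsilon>" "\<forall>x\<in>ball 0 \<epsilon>. \<bar>f x - (\<Sum>k<N. hom_poly c k x)\<bar> \<le> K * norm x ^ N"
    using hom_series_remainder[OF assms] by blast
  then show ?thesis
    by (intro order_boundI[where K = K]) (auto simp: eventually_nhds_metric dist_norm norm_minus_commute)
qed

lemma hom_series_vanishing_order:
  assumes "hom_series f c" "\<And>k. k < N \<Longrightarrow> hom_poly c k = (\<lambda>_. 0)"
  shows "order_bound f N"
  using hom_series_order_bound[OF assms(1), of N] assms(2) by simp

lemma analytic_hom_series:
  assumes "f real_analytic_on W" "0 \<in> W"
  shows "hom_series f (maclaurin_coeff f)"
proof -
  have "\<exists>c. has_power_series_at f 0 c" using assms by (auto simp: real_analytic_on_def)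
  from someI_ex[OF this] show ?thesis
    unfolding maclaurin_coeff_def by (rule power_series_imp_hom_series)
qed

text \<open>The point x on the right is arbitrary because the term of degree 0 is constant.\<close>

lemma hom_poly_at_0: "hom_poly c k 0 = (if k = 0 then hom_poly c 0 x else 0)"
  using hom_poly_scaleR[of c k 0 x] by (simp add: power_0_left)

lemma partial_deriv_hom_poly: "partial_deriv i (hom_poly c (Suc k)) x = hom_poly (dcoeff i c) k x"
  unfolding partial_derivI[OF hom_poly_has_derivative] by (simp add: axis_def if_distrib cong: if_cong)

lemma hom_poly_dcoeff_zero:
  assumes "hom_poly c (Suc k) = (\<lambda>_. 0)"
  shows "hom_poly (dcoeff i c) k = (\<lambda>_. 0)"
proof
  fix x
  have "partial_deriv i (\<lambda>_ :: real ^ 'a. 0 :: real) x = 0" by (rule partial_derivI) simp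
  then show "hom_poly (dcoeff i c) k x = 0"
    using partial_deriv_hom_poly[of i c k x] assms by simp
qed

lemma hom_series_at_0:
  assumes "hom_series f c"
  shows "f 0 = hom_poly c 0 x"
proof -
  have "(\<lambda>k. hom_poly c k 0) sums f 0"
    using assms by (auto simp: hom_series_def)
  moreover have "(\<lambda>k. hom_poly c k 0) sums hom_poly c 0 x"
    using sums_If_finite_set[of "{0 :: nat}" "\<lambda>_. hom_poly c 0 x"] by (subst hom_poly_at_0[of _ _ x]) simp
  ultimately show ?thesis by (rule sums_unique2)
qed

lemma hom_series_single_term:
  assumes "hom_series f c" "\<And>k. k \<noteq> k0 \<Longrightarrow> hom_poly c k = (\<lambda>_. 0)"
  shows "\<forall>\<^sub>F x in nhds 0. f x = hom_poly c k0 x"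
proof -
  obtain \<rho> where \<rho>: "\<rho> > 0" "\<And>x. x \<in> ball 0 \<rho> \<Longrightarrow> (\<lambda>k. hom_poly c k x) sums f x"
    using assms(1) by (auto simp: hom_series_def)
  have "f x = hom_poly c k0 x" if "x \<in> ball 0 \<rho>" for x
  proof -
    have "(\<lambda>k. hom_poly c k x) sums (\<Sum>k\<in>{k0}. hom_poly c k x)"
      using assms(2) by (intro sums_finite) auto
    then show ?thesis using \<rho>(2)[OF that] sums_unique2 by fastforce
  qed
  then show ?thesis
    using \<rho>(1) by (auto simp: eventually_nhds_metric dist_norm norm_minus_commute)
qed

lemma lipschitz_bound_at_right:
  assumes "hom_series f c"
  shows "\<forall>\<^sub>F \<rho> in at_right 0. \<exists>L. L-lipschitz_on (ball 0 \<rho>) f"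
proof -
  obtain \<epsilon> L where \<epsilon>: "\<epsilon> > 0" "L-lipschitz_on (ball 0 \<epsilon>) f"
    using hom_series_lipschitz[OF assms] by blast
  have "\<exists>L. L-lipschitz_on (ball 0 \<rho>) f" if "\<rho> < \<epsilon>" for \<rho>
    using lipschitz_on_subset[OF \<epsilon>(2) subset_ball[OF less_imp_le[OF that]]] by blast
  then show ?thesis unfolding eventually_at_right_field using \<epsilon>(1) by blast
qed

text \<open>The same device for the radius: properties of all sufficiently small balls are combined
  as eventualities in \<open>at_right 0\<close>.\<close>

lemma ball_at_right:
  assumes "\<forall>\<^sub>F x :: 'a::real_normed_vector in nhds 0. P x"
  shows "\<forall>\<^sub>F \<rho> in at_right 0. \<forall>x\<in>ball 0 \<rho>. P x"
proof -
  obtain \<epsilon> where \<epsilon>: "\<epsilon> > 0" "\<And>x. dist x 0 < \<epsilon> \<Longrightarrow> P x"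
    using assms unfolding eventually_nhds_metric by blast
  have "\<forall>x\<in>ball 0 \<rho>. P x" if "\<rho> < \<epsilon>" for \<rho>
    using \<epsilon>(2) that by simp
  then show ?thesis unfolding eventually_at_right_field using \<epsilon>(1) by blast
qed

lemma hom_series_differentiable_nhds:
  assumes "hom_series f c"
  shows "\<forall>\<^sub>F x in nhds 0. f differentiable (at x)"
proof -
  obtain \<epsilon> where "\<epsilon> > 0" "\<forall>x\<in>ball 0 \<epsilon>. f differentiable (at x)"
    using hom_series_differentiable[OF assms] by blast
  then show ?thesis by (auto simp: eventually_nhds_metric dist_norm norm_minus_commute)
qed

section \<open>Expansion of the potential and choice of the constants\<close>

lemma sum_two_terms:
  fixes P :: "nat \<Rightarrow> 'a \<Rightarrow> real"
  assumes "l1 < l2" "\<And>k. k < l1 \<Longrightarrow> P k = (\<lambda>_. 0)" "\<And>k. l1 < k \<Longrightarrow> k < l2 \<Longrightarrow> P k = (\<lambda>_. 0)"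
  shows "(\<Sum>k<l2 + 1. P k x) = P l1 x + P l2 x" 
proof -
  have "(\<Sum>k<l2 + 1. P k x) = (\<Sum>k\<in>{l1, l2}. P k x)"
  proof (rule sum.mono_neutral_right)
    show "\<forall>k\<in>{..<l2 + 1} - {l1, l2}. P k x = 0"
    proof
      fix k assume "k \<in> {..<l2 + 1} - {l1, l2}"
      then have "k < l1 \<or> (l1 < k \<and> k < l2)" by auto
      then show "P k x = 0" using assms(2,3) by auto
    qed
  qed (use assms(1) in auto)
  then show ?thesis using assms(1) by simp
qed

text \<open>By Euler's identity, x . df multiplies the term of degree j by j. Hence the expression
  in the third claim has lost its terms of degrees a + 2 and l2.\<close>

lemma two_term_expansion:
  fixes f :: "real ^ 'n \<Rightarrow> real"
  assumes f: "hom_series f c" and l: "a + 2 < l2"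
    and zero: "\<And>k. k < a + 2 \<Longrightarrow> hom_poly c k = (\<lambda>_. 0)"
      "\<And>k. a + 2 < k \<Longrightarrow> k < l2 \<Longrightarrow> hom_poly c k = (\<lambda>_. 0)"
  shows "order_bound (\<lambda>x. f x - hom_poly c (a + 2) x) (a + 3)"
    and "order_bound (\<lambda>x. norm (diff_vec f x - (\<chi> i. hom_poly (dcoeff i c) (a + 1) x))) (a + 2)"
    and "order_bound (\<lambda>x. real (a + 2) * f x - x \<bullet> diff_vec f x + real (l2 - (a + 2)) * hom_poly c l2 x) (l2 + 1)"
proof -
  have F: "order_bound (\<lambda>x. f x - (hom_poly c (a + 2) x + hom_poly c l2 x)) (l2 + 1)"
    using hom_series_order_bound[OF f, of "l2 + 1"] sum_two_terms[where P = "hom_poly c", OF l zero] by simp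
  \<comment> \<open>The differential of f starts with terms of degrees a + 1 and b.\<close>
  obtain b where b: "l2 = Suc b" "a + 1 < b" using l by (cases l2) auto
  have dzero: "hom_poly (dcoeff i c) k = (\<lambda>_. 0)" if "k < a + 1 \<or> (a + 1 < k \<and> k < b)" for i k
    using that b zero[of "Suc k"] by (intro hom_poly_dcoeff_zero) auto
  define dF where "dF i x = partial_deriv i f x - (hom_poly (dcoeff i c) (a + 1) x + hom_poly (dcoeff i c) b x)" for i x
  have dF: "order_bound (dF i) l2" for i
    using hom_series_order_bound[OF hom_series_partial_deriv[OF f, of i], of "b + 1"]
      sum_two_terms[where P = "hom_poly (dcoeff i c)", OF b(2) dzero dzero]
    by (simp add: dF_def[abs_def] b(1))
  have "order_bound (\<lambda>x. (f x - (hom_poly c (a + 2) x + hom_poly c l2 x)) + hom_poly c l2 x) (a + 3)"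
    by (intro sum_in_bigo order_bound_mono[OF F] order_bound_mono[OF order_bound_hom_poly]) (use l in auto)
  then show "order_bound (\<lambda>x. f x - hom_poly c (a + 2) x) (a + 3)" by simp
  show "order_bound (\<lambda>x. norm (diff_vec f x - (\<chi> i. hom_poly (dcoeff i c) (a + 1) x))) (a + 2)"
  proof (rule order_bound_norm)
    fix i
    have "order_bound (\<lambda>x. dF i x + hom_poly (dcoeff i c) b x) (a + 2)"
      by (intro sum_in_bigo order_bound_mono[OF dF] order_bound_mono[OF order_bound_hom_poly]) (use b in auto)
    then show "order_bound (\<lambda>x. (diff_vec f x - (\<chi> i. hom_poly (dcoeff i c) (a + 1) x)) $ i) (a + 2)"
      by (simp add: dF_def diff_vec_def)
  qed
  have "order_bound (\<lambda>x. x $ i * dF i x) (l2 + 1)" for i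
    using order_bound_mult[OF order_bound_nth[of i] dF[of i]] by simp
  then have "order_bound (\<lambda>x. \<Sum>i\<in>UNIV. x $ i * dF i x) (l2 + 1)"
    by (intro big_sum_in_bigo) simp
  then have S: "order_bound (\<lambda>x. real (a + 2) * (f x - (hom_poly c (a + 2) x + hom_poly c l2 x))
      - (\<Sum>i\<in>UNIV. x $ i * dF i x)) (l2 + 1)"
    by (intro sum_in_bigo order_bound_cmult[OF F])
  have "(\<Sum>i\<in>UNIV. x $ i * dF i x) = x \<bullet> diff_vec f x - (real (a + 2) * hom_poly c (a + 2) x + real l2 * hom_poly c l2 x)" for x
  proof -
    have "(\<Sum>i\<in>UNIV. x $ i * dF i x) = (\<Sum>i\<in>UNIV. x $ i * partial_deriv i f x)
        - ((\<Sum>i\<in>UNIV. x $ i * hom_poly (dcoeff i c) (a + 1) x) + (\<Sum>i\<in>UNIV. x $ i * hom_poly (dcoeff i c) b x))"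
      by (simp add: dF_def sum_subtractf sum.distrib distrib_left right_diff_distrib)
    then show ?thesis
      using euler_identity[of x c "a + 1"] euler_identity[of x c b]
      by (simp add: b(1) inner_vec_def diff_vec_def)
  qed
  with S show "order_bound (\<lambda>x. real (a + 2) * f x - x \<bullet> diff_vec f x + real (l2 - (a + 2)) * hom_poly c l2 x) (l2 + 1)"
    using l by (simp add: of_nat_diff algebra_simps)
qed

text \<open>Writing x = r q reduces the claim to \<open>sph\<close> on the unit sphere, since
  \<theta> |N|^2 and, if a + 2 + k = l2, the term of degree l2 are homogeneous of degree a + 2 + k.
  All remainders gain a factor r, and K collects their constants.\<close>

lemma restoring_estimate:
  fixes x dU :: "real ^ 'n" and u K K1 K2 \<eta> c0 :: real
  assumes x: "x \<noteq> 0" "norm x \<le> 1" and u: "u \<le> 0" and \<eta>: "0 \<le> \<eta>"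
    and R1: "\<bar>real (a + 2) * u - x \<bullet> dU + real (l2 - (a + 2)) * hom_poly c l2 x\<bar> \<le> K1 * norm x ^ (l2 + 1)"
    and R2: "\<bar>u - hom_poly c (a + 2) x\<bar> \<le> K2 * norm x ^ (a + 3)"
    and kl: "a + 2 + k \<le> l2"
    and sph: "\<And>q. q \<in> sphere 0 1 \<Longrightarrow> c0 \<le> (if a + 2 + k = l2 then - real (l2 - (a + 2)) * hom_poly c l2 q else 0)
      + \<eta> * ((norm (\<chi> i. hom_poly (dcoeff i c) (a + 1) q))\<^sup>2 + max 0 (hom_poly c (a + 2) q))"
    and K: "\<bar>K1\<bar> + \<eta> * \<bar>K2\<bar> + real (l2 - (a + 2)) * coeff_mass c l2 \<le> K"
  shows "c0 * norm x ^ (a + 2 + k) - K * norm x ^ (a + 2 + k + 1) \<le> real (a + 2) * u - x \<bullet> dU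
    + \<eta> * (x \<bullet> x) powr ((real k - real a) / 2) * (norm (\<chi> i. hom_poly (dcoeff i c) (a + 1) x))\<^sup>2"
proof -
  define r where "r = norm x"
  have r: "0 < r" "r \<le> 1" using x by (auto simp: r_def)
  define q where "q = x /\<^sub>R r"
  have q: "q \<in> sphere 0 1" and xq: "x = r *\<^sub>R q"
    using r by (auto simp: q_def r_def)
  define \<theta> where "\<theta> = (x \<bullet> x) powr ((real k - real a) / 2)"
  have \<theta>: "\<theta> * r ^ (a + 2) = r ^ (k + 2)"
    unfolding \<theta>_def r_def by (rule inner_self_powr[OF x(1)])
  define n where "n = (norm (\<chi> i. hom_poly (dcoeff i c) (a + 1) q))\<^sup>2"
  have Nx: "(\<chi> i. hom_poly (dcoeff i c) (a + 1) x) = r ^ (a + 1) *\<^sub>R (\<chi> i. hom_poly (dcoeff i c) (a + 1) q)"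
    unfolding xq hom_poly_scaleR by (simp add: vec_eq_iff)
  have "\<theta> * (norm (\<chi> i. hom_poly (dcoeff i c) (a + 1) x))\<^sup>2 = \<theta> * (r ^ (a + 1))\<^sup>2 * n"
    unfolding Nx n_def by (simp add: power_mult_distrib)
  also have "(r ^ (a + 1))\<^sup>2 = r ^ (a + 2) * r ^ a"
    by (simp add: power2_eq_square flip: power_add)
  also have "\<theta> * (r ^ (a + 2) * r ^ a) * n = r ^ (a + 2 + k) * n"
    unfolding mult.assoc[symmetric] \<theta> by (simp add: power_add mult_ac)
  finally have N: "\<theta> * (norm (\<chi> i. hom_poly (dcoeff i c) (a + 1) x))\<^sup>2 = r ^ (a + 2 + k) * n" .
  define R where "R = r ^ (a + 2 + k)"
  have R: "0 < R" using r by (simp add: R_def)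
  have Rr: "r ^ (a + 2 + k + 1) = R * r" by (simp add: R_def)
  define A where "A = (if a + 2 + k = l2 then - real (l2 - (a + 2)) * hom_poly c l2 q else 0)"
  define m where "m = real (l2 - (a + 2)) * coeff_mass c l2"
  have m: "0 \<le> m" by (simp add: m_def coeff_mass_nonneg)
  have "- real (l2 - (a + 2)) * hom_poly c l2 x \<ge> R * A - m * (R * r)"
  proof (cases "a + 2 + k = l2")
    case True
    have "- real (l2 - (a + 2)) * hom_poly c l2 x = R * A"
      unfolding xq hom_poly_scaleR using True by (simp add: A_def R_def)
    moreover have "0 \<le> m * (R * r)" using m R r by simp
    ultimately show ?thesis by linarith
  next
    \<comment> \<open>Now k < l2 - (a + 2), and the term of degree l2 is itself an error of size R
      r.\<close>
    case False
    have "r ^ l2 \<le> R * r"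
      unfolding Rr[symmetric] using False kl r by (intro power_decreasing) auto
    then have "m * r ^ l2 \<le> m * (R * r)" using m by (rule mult_left_mono)
    moreover have "real (l2 - (a + 2)) * hom_poly c l2 x \<le> m * r ^ l2"
      using hom_poly_bound[of c l2 x] unfolding m_def r_def mult.assoc by (intro mult_left_mono) auto
    ultimately show ?thesis using False by (simp add: A_def)
  qed
  moreover have "\<bar>K1\<bar> * (R * r) \<ge> K1 * norm x ^ (l2 + 1)"
  proof -
    have "r ^ (l2 + 1) \<le> R * r"
      unfolding Rr[symmetric] using kl r by (intro power_decreasing) auto
    then have "\<bar>K1\<bar> * r ^ (l2 + 1) \<le> \<bar>K1\<bar> * (R * r)" by (rule mult_left_mono) simp
    moreover have "K1 * r ^ (l2 + 1) \<le> \<bar>K1\<bar> * r ^ (l2 + 1)" using r by (intro mult_right_mono) auto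
    ultimately show ?thesis by (simp add: r_def)
  qed
  \<comment> \<open>Where U <= 0 the leading term can be positive only by O(r) on the sphere, so its
    positive part in \<open>sph\<close> is one of the errors.\<close>
  moreover have "max 0 (hom_poly c (a + 2) q) \<le> \<bar>K2\<bar> * r"
  proof -
    have "r ^ (a + 2) * hom_poly c (a + 2) q \<le> K2 * r ^ (a + 3)"
      using R2 u hom_poly_scaleR[of c "a + 2" r q] unfolding xq[symmetric] r_def[symmetric] by linarith
    also have "\<dots> = r ^ (a + 2) * (K2 * r)" by (simp add: power_add mult_ac numeral_3_eq_3)
    finally have "hom_poly c (a + 2) q \<le> K2 * r" using r by (simp add: mult_le_cancel_left_pos)
    also have "\<dots> \<le> \<bar>K2\<bar> * r" using r by (intro mult_right_mono) auto
    finally show ?thesis using r by simp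
  qed
  then have "R * (\<eta> * max 0 (hom_poly c (a + 2) q)) \<le> R * (\<eta> * (\<bar>K2\<bar> * r))"
    using R \<eta> by (intro mult_left_mono) auto
  moreover have "R * c0 \<le> R * (A + \<eta> * (n + max 0 (hom_poly c (a + 2) q)))"
    using sph[OF q] R unfolding A_def n_def by (intro mult_left_mono) auto
  moreover have "(\<bar>K1\<bar> + \<eta> * \<bar>K2\<bar> + m) * (R * r) \<le> K * (R * r)"
    using K R r unfolding m_def by (intro mult_right_mono) auto
  ultimately have "c0 * R - K * (R * r) \<le> real (a + 2) * u - x \<bullet> dU + \<eta> * (R * n)"
    using R1 by (simp add: algebra_simps abs_le_iff)
  moreover have "\<eta> * (x \<bullet> x) powr ((real k - real a) / 2) * (norm (\<chi> i. hom_poly (dcoeff i c) (a + 1) x))\<^sup>2 = \<eta> * (R * n)"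
    unfolding \<theta>_def[symmetric] mult.assoc N R_def ..
  ultimately show ?thesis
    by (simp only: r_def[symmetric] Rr R_def[symmetric])
qed

lemma norm_matrix_vector_mult_le:
  fixes A :: "real ^ 'n ^ 'm"
  shows "norm (A *v v) \<le> (\<Sum>i\<in>UNIV. \<Sum>j\<in>UNIV. \<bar>A $ i $ j\<bar>) * norm v"
proof -
  have "norm (A *v v) \<le> (\<Sum>i\<in>UNIV. \<Sum>j\<in>UNIV. \<bar>A $ i $ j\<bar> * norm v)"
  proof (rule norm_vec_le_sum)
    fix i
    have "norm (\<Sum>j\<in>UNIV. A $ i $ j * v $ j) \<le> (\<Sum>j\<in>UNIV. \<bar>A $ i $ j\<bar> * norm v)"
      by (rule sum_norm_le) (simp add: abs_mult component_le_norm_cart mult_left_mono)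
    then show "\<bar>(A *v v) $ i\<bar> \<le> (\<Sum>j\<in>UNIV. \<bar>A $ i $ j\<bar> * norm v)"
      by (simp add: matrix_vector_mult_def)
  qed
  then show ?thesis by (simp add: sum_distrib_right)
qed

lemma norm_contract_d_le:
  "norm (contract_d \<sigma> x v) \<le> (\<Sum>i\<in>UNIV. \<Sum>j\<in>UNIV.
     \<bar>partial_deriv j (\<lambda>y. \<sigma> y $ i) x - partial_deriv i (\<lambda>y. \<sigma> y $ j) x\<bar>) * norm v"
proof -
  have "contract_d \<sigma> x v = (\<chi> i j. partial_deriv j (\<lambda>y. \<sigma> y $ i) x - partial_deriv i (\<lambda>y. \<sigma> y $ j) x) *v v"
    by (simp add: contract_d_def matrix_vector_mult_def)
  then show ?thesis
    using norm_matrix_vector_mult_le[of "\<chi> i j. partial_deriv j (\<lambda>y. \<sigma> y $ i) x - partial_deriv i (\<lambda>y. \<sigma> y $ j) x" v]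
    by simp
qed

lemma norm_metric_force_le:
  "norm (metric_force g x v) \<le>
     (\<Sum>i\<in>UNIV. \<Sum>j\<in>UNIV. \<Sum>k\<in>UNIV. \<bar>partial_deriv i (\<lambda>y. g y $ j $ k) x\<bar>) * (norm v)\<^sup>2"
proof -
  have "norm (metric_force g x v) \<le>
     (\<Sum>i\<in>UNIV. \<Sum>j\<in>UNIV. \<Sum>k\<in>UNIV. \<bar>partial_deriv i (\<lambda>y. g y $ j $ k) x\<bar> * (norm v)\<^sup>2)"
  proof (rule norm_vec_le_sum)
    fix i
    have "norm (\<Sum>j\<in>UNIV. \<Sum>k\<in>UNIV. partial_deriv i (\<lambda>y. g y $ j $ k) x * v $ j * v $ k)
      \<le> (\<Sum>j\<in>UNIV. \<Sum>k\<in>UNIV. \<bar>partial_deriv i (\<lambda>y. g y $ j $ k) x\<bar> * (norm v)\<^sup>2)"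
    proof (intro sum_norm_le)
      fix j k
      have "\<bar>v $ j\<bar> * \<bar>v $ k\<bar> \<le> norm v * norm v"
        by (intro mult_mono component_le_norm_cart) auto
      then show "norm (partial_deriv i (\<lambda>y. g y $ j $ k) x * v $ j * v $ k)
          \<le> \<bar>partial_deriv i (\<lambda>y. g y $ j $ k) x\<bar> * (norm v)\<^sup>2"
        by (simp add: abs_mult power2_eq_square mult.assoc mult_left_mono)
    qed
    then show "\<bar>metric_force g x v $ i\<bar> \<le> (\<Sum>j\<in>UNIV. \<Sum>k\<in>UNIV. \<bar>partial_deriv i (\<lambda>y. g y $ j $ k) x\<bar> * (norm v)\<^sup>2)"
      by (simp add: metric_force_def)
  qed
  then show ?thesis by (simp add: sum_distrib_right)
qed

lemma hom_vec_bound: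
  "norm (\<chi> i. hom_poly (c i) k x) \<le> (\<Sum>i\<in>UNIV. coeff_mass (c i) k) * norm x ^ k"
proof -
  have "norm (\<chi> i. hom_poly (c i) k x) \<le> (\<Sum>i\<in>UNIV. coeff_mass (c i) k * norm x ^ k)"
    by (rule norm_vec_le_sum) (simp add: hom_poly_bound)
  then show ?thesis by (simp add: sum_distrib_right)
qed

lemma hom_mat_bound:
  fixes v :: "real ^ 'n"
  shows "norm (\<chi> i. \<Sum>j\<in>UNIV. hom_poly (c i j) k x * v $ j) \<le> (\<Sum>i\<in>UNIV. \<Sum>j\<in>UNIV. coeff_mass (c i j) k) * norm x ^ k * norm v"
proof -
  have "norm ((\<chi> i j. hom_poly (c i j) k x) *v v) \<le> (\<Sum>i\<in>UNIV. \<Sum>j\<in>UNIV. \<bar>hom_poly (c i j) k x\<bar>) * norm v"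
    using norm_matrix_vector_mult_le[of "\<chi> i j. hom_poly (c i j) k x" v] by simp
  also have "\<dots> \<le> (\<Sum>i\<in>UNIV. \<Sum>j\<in>UNIV. coeff_mass (c i j) k * norm x ^ k) * norm v"
    by (intro mult_right_mono sum_mono hom_poly_bound) simp
  finally show ?thesis by (simp add: matrix_vector_mult_def sum_distrib_right)
qed

text \<open>Since g is the identity at the origin, the entries of the difference are O(|x|). The
  deviation 1/2 is what yields the factor 2 in \<open>elliptic\<close>.\<close>

lemma metric_near_identity:
  fixes g :: "real ^ 'n \<Rightarrow> real ^ 'n ^ 'n"
  assumes g: "\<And>i j. hom_series (\<lambda>x. g x $ i $ j) (c i j)" and "g 0 = mat 1"
  shows "\<forall>\<^sub>F x in nhds 0. \<forall>v. norm (g x *v v - v) \<le> (1/2) * norm v"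
proof -
  define s where "s x = (\<Sum>i\<in>UNIV. \<Sum>j\<in>UNIV. \<bar>(g x - mat 1) $ i $ j\<bar>)" for x
  have "order_bound (\<lambda>x. (g x - mat 1) $ i $ j) 1" for i j
  proof -
    have "hom_poly (c i j) 0 x = (mat 1 :: real ^ 'n ^ 'n) $ i $ j" for x
      using hom_series_at_0[OF g[of i j], of x] assms(2) by simp
    then show ?thesis using hom_series_order_bound[OF g[of i j], of 1] by simp
  qed
  then have "order_bound s 1"
    unfolding s_def[abs_def] by (intro big_sum_in_bigo) simp
  then obtain K where K: "K > 0" "\<forall>\<^sub>F x in nhds 0. \<bar>s x\<bar> \<le> K * norm x"
    by (elim landau_o.bigE) auto
  have "\<forall>\<^sub>F x :: real ^ 'n in nhds 0. norm x < 1 / (2 * K)"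
    unfolding eventually_nhds_metric using K(1) by (intro exI[of _ "1 / (2 * K)"]) auto
  then show ?thesis
    using K(2)
  proof eventually_elim
    case (elim x)
    have "K * norm x \<le> K * (1 / (2 * K))" using elim(1) K(1) by (intro mult_left_mono) auto
    then have s: "s x \<le> 1 / 2" using elim(2) K(1) by simp
    show ?case
    proof
      fix v
      have "g x *v v - v = (g x - mat 1) *v v"
        by (simp add: matrix_vector_mult_diff_rdistrib)
      also have "norm \<dots> \<le> s x * norm v" unfolding s_def by (rule norm_matrix_vector_mult_le)
      also have "\<dots> \<le> (1/2) * norm v" using s by (rule mult_right_mono) simp
      finally show "norm (g x *v v - v) \<le> (1/2) * norm v" .
    qed
  qed
qed

text \<open>The choices are nested: \<open>K1\<close> and \<open>K2\<close> come from the expansion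
  of U, K dominates them and the constants of the other estimates, and \<rho> is taken last, so
  small that all estimates with this K hold on the ball.\<close>

lemma lagrangian_lyapunov_exists:
  fixes W :: "(real ^ 'n) set" and g :: "real ^ 'n \<Rightarrow> real ^ 'n ^ 'n"
  assumes W: "open W" "0 \<in> W" and metric: "riemannian_metric_on g W" "g 0 = mat 1"
    and U: "hom_series U c" and \<sigma>: "\<And>i. hom_series (\<lambda>x. \<sigma> x $ i) (c\<sigma> i)"
    and g: "\<And>i j. hom_series (\<lambda>x. g x $ i $ j) (cg i j)"
    and l: "a + 2 < l2" and zero: "\<And>k. k < a + 2 \<Longrightarrow> hom_poly c k = (\<lambda>_. 0)"
      "\<And>k. a + 2 < k \<Longrightarrow> k < l2 \<Longrightarrow> hom_poly c k = (\<lambda>_. 0)"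
    and \<sigma>_zero: "\<And>i j. j \<le> D \<Longrightarrow> hom_poly (c\<sigma> i) j = (\<lambda>_. 0)"
    and k: "1 \<le> k" "a + 2 + k \<le> l2" and D: "a + 2 + 2 * k + 1 \<le> 2 * D + 2" and \<eta>: "0 \<le> \<eta>" and c0: "0 < c0"
    and sph: "\<And>q. q \<in> sphere 0 1 \<Longrightarrow> c0 \<le> (if a + 2 + k = l2 then - real (l2 - (a + 2)) * hom_poly c l2 q else 0)
      + \<eta> * ((norm (\<chi> i. hom_poly (dcoeff i c) (a + 1) q))\<^sup>2 + max 0 (hom_poly c (a + 2) q))"
  shows "\<exists>\<rho> K. lagrangian_lyapunov W g \<sigma> U \<rho> K c a k D \<eta> c0"
proof -
  note two = two_term_expansion[OF U l zero]
  obtain K1 where K1: "\<forall>\<^sub>F x in nhds 0. \<bar>real (a + 2) * U x - x \<bullet> diff_vec U x + real (l2 - (a + 2)) * hom_poly c l2 x\<bar>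
      \<le> K1 * norm x ^ (l2 + 1)"
    using eventually_happens'[OF trivial_limit_at_top_linorder order_bound_at_top[OF two(3)]] by blast
  obtain K2 where K2: "\<forall>\<^sub>F x in nhds 0. \<bar>U x - hom_poly c (a + 2) x\<bar> \<le> K2 * norm x ^ (a + 3)"
    using eventually_happens'[OF trivial_limit_at_top_linorder order_bound_at_top[OF two(1)]] by blast
  define s\<sigma> where "s\<sigma> x = (\<Sum>i\<in>UNIV. \<Sum>j\<in>UNIV.
     \<bar>partial_deriv j (\<lambda>y. \<sigma> y $ i) x - partial_deriv i (\<lambda>y. \<sigma> y $ j) x\<bar>)" for x
  define sg where "sg x = (\<Sum>i\<in>UNIV. \<Sum>j\<in>UNIV. \<Sum>k\<in>UNIV. \<bar>partial_deriv i (\<lambda>y. g y $ j $ k) x\<bar>)" for x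
  have "order_bound (partial_deriv j (\<lambda>y. \<sigma> y $ i)) D" for i j
    by (rule hom_series_vanishing_order[OF hom_series_partial_deriv[OF \<sigma>]])
      (simp add: hom_poly_dcoeff_zero \<sigma>_zero)
  then have "order_bound s\<sigma> D"
    unfolding s\<sigma>_def[abs_def] by (intro big_sum_in_bigo) (simp add: sum_in_bigo)
  moreover have "order_bound (partial_deriv i (\<lambda>y. g y $ j $ k)) 0" for i j k
    by (rule hom_series_vanishing_order[OF hom_series_partial_deriv[OF g]]) simp
  then have "order_bound sg 0"
    unfolding sg_def[abs_def] by (intro big_sum_in_bigo) simp
  moreover have "order_bound U 2"
    by (rule hom_series_vanishing_order[OF U zero(1)]) simp
  ultimately have "\<forall>\<^sub>F K in at_top. (\<forall>\<^sub>F x in nhds 0. \<bar>s\<sigma> x\<bar> \<le> K * norm x ^ D) \<and>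
      (\<forall>\<^sub>F x in nhds 0. \<bar>sg x\<bar> \<le> K * norm x ^ 0) \<and> (\<forall>\<^sub>F x in nhds 0. \<bar>U x\<bar> \<le> K * norm x ^ 2) \<and>
      (\<forall>\<^sub>F x in nhds 0. \<bar>norm (diff_vec U x - (\<chi> i. hom_poly (dcoeff i c) (a + 1) x))\<bar> \<le> K * norm x ^ (a + 2)) \<and>
      2 \<le> K \<and> real a + real k \<le> K \<and> (\<Sum>i\<in>UNIV. coeff_mass (dcoeff i c) (a + 1)) \<le> K \<and>
      (\<Sum>i\<in>UNIV. \<Sum>j\<in>UNIV. coeff_mass (dcoeff j (dcoeff i c)) a) \<le> K \<and>
      \<bar>K1\<bar> + \<eta> * \<bar>K2\<bar> + real (l2 - (a + 2)) * coeff_mass c l2 \<le> K"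
    by (intro eventually_conj order_bound_at_top two(2) eventually_ge_at_top)
  from eventually_happens'[OF trivial_limit_at_top_linorder this]
  obtain K where K_ev: "\<forall>\<^sub>F x in nhds 0. \<bar>s\<sigma> x\<bar> \<le> K * norm x ^ D" "\<forall>\<^sub>F x in nhds 0. \<bar>sg x\<bar> \<le> K * norm x ^ 0"
      "\<forall>\<^sub>F x in nhds 0. \<bar>U x\<bar> \<le> K * norm x ^ 2"
      "\<forall>\<^sub>F x in nhds 0. \<bar>norm (diff_vec U x - (\<chi> i. hom_poly (dcoeff i c) (a + 1) x))\<bar> \<le> K * norm x ^ (a + 2)"
    and K: "2 \<le> K" "real a + real k \<le> K" "(\<Sum>i\<in>UNIV. coeff_mass (dcoeff i c) (a + 1)) \<le> K"
      "(\<Sum>i\<in>UNIV. \<Sum>j\<in>UNIV. coeff_mass (dcoeff j (dcoeff i c)) a) \<le> K"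
      "\<bar>K1\<bar> + \<eta> * \<bar>K2\<bar> + real (l2 - (a + 2)) * coeff_mass c l2 \<le> K"
    by (elim exE conjE)
  have g_diff: "\<forall>\<^sub>F x in nhds 0. \<forall>i j. (\<lambda>y. g y $ i $ j) differentiable (at x)"
    by (intro eventually_all_finite hom_series_differentiable_nhds[OF g])
  have norm1: "\<forall>\<^sub>F x :: real ^ 'n in nhds 0. norm x \<le> 1" by (rule eventually_norm_le_1)
  have "\<forall>\<^sub>F x in nhds 0. x \<in> W" by (rule eventually_nhds_in_open[OF W])
  note ev = ball_at_right[OF this] ball_at_right[OF K1] ball_at_right[OF K2] ball_at_right[OF K_ev(1)]
    ball_at_right[OF K_ev(2)] ball_at_right[OF K_ev(3)] ball_at_right[OF K_ev(4)] ball_at_right[OF norm1]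
    ball_at_right[OF metric_near_identity[OF g metric(2)]] ball_at_right[OF hom_series_differentiable_nhds[OF U]]
    ball_at_right[OF g_diff]
  have lip: "\<forall>\<^sub>F \<rho> in at_right 0. \<forall>i j. \<exists>L. L-lipschitz_on (ball 0 \<rho>) (\<lambda>y. g y $ i $ j)"
    "\<forall>\<^sub>F \<rho> in at_right 0. \<forall>k i j. \<exists>L. L-lipschitz_on (ball 0 \<rho>) (partial_deriv k (\<lambda>y. g y $ i $ j))"
    "\<forall>\<^sub>F \<rho> in at_right 0. \<forall>i. \<exists>L. L-lipschitz_on (ball 0 \<rho>) (partial_deriv i U)"
    "\<forall>\<^sub>F \<rho> in at_right 0. \<forall>k i. \<exists>L. L-lipschitz_on (ball 0 \<rho>) (partial_deriv k (\<lambda>y. \<sigma> y $ i))"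
    by (intro eventually_all_finite lipschitz_bound_at_right[OF g] lipschitz_bound_at_right[OF hom_series_partial_deriv[OF g]]
        lipschitz_bound_at_right[OF hom_series_partial_deriv[OF U]] lipschitz_bound_at_right[OF hom_series_partial_deriv[OF \<sigma>]])+
  have "\<exists>\<rho>. 0 < \<rho> \<and> lagrangian_lyapunov W g \<sigma> U \<rho> K c a k D \<eta> c0"
  proof (rule eventually_happens'[OF trivial_limit_at_right_real])
    show "\<forall>\<^sub>F \<rho> in at_right 0. 0 < \<rho> \<and> lagrangian_lyapunov W g \<sigma> U \<rho> K c a k D \<eta> c0"
      using eventually_at_right_less[of "0 :: real"] ev lip
    proof eventually_elim
      case (elim \<rho>)
      have near: "norm (g x *v v - v) \<le> (1/2) * norm v" if "x \<in> ball 0 \<rho>" for x v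
        using elim(10) that by blast
      have "lagrangian_lyapunov W g \<sigma> U \<rho> K c a k D \<eta> c0"
      proof unfold_locales
        show "open W" "riemannian_metric_on g W" "1 \<le> k" "a + 2 + 2 * k + 1 \<le> 2 * D + 2" "0 \<le> \<eta>" "0 < c0" "0 < \<rho>"
          by fact+
        show "ball 0 \<rho> \<subseteq> W" using elim(2) by blast
        show "1 \<le> K" "real a + real k \<le> K" using K by simp_all
        show "U differentiable (at x)" if "x \<in> ball 0 \<rho>" for x using elim(11) that by blast
        show "(\<lambda>y. g y $ i $ j) differentiable (at x)" if "x \<in> ball 0 \<rho>" for i j x using elim(12) that by blast
        show "(norm v)\<^sup>2 \<le> 2 * (v \<bullet> (g x *v v))" if "x \<in> ball 0 \<rho>" for x v
        proof -
          have "\<bar>v \<bullet> (g x *v v - v)\<bar> \<le> norm v * ((1/2) * norm v)"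
            using near[OF that, of v] by (intro order_trans[OF Cauchy_Schwarz_ineq2] mult_left_mono) auto
          moreover have "v \<bullet> (g x *v v - v) = v \<bullet> (g x *v v) - (norm v)\<^sup>2"
            by (simp add: inner_diff_right power2_norm_eq_inner)
          moreover have "norm v * ((1/2) * norm v) = (norm v)\<^sup>2 / 2" by (simp add: power2_eq_square)
          ultimately show ?thesis by linarith
        qed
        show "norm (g x *v v) \<le> K * norm v" if "x \<in> ball 0 \<rho>" for x v
        proof -
          have "norm (g x *v v) \<le> 2 * norm v"
            using near[OF that, of v] norm_triangle_sub[of "g x *v v" v] norm_ge_zero[of v] by linarith
          also have "\<dots> \<le> K * norm v" using K(1) by (rule mult_right_mono) simp
          finally show ?thesis .
        qed
        show "\<bar>U x\<bar> \<le> K * (norm x)\<^sup>2" if "x \<in> ball 0 \<rho>" for x using elim(7) that by blast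
        show "\<exists>L. L-lipschitz_on (ball 0 \<rho>) (\<lambda>y. g y $ i $ j)" for i j using elim(13) by blast
        show "\<exists>L. L-lipschitz_on (ball 0 \<rho>) (partial_deriv k (\<lambda>y. g y $ i $ j))" for k i j using elim(14) by blast
        show "\<exists>L. L-lipschitz_on (ball 0 \<rho>) (partial_deriv i U)" for i using elim(15) by blast
        show "\<exists>L. L-lipschitz_on (ball 0 \<rho>) (partial_deriv k (\<lambda>y. \<sigma> y $ i))" for k i using elim(16) by blast
        show "norm (metric_force g x v) \<le> K * (norm v)\<^sup>2" if "x \<in> ball 0 \<rho>" for x v
        proof -
          have "sg x \<le> K" using elim(6) that by (auto simp: abs_le_iff)
          then have "sg x * (norm v)\<^sup>2 \<le> K * (norm v)\<^sup>2" by (rule mult_right_mono) simp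
          then show ?thesis using norm_metric_force_le[of g x v] unfolding sg_def by (rule order_trans[rotated])
        qed
        show "norm (contract_d \<sigma> x v) \<le> K * norm x ^ D * norm v" if "x \<in> ball 0 \<rho>" for x v
        proof -
          have "s\<sigma> x \<le> K * norm x ^ D" using elim(5) that abs_le_D1 by blast
          then have "s\<sigma> x * norm v \<le> K * norm x ^ D * norm v" by (rule mult_right_mono) simp
          then show ?thesis using norm_contract_d_le[of \<sigma> x v] unfolding s\<sigma>_def by (rule order_trans[rotated])
        qed
        show "norm (diff_vec U x - (\<chi> i. hom_poly (dcoeff i c) (a + 1) x)) \<le> K * norm x ^ (a + 2)"
          if "x \<in> ball 0 \<rho>" for x
          using elim(8) that abs_le_D1 by blast
        show "norm (\<chi> i. hom_poly (dcoeff i c) (a + 1) x) \<le> K * norm x ^ (a + 1)" for x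
          by (rule order_trans[OF hom_vec_bound mult_right_mono[OF K(3)]]) simp
        show "norm (\<chi> i. \<Sum>j\<in>UNIV. hom_poly (dcoeff j (dcoeff i c)) a x * v $ j) \<le> K * norm x ^ a * norm v" for x v
          by (rule order_trans[OF hom_mat_bound mult_right_mono[OF mult_right_mono[OF K(4)]]]) simp_all
        show "c0 * norm x ^ (a + 2 + k) - K * norm x ^ (a + 2 + k + 1) \<le> real (a + 2) * U x - x \<bullet> diff_vec U x
            + \<eta> * (x \<bullet> x) powr ((real k - real a) / 2) * (norm (\<chi> i. hom_poly (dcoeff i c) (a + 1) x))\<^sup>2"
          if x: "x \<in> ball 0 \<rho>" "x \<noteq> 0" "U x \<le> 0" for x
        proof (rule restoring_estimate[OF x(2) _ x(3) \<eta> _ _ k(2) sph K(5)])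
          show "norm x \<le> 1" using elim(9) x(1) by blast
          show "\<bar>real (a + 2) * U x - x \<bullet> diff_vec U x + real (l2 - (a + 2)) * hom_poly c l2 x\<bar> \<le> K1 * norm x ^ (l2 + 1)"
            using elim(3) x(1) by blast
          show "\<bar>U x - hom_poly c (a + 2) x\<bar> \<le> K2 * norm x ^ (a + 3)" using elim(4) x(1) by blast
        qed
      qed
      then show ?case using elim(1) by blast
    qed
  qed
  then show ?thesis by blast
qed

section \<open>From the degree hypotheses to the constants of the Lyapunov function\<close>

lemma continuous_on_hom_poly: "continuous_on S (hom_poly c k)"
proof (rule has_derivative_continuous_on)
  fix x
  show "(hom_poly c k has_derivative (if k = 0 then \<lambda>_. 0 else
      (\<lambda>h. \<Sum>i\<in>UNIV. hom_poly (dcoeff i c) (k - 1) x * h $ i))) (at x within S)"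
    using hom_poly_0_has_derivative[of c x] hom_poly_has_derivative[of c "k - 1" x]
    by (cases k) (auto intro: has_derivative_at_withinI)
qed

text \<open>Otherwise the germ would equal its term of degree k0. The choice k0 = 0 shows that some
  degree occurs, the choice k0 = \<open>first_degree f\<close> that a second one does.\<close>

lemma nonzero_degrees_not_singleton:
  assumes f: "hom_series f (maclaurin_coeff f)" and "\<not> homogeneous_poly_germ f"
  shows "\<exists>k\<in>nonzero_degrees f. k \<noteq> k0"
proof (rule ccontr)
  assume "\<not> ?thesis"
  then have "hom_poly (maclaurin_coeff f) k = (\<lambda>_. 0)" if "k \<noteq> k0" for k
    using that by (auto simp: nonzero_degrees_def hom_term_def)
  from hom_series_single_term[OF f this] have "homogeneous_poly_germ f"
    unfolding homogeneous_poly_germ_def by blast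
  then show False using assms(2) by simp
qed

lemma first_degree_nonzero:
  assumes "hom_series f (maclaurin_coeff f)" and "\<not> homogeneous_poly_germ f"
  shows "first_degree f \<in> nonzero_degrees f"
  unfolding first_degree_def using nonzero_degrees_not_singleton[OF assms, of 0] by (metis LeastI)

lemma first_two_degrees:
  fixes f :: "real ^ 'n \<Rightarrow> real"
  assumes f: "hom_series f (maclaurin_coeff f)" and germ: "\<not> homogeneous_poly_germ f"
  shows "first_degree f < second_degree f"
    and "k < first_degree f \<Longrightarrow> hom_term f k = (\<lambda>_. 0)"
    and "first_degree f < k \<Longrightarrow> k < second_degree f \<Longrightarrow> hom_term f k = (\<lambda>_. 0)"
proof -
  let ?Z = "nonzero_degrees f"
  have zero: "hom_term f k = (\<lambda>_. 0)" if "k \<notin> ?Z" for k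
    using that by (simp add: nonzero_degrees_def)
  obtain k1 where k1: "k1 \<in> ?Z" "k1 \<noteq> first_degree f"
    using nonzero_degrees_not_singleton[OF f germ] by blast
  moreover have "first_degree f \<le> k1"
    unfolding first_degree_def using k1(1) by (rule Least_le)
  ultimately have "\<exists>k. k \<in> ?Z \<and> first_degree f < k" by (metis le_neq_implies_less)
  then show "first_degree f < second_degree f"
    unfolding second_degree_def by (rule LeastI2_ex) simp
  show "hom_term f k = (\<lambda>_. 0)" if "k < first_degree f"
    using zero not_less_Least[of k "\<lambda>k. k \<in> ?Z"] that by (auto simp: first_degree_def)
  show "hom_term f k = (\<lambda>_. 0)" if "first_degree f < k" "k < second_degree f"
    using zero[of k] not_less_Least[of k "\<lambda>k. k \<in> ?Z \<and> first_degree f < k"] that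
    by (auto simp: second_degree_def)
qed

text \<open>The term of degree 0 is f 0, and by Euler's identity the term of degree 1 is determined
  by the partial derivatives at 0.\<close>

lemma first_degree_ge_2:
  fixes f :: "real ^ 'n \<Rightarrow> real"
  assumes f: "hom_series f (maclaurin_coeff f)" and germ: "\<not> homogeneous_poly_germ f"
    and "f 0 = 0" and D: "(f has_derivative (\<lambda>_. 0)) (at 0)"
  shows "2 \<le> first_degree f"
proof (rule ccontr)
  let ?c = "maclaurin_coeff f"
  have h0: "hom_poly ?c 0 = (\<lambda>_. 0)"
    using hom_series_at_0[OF f] assms(3) by auto
  have "hom_poly (dcoeff i ?c) 0 x = 0" for i x
    using hom_series_at_0[OF hom_series_partial_deriv[OF f, of i], of x] partial_derivI[OF D, of i] by simp
  then have h1: "hom_poly ?c 1 = (\<lambda>_. 0)"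
    using euler_identity[of _ ?c 0] by (simp add: fun_eq_iff)
  assume "\<not> 2 \<le> first_degree f"
  then have "first_degree f = 0 \<or> first_degree f = 1" by linarith
  then have "hom_term f (first_degree f) = (\<lambda>_. 0)" using h0 h1 by (auto simp: hom_term_def)
  then show False using first_degree_nonzero[OF f germ] by (simp add: nonzero_degrees_def)
qed

text \<open>For finite degree d take D = d - 1: doubling the strict inequality d - l/2 > k gives,
  between integers, 2 d >= l + 2 k + 1. It also forces d > 0, so the subtraction is a true one. For
  the zero germ any large D serves.\<close>

lemma one_form_vanishing_degree:
  assumes "ereal (real k) < ereal_of_enat (one_form_degree \<sigma>) - ereal (real l / 2)"
  shows "\<exists>D. l + 2 * k + 1 \<le> 2 * D + 2 \<and> (\<forall>i. \<forall>j\<le>D. hom_term (\<lambda>x. \<sigma> x $ i) j = (\<lambda>_. 0))"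
proof -
  have zero: "hom_term (\<lambda>x. \<sigma> x $ i) j = (\<lambda>_. 0)" if "enat j < one_form_degree \<sigma>" for i j
  proof (rule ccontr)
    assume "\<not> ?thesis"
    then have "enat j \<in> enat ` {k. \<exists>i. k \<in> nonzero_degrees (\<lambda>x. \<sigma> x $ i)}"
      by (auto simp: nonzero_degrees_def)
    then have "one_form_degree \<sigma> \<le> enat j" unfolding one_form_degree_def by (rule Inf_lower)
    then show False using that by simp
  qed
  show ?thesis
  proof (cases "one_form_degree \<sigma>")
    case (enat d)
    then have "real k < real d - real l / 2" using assms by simp
    then have "l + 2 * k + 1 \<le> 2 * (d - 1) + 2" "0 < d" by linarith+
    then show ?thesis using zero enat by (intro exI[of _ "d - 1"]) auto
  next
    case infinity
    then show ?thesis using zero by (intro exI[of _ "l + k"]) auto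
  qed
qed

lemma metric_degree_pos: "1 \<le> metric_degree g"
  unfolding metric_degree_def by (rule Inf_greatest) (auto simp: one_enat_def)

theorem proposition12p3:
  fixes W :: "(real ^ 'n) set"
    and U :: "real ^ 'n \<Rightarrow> real"
    and \<sigma> :: "real ^ 'n \<Rightarrow> real ^ 'n"
    and g :: "real ^ 'n \<Rightarrow> real ^ 'n ^ 'n"
  defines "l1 \<equiv> first_degree U"
    and "l2 \<equiv> second_degree U"
    and "m \<equiv> metric_degree g"
    and "d \<equiv> one_form_degree \<sigma>"
  defines "\<kappa> \<equiv> min (enat (l2 - l1)) m"
  defines "f \<equiv> hom_term U l1"
  defines "C \<equiv> (\<lambda>q.
      - (if \<kappa> = enat (l2 - l1) then real (l2 - l1) * hom_term U l2 q else 0)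
      + (if \<kappa> = m then real (the_enat m) * hom_term U l1 q *
           (\<Sum>i\<in>UNIV. \<Sum>j\<in>UNIV. hom_term (\<lambda>x. g x $ i $ j) (the_enat m) q * q $ i * q $ j) else 0))"
  assumes "open W" and "0 \<in> W"
    and "U real_analytic_on W"
    and "\<And>i. (\<lambda>x. \<sigma> x $ i) real_analytic_on W"
    and "\<And>i j. (\<lambda>x. g x $ i $ j) real_analytic_on W"
    and "riemannian_metric_on g W"
    and "U 0 = 0" and "(U has_derivative (\<lambda>_. 0)) (at 0)"
    and "g 0 = mat 1"
    and "\<not> homogeneous_poly_germ U"
    and "ereal_of_enat d - ereal (real l1 / 2) > ereal_of_enat \<kappa>"
    and "\<And>q. sphere_critical_point f q \<Longrightarrow> f q \<le> 0 \<Longrightarrow> C q > 0"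
  shows "\<exists>B. open B \<and> 0 \<in> B \<and> B \<subseteq> W \<and>
           (\<forall>z. fst z \<in> W \<and> positive_orbit W g \<sigma> U z \<subseteq> B \<times> UNIV \<and> energy g U z \<le> 0 \<longrightarrow>
                (0, 0) \<in> omega_limit W g \<sigma> U z \<and> energy g U z = 0)"
proof -
  define c where "c = maclaurin_coeff U"
  have hU: "hom_series U c"
    unfolding c_def by (rule analytic_hom_series[OF \<open>U real_analytic_on W\<close> \<open>0 \<in> W\<close>])
  have h\<sigma>: "hom_series (\<lambda>x. \<sigma> x $ i) (maclaurin_coeff (\<lambda>x. \<sigma> x $ i))" for i
    by (rule analytic_hom_series[OF \<open>(\<lambda>x. \<sigma> x $ i) real_analytic_on W\<close> \<open>0 \<in> W\<close>])
  have hg: "hom_series (\<lambda>x. g x $ i $ j) (maclaurin_coeff (\<lambda>x. g x $ i $ j))" for i j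
    by (rule analytic_hom_series[OF \<open>(\<lambda>x. g x $ i $ j) real_analytic_on W\<close> \<open>0 \<in> W\<close>])
  note deg = first_two_degrees[OF hU[unfolded c_def] \<open>\<not> homogeneous_poly_germ U\<close>,
      folded l1_def l2_def, unfolded hom_term_def, folded c_def]
  define a where "a = l1 - 2"
  have l1: "l1 = a + 2"
    using first_degree_ge_2[OF hU[unfolded c_def] \<open>\<not> homogeneous_poly_germ U\<close> \<open>U 0 = 0\<close>
        \<open>(U has_derivative (\<lambda>_. 0)) (at 0)\<close>] by (simp add: a_def l1_def)
  have "\<kappa> \<le> enat (l2 - l1)" by (simp add: \<kappa>_def)
  then obtain k where k: "\<kappa> = enat k" "k \<le> l2 - l1" by (cases \<kappa>) auto
  have "1 \<le> \<kappa>"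
    unfolding \<kappa>_def m_def using deg(1) metric_degree_pos[of g] by (simp add: one_enat_def)
  then have k1: "1 \<le> k" using k(1) by (simp add: one_enat_def)
  have "ereal (real k) < ereal_of_enat (one_form_degree \<sigma>) - ereal (real l1 / 2)"
    using \<open>ereal_of_enat d - ereal (real l1 / 2) > ereal_of_enat \<kappa>\<close> k(1) by (simp add: d_def)
  from one_form_vanishing_degree[OF this] obtain D where D: "l1 + 2 * k + 1 \<le> 2 * D + 2"
    "\<And>i j. j \<le> D \<Longrightarrow> hom_poly (maclaurin_coeff (\<lambda>x. \<sigma> x $ i)) j = (\<lambda>_. 0)"
    by (auto simp: hom_term_def)
  define N where "N q = (\<chi> i. hom_poly (dcoeff i c) (a + 1) q)" for q :: "real ^ 'n"
  define A where "A q = (if a + 2 + k = l2 then - real (l2 - (a + 2)) * hom_poly c l2 q else 0)" for q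
  \<comment> \<open>At a zero of B the gradient N vanishes and with it, by Euler's identity, the
    leading term. The first summand is the gain from the gradient part of \<Phi>, the second is an
    error of higher order where U <= 0.\<close>
  define B where "B q = (norm (N q))\<^sup>2 + max 0 (hom_poly c (a + 2) q)" for q
  have pos: "0 < A q" if q: "q \<in> sphere 0 1" "B q = 0" for q
  proof -
    have N0: "N q = 0"
      using q(2) by (simp add: B_def add_nonneg_eq_0_iff)
    have Ni: "hom_poly (dcoeff i c) (a + 1) q = 0" for i
      using N0 by (simp add: N_def vec_eq_iff)
    have f: "f = hom_poly c (Suc (a + 1))" by (simp add: f_def hom_term_def c_def l1)
    have f0: "f q = 0"
      using euler_identity[of q c "a + 1"] unfolding Ni f by simp
    have deriv: "(f has_derivative (\<lambda>_. 0)) (at q)"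
      using hom_poly_has_derivative[of c "a + 1" q] unfolding Ni f by simp
    have "sphere_critical_point f q"
      using q(1) deriv frechet_derivative_at[OF deriv]
      by (auto simp: sphere_critical_point_def differentiable_def fun_eq_iff)
    then have "0 < C q" using f0 \<open>\<And>q. sphere_critical_point f q \<Longrightarrow> f q \<le> 0 \<Longrightarrow> C q > 0\<close> by simp
    \<comment> \<open>The metric term of C carries the vanishing factor U_l1(q). If k < l2 - l1,
      then A q = 0 by definition, and positivity of C q becomes a contradiction: N has no zero on
      the sphere.\<close>
    also have "C q = A q"
    proof -
      have "hom_term U l1 q = 0" using f0 by (simp add: f_def)
      moreover have "\<kappa> = enat (l2 - l1) \<longleftrightarrow> a + 2 + k = l2"
        using k deg(1) by (auto simp: l1)
      moreover have "hom_term U l2 q = hom_poly c l2 q" by (simp add: hom_term_def c_def)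
      ultimately show ?thesis
        unfolding C_def A_def by (cases "a + 2 + k = l2") (simp_all only: l1 simp_thms if_True if_False mult_zero_left
          mult_zero_right if_cancel add_0_right minus_mult_left minus_zero)
    qed
    finally show ?thesis .
  qed
  have contA: "continuous_on (sphere 0 1) A"
    unfolding A_def[abs_def]
    by (cases "a + 2 + k = l2") (simp_all add: continuous_on_mult_left continuous_on_minus continuous_on_hom_poly)
  have contB: "continuous_on (sphere 0 1) B"
    unfolding B_def[abs_def] N_def by (intro continuous_intros continuous_on_hom_poly)
  obtain \<eta> c0 where \<eta>: "0 \<le> \<eta>" "0 < c0" "\<And>q. q \<in> sphere 0 1 \<Longrightarrow> c0 \<le> A q + \<eta> * B q"
    using compact_penalization[OF compact_sphere contA contB _ pos] by (auto simp: B_def)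
  have "\<exists>\<rho> K. lagrangian_lyapunov W g \<sigma> U \<rho> K c a k D \<eta> c0"
    using deg[unfolded l1] k(2) k1 D \<eta>
    by (intro lagrangian_lyapunov_exists[OF \<open>open W\<close> \<open>0 \<in> W\<close> \<open>riemannian_metric_on g W\<close> \<open>g 0 = mat 1\<close>
          hU h\<sigma> hg, of a l2 D k \<eta> c0]) (auto simp: l1 A_def B_def N_def)
  then obtain \<rho> K where "lagrangian_lyapunov W g \<sigma> U \<rho> K c a k D \<eta> c0" by blast
  then interpret lagrangian_lyapunov W g \<sigma> U \<rho> K c a k D \<eta> c0 .
  have "ball 0 radius \<subseteq> W"
    using subset_ball[of radius \<rho> 0] radius_le(1) \<rho> by force
  then show ?thesis
    using radius_pos omega_limit_contains_origin by (intro exI[of _ "ball 0 radius"]) simp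
qed

end
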